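(* Let $p\equiv 1 \pmod 4$ be a prime. Let $\{a_s\}_{s=1}^{(p-1)/2}$ be positive integers forming a complete set of representatives of the quadratic residues modulo $p$, and let $\{b_s\}_{s=1}^{(p-1)/2}$ be positive integers forming a complete set of representatives of the quadratic non-residues modulo $p$ (the $a_s,b_s$ need not lie in $[1,p]$). Put $A^*=\prod_{s=1}^{(p-1)/2} a_s$ and $B^*=\prod_{s=1}^{(p-1)/2} b_s$. Let $\varepsilon=\frac{1}{2}(t+u\sqrt{p})$ be the fundamental unit of $\mathbb{Q}(\sqrt{p})$, with $t,u$ positive integers, and let $h$ be the class number of $\mathbb{Q}(\sqrt p)$. Then $$\frac{A^*+B^*}{p}\equiv \frac{2hu}{t}+\left(A^*\sum_{s=1}^{(p-1)/2}\left[\frac{a_s}{p}\right]\frac{1}{a_s}+B^*\sum_{s=1}^{(p-1)/2}\left[\frac{b_s}{p}\right]\frac{1}{b_s}\right)\pmod p .$$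
   Context: $[x]$ denotes the floor (greatest integer $\le x$). Quadratic residues modulo $p$ are the nonzero squares modulo $p$; "complete set" means each of the $(p-1)/2$ nonzero residue classes of the given type is represented exactly once. Congruences modulo $p$ between rational numbers whose denominators are prime to $p$ are understood in the localization $\mathbb{Z}_{(p)}$, i.e. division is by inverses modulo $p$. *)

theory Defs
  imports
    "HOL-Computational_Algebra.Computational_Algebra"
    "HOL-Number_Theory.Number_Theory"
    "HOL-Algebra.Ideal"
begin

section \<open>Real quadratic fields\<close>

text \<open>The field \<open>\<rat>(\<surd>d)\<close>, embedded in the reals.\<close>

definition quadratic_field :: "nat \<Rightarrow> real set" where
  "quadratic_field d = {x + y * sqrt (real d) | x y. x \<in> \<rat> \<and> y \<in> \<rat>}"

definition ring_of_integers :: "nat \<Rightarrow> real ring" where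
  "ring_of_integers d =
     \<lparr>carrier = {x \<in> quadratic_field d. algebraic_int x},
      mult = (*), one = 1, zero = 0, add = (+)\<rparr>"

text \<open>A fundamental unit generates the unit group modulo \<open>\<plusminus>1\<close>; it is normalised to exceed \<open>1\<close>,
  which makes it unique.\<close>

definition fundamental_unit :: "nat \<Rightarrow> real \<Rightarrow> bool" where
  "fundamental_unit d \<epsilon> \<longleftrightarrow>
     \<epsilon> \<in> Units (ring_of_integers d) \<and> \<epsilon> > 1 \<and>
     (\<forall>\<eta>\<in>Units (ring_of_integers d). \<exists>n::int. \<eta> = \<epsilon> powi n \<or> \<eta> = - (\<epsilon> powi n))"

text \<open>The class number counts nonzero integral ideals modulo \<open>I \<sim> J \<longleftrightarrow> \<alpha>I = \<beta>J\<close> for some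
  nonzero integers \<open>\<alpha>, \<beta>\<close> of the field; every class of fractional ideals has an integral
  representative, so this is the order of the ideal class group (in the wide sense: no sign
  condition on \<open>\<alpha>\<close>, \<open>\<beta>\<close>).\<close>

definition nonzero_ideals :: "nat \<Rightarrow> real set set" where
  "nonzero_ideals d = {I. ideal I (ring_of_integers d) \<and> I \<noteq> {0}}"

definition ideal_class_rel :: "nat \<Rightarrow> (real set \<times> real set) set" where
  "ideal_class_rel d =
     {(I, J). I \<in> nonzero_ideals d \<and> J \<in> nonzero_ideals d \<and>
        (\<exists>\<alpha>\<in>carrier (ring_of_integers d) - {0}. \<exists>\<beta>\<in>carrier (ring_of_integers d) - {0}.
           (*) \<alpha> ` I = (*) \<beta> ` J)}"

definition class_number :: "nat \<Rightarrow> nat" where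
  "class_number d = card (nonzero_ideals d // ideal_class_rel d)"

section \<open>Congruences between rational numbers\<close>

text \<open>The localization of the integers at a prime \<open>p\<close>, as a subset of the rationals.\<close>

definition Z_localized :: "nat \<Rightarrow> rat set" where
  "Z_localized p = {x. coprime (int p) (snd (quotient_of x))}"

text \<open>Both sides are required to be \<open>p\<close>-integral.\<close>

definition rat_cong :: "nat \<Rightarrow> rat \<Rightarrow> rat \<Rightarrow> bool" where
  "rat_cong p x y \<longleftrightarrow>
     x \<in> Z_localized p \<and> y \<in> Z_localized p \<and> (\<exists>z\<in>Z_localized p. x - y = of_nat p * z)"

section \<open>Systems of representatives\<close>

definition complete_residue_reps :: "nat \<Rightarrow> (nat \<Rightarrow> nat) \<Rightarrow> bool" where
  "complete_residue_reps p a \<longleftrightarrow>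
     bij_betw (\<lambda>s. a s mod p) {1..(p - 1) div 2} {r \<in> {1..<p}. QuadRes (int p) (int r)}"

definition complete_nonresidue_reps :: "nat \<Rightarrow> (nat \<Rightarrow> nat) \<Rightarrow> bool" where
  "complete_nonresidue_reps p b \<longleftrightarrow>
     bij_betw (\<lambda>s. b s mod p) {1..(p - 1) div 2} {r \<in> {1..<p}. \<not> QuadRes (int p) (int r)}"

end

theory Submission
  imports Defs "HOL-Complex_Analysis.Complex_Analysis"
begin

text \<open>
  Let \<open>\<chi>\<close> be the quadratic character modulo \<open>p\<close>, let \<open>m = (p - 1) / 2\<close>, and let \<open>\<zeta>\<close> be a primitive \<open>p\<close>-th
  root of unity whose Gauss sum is \<open>+\<surd>p\<close>. Counting the ideals of norm at most \<open>N\<close> in two ways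
  (class by class, as lattice points in a hyperbolic sector, and through the divisor sums of \<open>\<chi>\<close>)
  gives \<open>2 h ln \<epsilon> = \<surd>p L(1, \<chi>)\<close>. Evaluating \<open>L(1, \<chi>)\<close> with the Gauss sum turns this into
  \<open>\<Prod>\<^sub>n \<bar>1 - \<zeta>\<^sup>n\<bar> = \<epsilon>\<^bsup>2h\<^esup> \<Prod>\<^sub>r \<bar>1 - \<zeta>\<^sup>r\<bar>\<close>, where \<open>r\<close> runs over the residues and \<open>n\<close> over the non-residues.

  Up to a sign this is an identity between integer polynomials in \<open>\<zeta>\<close>, hence a congruence modulo the
  \<open>p\<close>-th cyclotomic polynomial. The latter vanishes modulo \<open>p\<close> and \<open>y\<^bsup>p-1\<^esup>\<close> at \<open>e\<^sup>y\<close>; substituting \<open>e\<^sup>y\<close> for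
  \<open>\<zeta>\<close> and comparing the coefficients of \<open>y\<^bsup>m-1\<^esup>\<close> in the logarithmic derivatives yields
  \<open>h u / t \<equiv> B\<^sub>m\<close> modulo \<open>p\<close>, where \<open>B\<^sub>m\<close> is the Bernoulli number. On the other hand, the products \<open>A\<close> and \<open>B\<close> of the
  least positive residues and non-residues satisfy \<open>A\<^sup>m - B\<^sup>m \<equiv> \<Sum> j\<^sup>m \<equiv> p B\<^sub>m\<close> modulo \<open>p\<^sup>2\<close>, while
  \<open>A \<equiv> -1\<close> and \<open>B \<equiv> 1\<close> modulo \<open>p\<close>, so that \<open>(A + B) / p \<equiv> 2 B\<^sub>m\<close>. Other representatives change
  \<open>A\<close> and \<open>B\<close> by the sums over the integer parts.
\<close>

section \<open>The quadratic character and roots modulo \<open>n\<close>\<close>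

text \<open>Ideals are handled through the normal form d (a, omega - b), where b is a root modulo a
  of the minimal polynomial of omega = (1 + sqrt p) / 2. Counting ideals thus becomes counting roots
  of a quadratic polynomial, and quadratic reciprocity turns the root count into \<open>chi\<close>.
  The analytic part controls only absolute values, so the polynomial identity carries an unknown
  sign and a factor 4^h; logarithmic derivatives remove both constants. The coefficient of y^(m-1)
  is the one to compare for the following reason. When e^y replaces zeta, the Gauss sum, which
  stands for sqrt p, becomes modulo p the series - y^m / m! up to higher order. So (t + u sqrt
  p)^(2h) is constant up to y^m, and the first nonzero coefficient of its logarithmic derivative is
  - 2 m h u / (t m!) at y^(m-1); since 2 m = p - 1, this is h u / (t m!) modulo p. The factorials in
  e^y are prime to p below degree p, which leaves room well beyond degree m.\<close>

locale quad_prime =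
  fixes p :: nat
  assumes prime_p: "prime p" and p_mod_4: "p mod 4 = 1"
begin

definition q0 :: int where "q0 = int ((p - 1) div 4)"

definition half :: nat where "half = (p - 1) div 2"

definition chi :: "nat \<Rightarrow> int" where "chi n = Legendre (int n) (int p)"

lemma p_ge_5: "p \<ge> 5"
proof -
  have "p \<noteq> 1" using prime_p by auto
  moreover have "p \<noteq> 0" using p_mod_4 by auto
  moreover have "p \<noteq> 2" "p \<noteq> 3" "p \<noteq> 4" using p_mod_4 by auto
  ultimately show ?thesis by linarith
qed

lemma p_eq: "int p = 4 * q0 + 1"
  using p_mod_4 unfolding q0_def by (simp add: zdiv_int) presburger

lemma half_eq: "half = 2 * nat q0"
proof -
  have "nat q0 = (p - 1) div 4" unfolding q0_def by (simp only: nat_int)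
  moreover have "(p - 1) div 2 = 2 * ((p - 1) div 4)" using p_mod_4 by presburger
  ultimately show ?thesis unfolding half_def by simp
qed

lemma p_eq_half: "p = 2 * half + 1"
  using p_mod_4 unfolding half_def by presburger

lemma q0_pos: "q0 > 0"
  using p_eq p_ge_5 by linarith

lemma half_ge_2: "half \<ge> 2"
  using p_eq_half p_ge_5 by linarith

lemma chi_cong: "[chi n = int n ^ half] (mod int p)"
  using euler_criterion[OF prime_p, of "int n"] p_ge_5 unfolding chi_def half_def by simp

lemma chi_cases: "chi n = 0 \<or> chi n = 1 \<or> chi n = -1"
  unfolding chi_def Legendre_def by auto

lemma chi_eq_0_iff: "chi n = 0 \<longleftrightarrow> p dvd n"
  unfolding chi_def Legendre_def by (auto simp: cong_0_iff)

text \<open>The values 0, 1, -1 are pairwise incongruent modulo p because p is at least 5, so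
  identities for \<open>chi\<close> can be read off from Euler's criterion.\<close>

lemma chi_eqI:
  assumes "[x = y] (mod int p)" "x \<in> {0, 1, -1}" "y \<in> {0, 1, -1}"
  shows "x = y"
proof -
  have "int p dvd x - y" using assms(1) by (simp add: cong_iff_dvd_diff)
  moreover have "\<bar>x - y\<bar> < int p" using assms(2,3) p_ge_5 by auto
  ultimately show ?thesis using zdvd_imp_le[of "int p" "\<bar>x - y\<bar>"] by fastforce
qed

lemma chi_mult: "chi (a * b) = chi a * chi b"
proof (rule chi_eqI)
  have "[chi (a * b) = int (a * b) ^ half] (mod int p)" by (rule chi_cong)
  also have "int (a * b) ^ half = int a ^ half * int b ^ half" by (simp add: power_mult_distrib)
  also have "[\<dots> = chi a * chi b] (mod int p)"
    by (intro cong_mult cong_sym[OF chi_cong])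
  finally show "[chi (a * b) = chi a * chi b] (mod int p)" .
qed (use chi_cases[of a] chi_cases[of b] chi_cases[of "a * b"] in auto)

lemma chi_1 [simp]: "chi 1 = 1" "chi (Suc 0) = 1"
proof -
  show "chi 1 = 1"
    using chi_mult[of 1 1] chi_eq_0_iff[of 1] prime_p by (auto simp: not_prime_1)
  thus "chi (Suc 0) = 1" by simp
qed

lemma chi_power: "chi (a ^ k) = chi a ^ k"
  by (induction k) (auto simp: chi_mult)

lemma chi_congI: "[a = b] (mod p) \<Longrightarrow> chi a = chi b"
proof (rule chi_eqI)
  assume "[a = b] (mod p)"
  hence ab: "[int a = int b] (mod int p)" by (simp add: cong_int_iff)
  have "[chi a = int a ^ half] (mod int p)" by (rule chi_cong)
  also have "[int a ^ half = int b ^ half] (mod int p)" by (rule cong_pow[OF ab])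
  also have "[int b ^ half = chi b] (mod int p)" by (rule cong_sym[OF chi_cong])
  finally show "[chi a = chi b] (mod int p)" .
qed (use chi_cases[of a] chi_cases[of b] in auto)

lemma chi_mod [simp]: "chi (n mod p) = chi n"
  by (rule chi_congI) simp

text \<open>By Euler's criterion a primitive root is a non-residue, since \<open>half\<close> is
  smaller than its order. It serves below as the standard multiplier that flips the sign of
  \<open>chi\<close>.\<close>

lemma primroot_exists:
  obtains g where "coprime g p" "ord p g = p - 1" "chi g = -1"
proof -
  obtain g where g: "residue_primroot p g" using prime_p prime_primitive_root_exists[of p] prime_gt_1_nat by blast
  hence co: "coprime p g" and o: "ord p g = p - 1"
    using prime_p by (auto simp: residue_primroot_def totient_prime)
  have "\<not> [g ^ half = 1] (mod p)"
    using o p_eq_half half_ge_2 ord_divides[of g half p] by (auto dest: dvd_imp_le)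
  hence "\<not> [int g ^ half = 1] (mod int p)"
    using cong_int_iff[of "g ^ half" 1 p] by simp
  hence "chi g \<noteq> 1" using chi_cong[of g] by (metis cong_sym)
  moreover have "chi g \<noteq> 0" using co prime_p by (auto simp: chi_eq_0_iff coprime_absorb_left)
  ultimately have "chi g = -1" using chi_cases[of g] by auto
  thus ?thesis using that[of g] co o by (simp add: coprime_commute)
qed

text \<open>With \<open>i\<^sup>2 = -1\<close> one has \<open>(1 + i)\<^sup>2 = 2 i\<close>, so \<open>\<chi>(2) = \<chi>(i)\<close>.\<close>

lemma chi_2: "chi 2 = (-1) ^ nat q0"
proof -
  obtain g where g: "coprime g p" "ord p g = p - 1" "chi g = -1" by (rule primroot_exists)
  define i where "i = g ^ nat q0"
  have "[int i ^ 2 = -1] (mod int p)"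
    using chi_cong[of g] g(3) half_eq unfolding i_def
    by (simp add: cong_sym power_mult[symmetric] mult.commute)
  hence "[(1 + 2 * int i) + int i ^ 2 = (1 + 2 * int i) + (-1)] (mod int p)" by (intro cong_add) auto
  hence "[int ((1 + i) ^ 2) = int (2 * i)] (mod int p)"
    by (simp add: power2_eq_square algebra_simps)
  hence "[(1 + i) ^ 2 = 2 * i] (mod p)" using cong_int_iff by blast
  hence "chi (1 + i) ^ 2 = chi 2 * chi i" using chi_congI chi_power chi_mult by metis
  moreover have "chi i = (-1) ^ nat q0" unfolding i_def by (simp add: chi_power g(3))
  moreover have "chi 2 \<noteq> 0" unfolding chi_eq_0_iff using p_ge_5 by (auto dest: dvd_imp_le)
  ultimately show ?thesis
    using chi_cases[of 2] chi_cases[of "1+i"] by (cases "even (nat q0)") auto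
qed

text \<open>\<open>froot b\<close> is the norm of \<open>\<omega> - b\<close>, where \<open>\<omega> = (1 + \<surd>p) / 2\<close>.\<close>

definition froot :: "int \<Rightarrow> int" where "froot b = b\<^sup>2 - b - q0"

lemma froot_4: "4 * froot b = (2 * b - 1)\<^sup>2 - int p"
  unfolding froot_def p_eq by (simp add: power2_eq_square algebra_simps)

lemma froot_diff: "froot (b + c) = froot b + c * (2 * b - 1) + c\<^sup>2"
  unfolding froot_def by (simp add: power2_eq_square algebra_simps)

lemma froot_cong: "[a = b] (mod n) \<Longrightarrow> [froot a = froot b] (mod n)"
  unfolding froot_def by (intro cong_diff cong_pow) auto

definition Rho :: "nat \<Rightarrow> int set" where
  "Rho n = {b \<in> {0..<int n}. int n dvd froot b}"

definition rho :: "nat \<Rightarrow> nat" where "rho n = card (Rho n)"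

lemma finite_Rho [simp]: "finite (Rho n)"
  by (rule finite_subset[of _ "{0..<int n}"]) (auto simp: Rho_def)

lemma Rho_1: "Rho 1 = {0}"
  unfolding Rho_def by auto

lemma rho_1 [simp]: "rho 1 = 1" "rho (Suc 0) = 1"
  using Rho_1 unfolding rho_def by auto

lemma mod_in_Rho: "n > 0 \<Longrightarrow> int n dvd froot b \<Longrightarrow> b mod int n \<in> Rho n"
  unfolding Rho_def using froot_cong[of "b mod int n" b "int n"]
  by (auto simp: cong_dvd_iff)

lemma rho_mult:
  assumes "coprime m n" "m > 0" "n > 0"
  shows "rho (m * n) = rho m * rho n"
proof -
  let ?g = "\<lambda>b. (b mod int m, b mod int n)"
  have co: "coprime (int m) (int n)" using assms by simp
  have "bij_betw ?g (Rho (m * n)) (Rho m \<times> Rho n)"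
  proof (rule bij_betwI')
    fix x y assume xy: "x \<in> Rho (m * n)" "y \<in> Rho (m * n)"
    show "(?g x = ?g y) = (x = y)"
    proof
      assume "?g x = ?g y"
      hence "[x = y] (mod int m)" "[x = y] (mod int n)" unfolding Cong.cong_def by simp_all
      hence "[x = y] (mod int m * int n)" using co coprime_cong_mult by blast
      thus "x = y" using xy unfolding Rho_def by (auto simp: Cong.cong_def)
    qed auto
  next
    fix x assume x: "x \<in> Rho (m * n)"
    hence "int m dvd froot x" "int n dvd froot x" unfolding Rho_def
      by (auto elim: dvd_mult_left dvd_mult_right)
    thus "?g x \<in> Rho m \<times> Rho n" using assms mod_in_Rho by auto
  next
    fix y assume "y \<in> Rho m \<times> Rho n"
    then obtain y1 y2 where y: "y = (y1, y2)" "y1 \<in> Rho m" "y2 \<in> Rho n" by auto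
    obtain x where x: "[x = y1] (mod int m)" "[x = y2] (mod int n)"
      using binary_chinese_remainder_int[OF co] by blast
    have "int m dvd froot x" "int n dvd froot x"
      using y x froot_cong cong_dvd_iff unfolding Rho_def by blast+
    hence "int (m * n) dvd froot x" using co by (simp add: divides_mult)
    hence "x mod int (m * n) \<in> Rho (m * n)" using assms by (intro mod_in_Rho) auto
    moreover have "?g (x mod int (m * n)) = y"
      using x y unfolding Rho_def by (auto simp: Cong.cong_def mod_mod_cancel)
    ultimately show "\<exists>x\<in>Rho (m * n). y = ?g x" by metis
  qed
  thus ?thesis unfolding rho_def using bij_betw_same_card card_cartesian_product by metis
qed

text \<open>Hensel lifting. The discriminant of \<open>froot\<close> is p, so for q different from p
  the derivative 2 b - 1 is invertible modulo q at every root, and each root modulo q^k lifts in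
  exactly one way.\<close>

lemma rho_Suc:
  assumes "prime q" "q \<noteq> p" "k > 0"
  shows "rho (q ^ Suc k) = rho (q ^ k)"
proof -
  let ?Q = "int q ^ k"
  have q0: "q > 0" using assms prime_gt_0_nat by auto
  have Qpos: "?Q > 0" using q0 by auto
  have co: "coprime (int q) (2 * b - 1)" if "int q dvd froot b" for b
  proof (rule ccontr)
    assume "\<not> ?thesis"
    hence "int q dvd 2 * b - 1" using assms by (meson prime_imp_coprime prime_int_nat_transfer prime_nat_int_transfer)
    hence "int q dvd (2*b-1)\<^sup>2 - 4 * froot b" using that by (intro dvd_diff) (auto simp: power2_eq_square)
    hence "int q dvd int p" unfolding froot_4 by simp
    thus False using assms prime_p primes_dvd_imp_eq by (metis int_dvd_int_iff)
  qed
  \<comment> \<open>Taylor expansion at b: the quadratic term contains the square of q^k, which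
    q^(k+1) divides because k > 0. Only a linear condition on j remains.\<close>
  have key: "int q ^ Suc k dvd froot (b + j * ?Q) \<longleftrightarrow> int q dvd froot b div ?Q + j * (2 * b - 1)"
    if fb: "?Q dvd froot b" for b j
  proof -
    obtain c where c: "froot b = ?Q * c" using fb by (elim dvdE)
    have "froot (b + j * ?Q) = ?Q * (c + j * (2 * b - 1)) + (j^2 * int q ^ (k - 1)) * int q ^ Suc k"
    proof -
      have "int q ^ (k - 1) * int q ^ Suc k = ?Q ^ 2"
      proof -
        have "k - 1 + Suc k = k + k" using assms(3) by simp
        thus ?thesis unfolding power2_eq_square power_add[symmetric] by (simp only:)
      qed
      thus ?thesis by (simp add: froot_diff c algebra_simps power_mult_distrib)
    qed
    hence "int q ^ Suc k dvd froot (b + j * ?Q) \<longleftrightarrow> int q ^ Suc k dvd ?Q * (c + j * (2 * b - 1))"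
      by (simp add: dvd_add_left_iff)
    also have "\<dots> \<longleftrightarrow> int q dvd c + j * (2 * b - 1)" using q0 by simp
    finally show ?thesis using c Qpos by simp
  qed
  have "bij_betw (\<lambda>b. b mod ?Q) (Rho (q ^ Suc k)) (Rho (q ^ k))"
  proof (rule bij_betwI')
    fix x y assume xy: "x \<in> Rho (q ^ Suc k)" "y \<in> Rho (q ^ Suc k)"
    show "(x mod ?Q = y mod ?Q) = (x = y)"
    proof
      assume "x mod ?Q = y mod ?Q"
      then obtain j where j: "y = x + j * ?Q"
        by (metis mod_eqE mult.commute)
      have fx: "?Q dvd froot x" "int q dvd froot x" using xy assms(3) unfolding Rho_def
        by (auto intro: dvd_mult_right dvd_mult_left)
      have "int q dvd froot x div ?Q + j * (2 * x - 1)"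
        using key[OF fx(1), of j] xy unfolding j Rho_def by simp
      moreover have "int q dvd froot x div ?Q + 0 * (2 * x - 1)"
        using key[OF fx(1), of 0] xy unfolding Rho_def by simp
      ultimately have "int q dvd j * (2 * x - 1)" by (simp add: dvd_add_right_iff)
      hence "int q dvd j" using co[OF fx(2)] by (simp add: coprime_dvd_mult_left_iff)
      hence "[x = y] (mod int q ^ Suc k)" unfolding j cong_iff_dvd_diff by (auto elim!: dvdE)
      thus "x = y" using xy unfolding Rho_def by (auto simp: Cong.cong_def)
    qed auto
  next
    fix x assume "x \<in> Rho (q ^ Suc k)"
    hence "int (q ^ k) dvd froot x" unfolding Rho_def by (auto intro: dvd_mult_right)
    thus "x mod ?Q \<in> Rho (q ^ k)" using mod_in_Rho[of "q^k" x] q0 by simp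
  next
    fix b assume b: "b \<in> Rho (q ^ k)"
    have fb: "?Q dvd froot b" using b unfolding Rho_def by simp
    have "int q dvd froot b" using fb assms(3) by (meson dvd_power dvd_trans)
    then obtain y where y: "[(2 * b - 1) * y = 1] (mod int q)"
      using co[of b] cong_solve_coprime_int[of "2*b-1" "int q"] by (auto simp: coprime_commute)
    \<comment> \<open>The Newton step: j solves the linear congruence of \<open>key\<close>, y being
      the inverse of the derivative.\<close>
    define j where "j = - (froot b div ?Q) * y"
    have "[froot b div ?Q + j * (2 * b - 1) = froot b div ?Q - (froot b div ?Q) * 1] (mod int q)"
    proof -
      have "froot b div ?Q + j * (2 * b - 1) = froot b div ?Q - (froot b div ?Q) * ((2 * b - 1) * y)"
        unfolding j_def by (simp add: algebra_simps)
      thus ?thesis using y by (metis cong_diff cong_mult cong_refl)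
    qed
    hence "int q dvd froot b div ?Q + j * (2 * b - 1)" by (simp add: cong_0_iff)
    hence "int (q ^ Suc k) dvd froot (b + j * ?Q)" using key[OF fb] by simp
    hence "(b + j * ?Q) mod int (q ^ Suc k) \<in> Rho (q ^ Suc k)" using q0 by (intro mod_in_Rho) auto
    moreover have "((b + j * ?Q) mod int (q ^ Suc k)) mod ?Q = b"
      using b unfolding Rho_def by (simp add: mod_mod_cancel)
    ultimately show "\<exists>x\<in>Rho (q ^ Suc k). b = x mod ?Q" by metis
  qed
  thus ?thesis unfolding rho_def using bij_betw_same_card by blast
qed

text \<open>Completing the square turns roots modulo an odd prime q into square roots of p modulo q.
  Reciprocity has no sign here because p is 1 modulo 4, so the count depends on
  \<open>chi q\<close>. The primes 2 and p are treated by hand.\<close>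

lemma rho_prime:
  assumes q: "prime q"
  shows "int (rho q) = 1 + chi q"
proof -
  consider "q = 2" | "q = p" | "q > 2" "q \<noteq> p" using prime_ge_2_nat[OF q] by fastforce
  thus ?thesis
  proof cases
    case 1
    \<comment> \<open>As b^2 - b is always even, everything depends on the parity of
      \<open>q0\<close>, which also determines \<open>chi 2\<close>.\<close>
    have "Rho 2 = (if even q0 then {0, 1} else {})"
    proof -
      have *: "{0..<int 2} = {0, 1}" by auto
      show ?thesis unfolding Rho_def * froot_def by auto
    qed
    hence "rho 2 = (if even q0 then 2 else 0)" unfolding rho_def by auto
    moreover have "even (nat q0) = even q0" using q0_pos by (simp add: even_nat_iff)
    ultimately show ?thesis using chi_2 1 by auto
  next
    case 2
    \<comment> \<open>The double root of the ramified prime: 2 b - 1 must vanish modulo p, which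
      gives b = (p + 1) / 2.\<close>
    have "Rho p = {2 * q0 + 1}"
    proof (intro equalityI subsetI)
      fix b assume "b \<in> Rho p"
      hence b: "0 \<le> b" "b < int p" "int p dvd froot b" unfolding Rho_def by auto
      hence "int p dvd 4 * froot b + int p" by (intro dvd_add dvd_mult) auto
      hence "int p dvd (2 * b - 1)\<^sup>2" unfolding froot_4 by simp
      hence "int p dvd 2 * b - 1" using prime_p prime_dvd_power[of "int p" "2 * b - 1" 2] by simp
      then obtain k where k: "2 * b - 1 = int p * k" by (elim dvdE)
      have "int p * k < int p * 2" "int p * (-1) < int p * k"
        using b p_ge_5 k by linarith+
      moreover have "int p > 0" using p_ge_5 by simp
      ultimately have "k < 2" "-1 < k" by (simp_all only: mult_less_cancel_left_pos)
      hence "k = 0 \<or> k = 1" by auto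
      moreover have "k \<noteq> 0"
      proof
        assume "k = 0"
        hence "2 * b = 1" using k by simp
        thus False by presburger
      qed
      ultimately show "b \<in> {2 * q0 + 1}" using k p_eq by auto
    next
      fix b assume "b \<in> {2 * q0 + 1}"
      hence b: "b = 2 * q0 + 1" by simp
      have "froot b = q0 * int p" unfolding froot_def b p_eq by (simp add: power2_eq_square algebra_simps)
      thus "b \<in> Rho p" unfolding Rho_def using b p_eq q0_pos by auto
    qed
    thus ?thesis using 2 chi_eq_0_iff[of p] unfolding rho_def by simp
  next
    case 3
    have odd: "odd q" using q 3 prime_odd_nat by auto
    have co2: "coprime (2::int) (int q)" "coprime (4::int) (int q)" using odd
      by (auto simp: coprime_left_2_iff_odd intro: coprime_power_left_iff[of 2 2 "int q", THEN iffD2, simplified])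
    have npq: "\<not> q dvd p" "\<not> p dvd q" using 3 q prime_p primes_dvd_imp_eq by blast+
    have chi_q: "chi q = Legendre (int p) (int q)"
    proof -
      have "Legendre (int p) (int q) * Legendre (int q) (int p) = (-1::int) ^ ((p - 1) div 2 * ((q - 1) div 2))"
        using prime_p q 3 p_ge_5 by (intro Quadratic_Reciprocity) auto
      also have "\<dots> = 1" using half_eq unfolding half_def by simp
      finally have "Legendre (int p) (int q) * chi q = 1" unfolding chi_def .
      thus ?thesis using chi_cases[of q] by auto
    qed
    have np: "\<not> [int p = 0] (mod int q)" using npq by (simp add: cong_0_iff)
    have dvd_iff: "int q dvd froot b \<longleftrightarrow> int q dvd (2 * b - 1)\<^sup>2 - int p" for b
      unfolding froot_4[symmetric] using co2(2)
      by (subst coprime_dvd_mult_right_iff) (auto simp: coprime_commute)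
    show ?thesis
    proof (cases "QuadRes (int q) (int p)")
      case False
      hence "Rho q = {}" unfolding Rho_def dvd_iff QuadRes_def by (auto simp: cong_iff_dvd_diff)
      thus ?thesis using chi_q False np unfolding rho_def Legendre_def by simp
    next
      case True
      then obtain y where y: "[y\<^sup>2 = int p] (mod int q)" unfolding QuadRes_def by auto
      obtain i where i: "[2 * i = 1] (mod int q)"
        using cong_solve_coprime_int[of 2 "int q"] co2 by auto
      define r1 where "r1 = (i * (1 + y)) mod int q"
      define r2 where "r2 = (i * (1 - y)) mod int q"
      have qpos: "int q > 0" using 3 by simp
      have inv: "[2 * ((i * z) mod int q) = z] (mod int q)" for z
      proof -
        have "[2 * ((i * z) mod int q) = 2 * (i * z)] (mod int q)" by (intro cong_mult) (auto simp: Cong.cong_def)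
        also have "2 * (i * z) = (2 * i) * z" by simp
        also have "[(2 * i) * z = 1 * z] (mod int q)" using i by (intro cong_mult) auto
        finally show ?thesis by simp
      qed
      have ny: "\<not> int q dvd y"
      proof
        assume "int q dvd y"
        hence "int q dvd y\<^sup>2" by (simp add: power2_eq_square)
        thus False using y np by (meson cong_0_iff cong_sym cong_trans)
      qed
      have ne: "r1 \<noteq> r2"
      proof
        assume "r1 = r2"
        hence "[1 + y = 1 - y] (mod int q)" using inv[of "1 + y"] inv[of "1 - y"] unfolding r1_def r2_def
          by (metis cong_sym cong_trans)
        hence "int q dvd 2 * y" by (simp add: cong_iff_dvd_diff)
        thus False using ny co2(1) coprime_dvd_mult_right_iff coprime_commute by metis
      qed
      have "b \<in> Rho q \<longleftrightarrow> b = r1 \<or> b = r2" for b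
      proof
        assume "b = r1 \<or> b = r2"
        hence "[2 * b = 1 + y] (mod int q) \<or> [2 * b = 1 - y] (mod int q)"
          using inv unfolding r1_def r2_def by blast
        hence "[2 * b - 1 = 1 + y - 1] (mod int q) \<or> [2 * b - 1 = 1 - y - 1] (mod int q)"
          by (meson cong_diff cong_refl)
        hence "[(2 * b - 1)\<^sup>2 = y\<^sup>2] (mod int q)" using cong_pow[of "2*b-1" _ "int q" 2] by fastforce
        hence "[(2 * b - 1)\<^sup>2 = int p] (mod int q)" using y cong_trans by blast
        hence "int q dvd froot b" unfolding dvd_iff by (simp add: cong_iff_dvd_diff)
        moreover have "0 \<le> b \<and> b < int q" using \<open>b = r1 \<or> b = r2\<close> qpos unfolding r1_def r2_def by auto
        ultimately show "b \<in> Rho q" unfolding Rho_def by auto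
      next
        assume b: "b \<in> Rho q"
        hence "int q dvd (2 * b - 1)\<^sup>2 - int p" unfolding Rho_def dvd_iff by auto
        moreover have "int q dvd y\<^sup>2 - int p" using y by (simp add: cong_iff_dvd_diff)
        ultimately have "int q dvd ((2 * b - 1)\<^sup>2 - int p) - (y\<^sup>2 - int p)" by (rule dvd_diff)
        also have "\<dots> = (2 * b - (1 + y)) * (2 * b - (1 - y))" by (simp add: power2_eq_square algebra_simps)
        finally have "int q dvd 2 * b - (1 + y) \<or> int q dvd 2 * b - (1 - y)"
          using q prime_dvd_mult_iff[of "int q"] by simp
        hence "[2 * b = 1 + y] (mod int q) \<or> [2 * b = 1 - y] (mod int q)" by (simp add: cong_iff_dvd_diff)
        hence "[2 * b = 2 * r1] (mod int q) \<or> [2 * b = 2 * r2] (mod int q)"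
          using inv[of "1 + y"] inv[of "1 - y"] unfolding r1_def r2_def by (meson cong_sym cong_trans)
        hence "[b = r1] (mod int q) \<or> [b = r2] (mod int q)"
          using co2(1) cong_mult_lcancel by blast
        thus "b = r1 \<or> b = r2" using b qpos unfolding Rho_def r1_def r2_def by (auto simp: Cong.cong_def)
      qed
      hence "Rho q = {r1, r2}" by auto
      thus ?thesis using chi_q True np ne unfolding rho_def Legendre_def by simp
    qed
  qed
qed

text \<open>At a root modulo p the number 2 b - 1 is divisible by p, so (2 b - 1)^2 - p, which is 4
  \<open>froot b\<close>, contains p exactly once.\<close>

lemma rho_p_power: "rho (p ^ Suc (Suc k)) = 0"
proof -
  have "\<not> int (p ^ Suc (Suc k)) dvd froot b" for b
  proof
    assume a: "int (p ^ Suc (Suc k)) dvd froot b"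
    have "(int p)\<^sup>2 dvd int (p ^ Suc (Suc k))" by (simp add: power2_eq_square)
    hence p2: "(int p)\<^sup>2 dvd froot b" using a dvd_trans by blast
    hence "int p dvd 4 * froot b + int p" by (intro dvd_add dvd_mult) (auto simp: power2_eq_square elim: dvd_mult_left)
    hence "int p dvd (2 * b - 1)\<^sup>2" unfolding froot_4 by simp
    hence "int p dvd 2 * b - 1" using prime_p prime_dvd_power[of "int p" "2 * b - 1" 2] by simp
    hence "(int p)\<^sup>2 dvd (2 * b - 1)\<^sup>2" by (rule dvd_power_same)
    hence "(int p)\<^sup>2 dvd (2 * b - 1)\<^sup>2 - 4 * froot b" using p2 by (intro dvd_diff dvd_mult)
    hence "(int p)\<^sup>2 dvd int p" unfolding froot_4 by simp
    hence "p\<^sup>2 dvd p" by (metis int_dvd_int_iff of_nat_power)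
    hence "p * p \<le> p" using p_ge_5 by (auto dest!: dvd_imp_le simp: power2_eq_square)
    thus False using p_ge_5 by (cases p) auto
  qed
  hence "Rho (p ^ Suc (Suc k)) = {}" unfolding Rho_def by blast
  thus ?thesis unfolding rho_def by simp
qed

section \<open>Divisor sums and the number of ideals of a given norm\<close>

lemma divisors_mult_bij:
  fixes m n :: nat
  assumes "coprime m n" "m > 0" "n > 0"
  shows "bij_betw (\<lambda>(x, y). x * y) ({x. x dvd m} \<times> {y. y dvd n}) {d. d dvd m * n}"
proof (rule bij_betwI')
  fix u v assume u: "u \<in> {x. x dvd m} \<times> {y. y dvd n}" and v: "v \<in> {x. x dvd m} \<times> {y. y dvd n}"
  obtain a b c d where ab: "u = (a, b)" "v = (c, d)" by fastforce
  have dv: "a dvd m" "b dvd n" "c dvd m" "d dvd n" using u v ab by auto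
  have gcds: "x = gcd (x * y) m" "y = gcd (x * y) n" if "x dvd m" "y dvd n" for x y
  proof -
    have "coprime y m" "coprime x n" using that assms(1)
      by (meson coprime_commute coprime_divisors dvd_refl)+
    thus "x = gcd (x * y) m" "y = gcd (x * y) n" using that
      by (metis coprime_commute gcd_mult_left_right_cancel gcd_mult_left_left_cancel gcd_nat.absorb1)+
  qed
  show "((case u of (x, y) \<Rightarrow> x * y) = (case v of (x, y) \<Rightarrow> x * y)) = (u = v)"
    using gcds[OF dv(1,2)] gcds[OF dv(3,4)] ab by auto
next
  fix u assume "u \<in> {x. x dvd m} \<times> {y. y dvd n}"
  thus "(case u of (x, y) \<Rightarrow> x * y) \<in> {d. d dvd m * n}" by (auto intro: mult_dvd_mono)
next
  fix d assume "d \<in> {d. d dvd m * n}"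
  then obtain a b where "d = a * b" "a dvd m" "b dvd n" using division_decomp[of d m n] by auto
  thus "\<exists>x\<in>{x. x dvd m} \<times> {y. y dvd n}. d = (case x of (x, y) \<Rightarrow> x * y)" by force
qed

lemma divisor_sum_mult:
  fixes F G H :: "nat \<Rightarrow> 'a :: comm_semiring_1"
  assumes "coprime m n" "m > 0" "n > 0"
    and "\<And>x y. x dvd m \<Longrightarrow> y dvd n \<Longrightarrow> H (x * y) = F x * G y"
  shows "(\<Sum>d | d dvd m * n. H d) = (\<Sum>d | d dvd m. F d) * (\<Sum>d | d dvd n. G d)"
proof -
  have "(\<Sum>d | d dvd m * n. H d) = (\<Sum>(x,y)\<in>{x. x dvd m} \<times> {y. y dvd n}. H (x * y))"
    using sum.reindex_bij_betw[OF divisors_mult_bij[OF assms(1-3)], of H]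
    by (simp add: case_prod_unfold)
  also have "\<dots> = (\<Sum>(x,y)\<in>{x. x dvd m} \<times> {y. y dvd n}. F x * G y)"
    using assms(4) by (intro sum.cong) auto
  also have "\<dots> = (\<Sum>d | d dvd m. F d) * (\<Sum>d | d dvd n. G d)"
    by (simp add: sum_product sum.cartesian_product)
  finally show ?thesis .
qed

text \<open>\<open>\<rho>(a)\<close> counts the ideals of norm \<open>a\<close> not divisible by an integer; every ideal is \<open>d\<close> times such an ideal.\<close>

definition ideal_count :: "nat \<Rightarrow> nat" where
  "ideal_count n = (\<Sum>d | d dvd n. if d\<^sup>2 dvd n then rho (n div d\<^sup>2) else 0)"

lemma coprime_square_dvd:
  fixes m n x y :: nat
  assumes "coprime m n" "x dvd m" "y dvd n"
  shows "(x * y)\<^sup>2 dvd m * n \<longleftrightarrow> x\<^sup>2 dvd m \<and> y\<^sup>2 dvd n"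
proof
  assume a: "(x * y)\<^sup>2 dvd m * n"
  have co: "coprime (x\<^sup>2) n" "coprime (y\<^sup>2) m"
    using coprime_divisors[OF assms(2) dvd_refl assms(1)] coprime_divisors[OF dvd_refl assms(3) assms(1)]
    by (simp_all add: coprime_commute)
  have "x\<^sup>2 dvd m * n" "y\<^sup>2 dvd m * n"
    using a by (auto simp: power_mult_distrib elim: dvd_mult_left dvd_mult_right)
  thus "x\<^sup>2 dvd m \<and> y\<^sup>2 dvd n" using co by (auto simp: coprime_dvd_mult_left_iff coprime_dvd_mult_right_iff)
qed (auto simp: power_mult_distrib intro: mult_dvd_mono)

lemma ideal_count_mult:
  assumes "coprime m n" "m > 0" "n > 0"
  shows "ideal_count (m * n) = ideal_count m * ideal_count n"
  unfolding ideal_count_def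
proof (rule divisor_sum_mult[OF assms])
  fix x y assume xy: "x dvd m" "y dvd n"
  show "(if (x * y)\<^sup>2 dvd m * n then rho (m * n div (x * y)\<^sup>2) else 0) =
    (if x\<^sup>2 dvd m then rho (m div x\<^sup>2) else 0) * (if y\<^sup>2 dvd n then rho (n div y\<^sup>2) else 0)"
  proof (cases "x\<^sup>2 dvd m \<and> y\<^sup>2 dvd n")
    case True
    have "m * n div (x * y)\<^sup>2 = (m div x\<^sup>2) * (n div y\<^sup>2)"
      using True by (simp add: power_mult_distrib div_mult_div_if_dvd)
    moreover have "coprime (m div x\<^sup>2) (n div y\<^sup>2)" using assms(1) True
      by (elim conjE dvdE) (use assms(2,3) in \<open>auto simp: power_eq_0_iff\<close>)
    moreover have "m div x\<^sup>2 > 0" "n div y\<^sup>2 > 0" using True assms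
      by (auto simp: div_greater_zero_iff dvd_imp_le)
    ultimately show ?thesis using True coprime_square_dvd[OF assms(1) xy] rho_mult by auto
  qed (use coprime_square_dvd[OF assms(1) xy] in auto)
qed

lemma divisors_prime_power:
  assumes "prime (q::nat)"
  shows "(\<Sum>d | d dvd q ^ k. F d) = (\<Sum>i\<le>k. F (q ^ i))"
proof -
  have "{d. d dvd q ^ k} = (\<lambda>i. q ^ i) ` {..k}"
    using divides_primepow_nat[OF assms, of _ k] by auto
  moreover have "inj_on (\<lambda>i. q ^ i) {..k}"
    using prime_gt_1_nat[OF assms] by (intro inj_onI) simp
  ultimately show ?thesis by (simp add: sum.reindex)
qed

text \<open>Induction in steps of two: dividing an ideal by the integer q lowers the exponent of the
  norm by 2. Passing from k to k + 2 therefore adds \<open>rho (q ^ (k + 2))\<close>, which equals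
  the two new terms of the geometric sum whether \<open>chi q\<close> is 0, 1 or -1.\<close>

lemma ideal_count_prime_power:
  assumes q: "prime q"
  shows "int (ideal_count (q ^ k)) = (\<Sum>i\<le>k. chi q ^ i)"
proof -
  have q1: "q > 1" using prime_gt_1_nat[OF q] .
  have eq: "ideal_count (q ^ k) = (\<Sum>i | 2 * i \<le> k. rho (q ^ (k - 2 * i)))" for k
  proof -
    have "ideal_count (q ^ k) = (\<Sum>i\<le>k. if 2 * i \<le> k then rho (q ^ (k - 2 * i)) else 0)"
      unfolding ideal_count_def divisors_prime_power[OF q]
    proof (intro sum.cong refl)
      fix i
      have "(q ^ i)\<^sup>2 = q ^ (2 * i)" by (simp add: power_mult[symmetric] mult.commute)
      moreover have "q ^ (2 * i) dvd q ^ k \<longleftrightarrow> 2 * i \<le> k" using q1 by (simp add: dvd_power_iff_le)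
      moreover have "2 * i \<le> k \<Longrightarrow> q ^ k div q ^ (2 * i) = q ^ (k - 2 * i)"
        using q1 by (simp add: power_diff)
      ultimately show "(if (q ^ i)\<^sup>2 dvd q ^ k then rho (q ^ k div (q ^ i)\<^sup>2) else 0) =
        (if 2 * i \<le> k then rho (q ^ (k - 2 * i)) else 0)" by simp
    qed
    also have "\<dots> = (\<Sum>i\<in>{i. i \<le> k \<and> 2 * i \<le> k}. rho (q ^ (k - 2 * i)))"
      by (subst sum.inter_filter[symmetric]) (auto intro: sum.cong)
    also have "{i. i \<le> k \<and> 2 * i \<le> k} = {i. 2 * i \<le> k}" by auto
    finally show ?thesis .
  qed
  have step: "ideal_count (q ^ Suc (Suc k)) = rho (q ^ Suc (Suc k)) + ideal_count (q ^ k)" for k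
  proof -
    have *: "{i. 2 * i \<le> Suc (Suc k)} = insert 0 (Suc ` {i. 2 * i \<le> k})"
    proof (intro equalityI subsetI)
      fix i assume "i \<in> {i. 2 * i \<le> Suc (Suc k)}"
      thus "i \<in> insert 0 (Suc ` {i. 2 * i \<le> k})" by (cases i) auto
    qed auto
    moreover have "finite {i. 2 * i \<le> k}" by (rule finite_subset[of _ "{..k}"]) auto
    ultimately show ?thesis unfolding eq by (subst *) (simp add: sum.reindex)
  qed
  have rho_ge2: "int (rho (q ^ Suc (Suc k))) = chi q ^ Suc k + chi q ^ Suc (Suc k)" for k
  proof (cases "q = p")
    case True
    thus ?thesis using rho_p_power chi_eq_0_iff[of p] by simp
  next
    case False
    have "rho (q ^ Suc j) = rho q" for j
    proof (induction j)
      case (Suc j)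
      thus ?case using rho_Suc[OF q False, of "Suc j"] by simp
    qed simp
    hence "int (rho (q ^ Suc (Suc k))) = 1 + chi q" using rho_prime[OF q] by metis
    moreover have "chi q = 1 \<or> chi q = -1"
      using chi_cases[of q] chi_eq_0_iff[of q] primes_dvd_imp_eq[OF prime_p q] False by auto
    ultimately show ?thesis by auto
  qed
  show ?thesis
  proof (induction k rule: induct_nat_012)
    case 0
    have "{i::nat. 2 * i \<le> 0} = {0}" by auto
    thus ?case unfolding eq by simp
  next
    case 1
    have "{i::nat. 2 * i \<le> Suc 0} = {0}" by auto
    thus ?case unfolding eq using rho_prime[OF q] by simp
  next
    case (ge2 k)
    show ?case unfolding step using ge2(1) rho_ge2[of k] by (simp add: of_nat_add)
  qed
qed

text \<open>The coefficient form of the factorisation of the Dedekind zeta function into the Riemann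
  zeta function and L(s, chi). Both sides are multiplicative and agree at prime powers.\<close>

theorem ideal_count_eq:
  assumes "n > 0"
  shows "int (ideal_count n) = (\<Sum>d | d dvd n. chi d)"
  using assms
proof (induction n rule: less_induct)
  case (less n)
  show ?case
  proof (cases "n = 1")
    case True
    thus ?thesis unfolding ideal_count_def by simp
  next
    case False
    then obtain q where q: "prime q" "q dvd n" using prime_factor_nat by blast
    define k where "k = multiplicity q n"
    obtain m where m: "n = q ^ k * m" "\<not> q dvd m"
      using multiplicity_decompose'[of n q] less.prems q unfolding k_def
      by (metis not_prime_unit neq0_conv)
    have k0: "k > 0" using m q by (cases k) auto
    have co: "coprime (q ^ k) m" using m q by (simp add: prime_imp_coprime coprime_power_left_iff)
    have pos: "m > 0" "q ^ k > 0" using m less.prems by (auto intro: Nat.gr0I)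
    have "m < n" using m(1) k0 pos one_less_power[OF prime_gt_1_nat[OF q(1)] k0] by simp
    hence IH: "int (ideal_count m) = (\<Sum>d | d dvd m. chi d)" using less.IH pos by blast
    have "int (ideal_count n) = int (ideal_count (q ^ k)) * int (ideal_count m)"
      using ideal_count_mult[OF co] pos m by simp
    also have "int (ideal_count (q ^ k)) = (\<Sum>d | d dvd q ^ k. chi d)"
      using ideal_count_prime_power[OF q(1), of k] divisors_prime_power[OF q(1), of chi k]
      by (simp add: chi_power)
    also have "\<dots> * int (ideal_count m) = (\<Sum>d | d dvd n. chi d)"
      unfolding IH m(1) by (rule divisor_sum_mult[symmetric, OF co]) (use pos chi_mult in auto)
    finally show ?thesis .
  qed
qed

section \<open>Character sums and power sums modulo p\<close>

lemma mult_mod_bij: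
  assumes "\<not> p dvd n"
  shows "bij_betw (\<lambda>a. (a * n) mod p) {1..<p} {1..<p}"
proof -
  have co: "coprime n p" using prime_imp_coprime[OF prime_p assms] by (simp add: coprime_commute)
  have inj: "inj_on (\<lambda>a. (a * n) mod p) {1..<p}"
  proof (rule inj_onI)
    fix x y assume xy: "x \<in> {1..<p}" "y \<in> {1..<p}" "x * n mod p = y * n mod p"
    hence "[x = y] (mod p)" using cong_mult_rcancel_nat[OF co] by (simp add: Cong.cong_def)
    thus "x = y" using xy by (simp add: Cong.cong_def)
  qed
  have "(a * n) mod p \<in> {1..<p}" if "a \<in> {1..<p}" for a
  proof -
    have "\<not> p dvd a" using that by (auto dest: dvd_imp_le)
    hence "\<not> p dvd a * n" using assms prime_p by (simp add: prime_dvd_mult_iff)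
    thus ?thesis using p_ge_5 by (auto simp: mod_greater_zero_iff_not_dvd Suc_le_eq)
  qed
  hence "(\<lambda>a. (a * n) mod p) ` {1..<p} = {1..<p}" by (intro endo_inj_surj inj) auto
  thus ?thesis using inj by (simp add: bij_betw_def)
qed

lemma sum_chi: "(\<Sum>a = 1..<p. chi a) = 0"
proof -
  obtain g where g: "coprime g p" "ord p g = p - 1" "chi g = -1" by (rule primroot_exists)
  have "\<not> p dvd g" using g(3) chi_eq_0_iff[of g] by auto
  hence "(\<Sum>a = 1..<p. chi a) = (\<Sum>a = 1..<p. chi ((a * g) mod p))"
    using sum.reindex_bij_betw[OF mult_mod_bij, of g chi] by simp
  also have "\<dots> = - (\<Sum>a = 1..<p. chi a)" by (simp add: chi_mult g(3) sum_negf)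
  finally show ?thesis by simp
qed

lemma chi_0 [simp]: "chi 0 = 0"
  by (simp add: chi_eq_0_iff)

lemma chi_add_p [simp]: "chi (n + p) = chi n"
  by (rule chi_congI) (simp add: Cong.cong_def)

lemma sum_chi_block: "(\<Sum>a = m..<m + p. chi a) = 0"
proof (induction m)
  case 0
  have "{0..<p} = insert 0 {1..<p}" using p_ge_5 by auto
  thus ?case using sum_chi by simp
next
  case (Suc m)
  have "(\<Sum>a = m..<m + p. chi a) = chi m + (\<Sum>a = Suc m..<m + p. chi a)"
    using p_ge_5 by (subst sum.atLeast_Suc_lessThan) auto
  moreover have "(\<Sum>a = Suc m..<Suc m + p. chi a) = (\<Sum>a = Suc m..<m + p. chi a) + chi (m + p)"
    using p_ge_5 by simp
  ultimately show ?case using Suc by simp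
qed

text \<open>Full periods cancel, and what is left has fewer than p terms.\<close>

lemma chi_sum_bound: "\<bar>\<Sum>a = m..<n. chi a\<bar> \<le> int p"
proof (induction "n - m" arbitrary: m rule: less_induct)
  case less
  show ?case
  proof (cases "n - m < p")
    case True
    have "\<bar>\<Sum>a = m..<n. chi a\<bar> \<le> (\<Sum>a = m..<n. 1)"
      by (rule order.trans[OF sum_abs]) (intro sum_mono, metis abs_0 abs_1 abs_neg_one chi_cases order_refl zero_le_one)
    thus ?thesis using True by simp
  next
    case False
    have "(\<Sum>a = m..<n. chi a) = (\<Sum>a = m..<m + p. chi a) + (\<Sum>a = m + p..<n. chi a)"
      using False p_ge_5 by (intro sum.atLeastLessThan_concat[symmetric]) linarith+
    thus ?thesis using less(1)[of "m + p"] sum_chi_block False p_ge_5 by simp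
  qed
qed

text \<open>Evenness of \<open>chi\<close>: -1 is a residue because \<open>half\<close> is even.
  This makes the Gauss sums and the products over residues real.\<close>

lemma chi_p_minus:
  assumes "n \<le> p"
  shows "chi (p - n) = chi n"
proof (rule chi_eqI)
  have "int (p - n) ^ half = (int p - int n) ^ half" using assms by (simp add: of_nat_diff)
  also have "[(int p - int n) ^ half = (0 - int n) ^ half] (mod int p)"
    by (intro cong_pow cong_diff) (auto simp: cong_0_iff)
  also have "(0 - int n) ^ half = int n ^ half" by (simp add: half_eq)
  finally show "[chi (p - n) = chi n] (mod int p)" using chi_cong by (meson cong_sym cong_trans)
qed (use chi_cases[of n] chi_cases[of "p - n"] in auto)

text \<open>Replacing a by a g for a primitive root g multiplies the sum by g^k, which is not 1
  modulo p for these k.\<close>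

lemma power_sum_cong_0:
  assumes "0 < k" "k < p - 1"
  shows "[(\<Sum>a = 1..<p. int a ^ k) = 0] (mod int p)"
proof -
  obtain g where g: "coprime g p" "ord p g = p - 1" "chi g = -1" by (rule primroot_exists)
  have ng: "\<not> p dvd g" using g(3) chi_eq_0_iff[of g] by auto
  have "(\<Sum>a = 1..<p. int a ^ k) = (\<Sum>a = 1..<p. int ((a * g) mod p) ^ k)"
    using sum.reindex_bij_betw[OF mult_mod_bij[OF ng], of "\<lambda>a. int a ^ k"] by simp
  also have "[\<dots> = (\<Sum>a = 1..<p. int (a * g) ^ k)] (mod int p)"
    by (intro cong_sum cong_pow) (auto simp: Cong.cong_def zmod_int)
  also have "(\<Sum>a = 1..<p. int (a * g) ^ k) = int g ^ k * (\<Sum>a = 1..<p. int a ^ k)"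
    by (simp add: power_mult_distrib sum_distrib_left mult.commute)
  finally have "int p dvd (1 - int g ^ k) * (\<Sum>a = 1..<p. int a ^ k)"
    by (simp add: cong_iff_dvd_diff algebra_simps)
  moreover have "\<not> int p dvd 1 - int g ^ k"
  proof
    assume "int p dvd 1 - int g ^ k"
    hence "[int g ^ k = 1] (mod int p)" by (simp add: cong_iff_dvd_diff dvd_diff_commute)
    hence "[g ^ k = 1] (mod p)" using cong_int_iff[of "g ^ k" 1 p] by simp
    hence "p - 1 dvd k" using g(2) ord_divides[of g k p] by simp
    thus False using assms by (auto dest: dvd_imp_le)
  qed
  ultimately show ?thesis using prime_p prime_dvd_mult_iff[of "int p"] by (simp add: cong_0_iff)
qed

end

section \<open>Abel summation\<close>

text \<open>Summation by parts: the differences of the decreasing weights \<open>f\<close>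
  telescope, so a bound for the partial sums of \<open>c\<close> costs only the first
  weight.\<close>

lemma abel_inequality:
  fixes c f :: "nat \<Rightarrow> real"
  assumes bound: "\<And>n. \<bar>\<Sum>d = m..<n. c d\<bar> \<le> M"
    and dec: "\<And>d. d \<ge> m \<Longrightarrow> f (Suc d) \<le> f d" and nonneg: "\<And>d. d \<ge> m \<Longrightarrow> f d \<ge> 0"
  shows "\<bar>\<Sum>d = m..<n. c d * f d\<bar> \<le> M * f m"
proof -
  let ?C = "\<lambda>n. \<Sum>d = m..<n. c d"
  have parts: "(\<Sum>d = m..<n. c d * f d) = ?C n * f n + (\<Sum>d = m..<n. ?C (Suc d) * (f d - f (Suc d)))" if "m \<le> n" for n
    using that by (induction n rule: dec_induct) (auto simp: algebra_simps)
  show ?thesis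
  proof (cases "m \<le> n")
    case True
    have "\<bar>\<Sum>d = m..<n. c d * f d\<bar> \<le> \<bar>?C n * f n\<bar> + (\<Sum>d = m..<n. \<bar>?C (Suc d) * (f d - f (Suc d))\<bar>)"
      unfolding parts[OF True] by (intro order.trans[OF abs_triangle_ineq] add_left_mono sum_abs)
    also have "\<dots> \<le> M * f n + (\<Sum>d = m..<n. M * (f d - f (Suc d)))"
      by (intro add_mono sum_mono) (auto simp: abs_mult True nonneg dec simp del: sum.op_ivl_Suc
            intro!: mult_mono bound order.trans[OF abs_ge_zero bound])
    also have "(\<Sum>d = m..<n. M * (f d - f (Suc d))) = M * (f m - f n)"
      using sum_Suc_diff'[OF True, of f] sum_negf[of "\<lambda>d. f (Suc d) - f d" "{m..<n}"]
      by (simp add: sum_distrib_left[symmetric])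
    finally show ?thesis by (simp add: algebra_simps)
  next
    case False
    thus ?thesis using nonneg[of m] bound[of m] by simp
  qed
qed

locale bounded_sums =
  fixes c :: "nat \<Rightarrow> real" and M :: real
  assumes bounded_sums: "\<And>m n. \<bar>\<Sum>d = m..<n. c d\<bar> \<le> M"
begin

lemma M_nonneg: "M \<ge> 0" using bounded_sums[of 0 0] by simp

text \<open>The bound is uniform in x up to and including 1. This gives convergence at 1 and
  continuity there, which is Abel's limit theorem for these series.\<close>

lemma tail_bound:
  assumes "m > 0" "0 \<le> x" "x \<le> 1"
  shows "\<bar>\<Sum>d = m..<n. c d / d * x ^ d\<bar> \<le> M / m"
proof -
  have "\<bar>\<Sum>d = m..<n. c d * (x ^ d / d)\<bar> \<le> M * (x ^ m / m)"
  proof (rule abel_inequality)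
    fix d assume "d \<ge> m"
    thus "x ^ Suc d / real (Suc d) \<le> x ^ d / real d"
      using assms by (intro frac_le) (auto intro: mult_left_le_one_le)
  qed (use assms bounded_sums in auto)
  also have "\<dots> \<le> M * (1 / m)"
    using assms M_nonneg by (intro mult_left_mono divide_right_mono power_le_one) auto
  finally show ?thesis by simp
qed

lemma summable_series:
  assumes "0 \<le> x" "x \<le> 1"
  shows "summable (\<lambda>d. c d / d * x ^ d)"
  unfolding summable_Cauchy
proof (intro allI impI)
  fix e :: real assume e: "e > 0"
  obtain N where N: "real N > M / e" using reals_Archimedean2 by blast
  show "\<exists>N. \<forall>m\<ge>N. \<forall>n. norm (\<Sum>d = m..<n. c d / d * x ^ d) < e"
  proof (intro exI[of _ "Suc N"] allI impI)
    fix m n assume m: "m \<ge> Suc N"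
    have "M / e < real m" using N m by linarith
    hence "M / m < e" using m e by (simp add: field_simps)
    thus "norm (\<Sum>d = m..<n. c d / d * x ^ d) < e" using tail_bound[of m x n] m assms by simp
  qed
qed

lemma suminf_tail_bound:
  assumes "m > 0" "0 \<le> x" "x \<le> 1"
  shows "\<bar>(\<Sum>d. c d / d * x ^ d) - (\<Sum>d<m. c d / d * x ^ d)\<bar> \<le> M / m"
proof (rule tendsto_upperbound)
  show "(\<lambda>n. \<bar>(\<Sum>d<n. c d / d * x ^ d) - (\<Sum>d<m. c d / d * x ^ d)\<bar>) \<longlonglongrightarrow> \<bar>(\<Sum>d. c d / d * x ^ d) - (\<Sum>d<m. c d / d * x ^ d)\<bar>"
    using summable_series[OF assms(2,3)] by (intro tendsto_intros summable_LIMSEQ)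
  show "\<forall>\<^sub>F n in sequentially. \<bar>(\<Sum>d<n. c d / d * x ^ d) - (\<Sum>d<m. c d / d * x ^ d)\<bar> \<le> M / m"
    using eventually_ge_at_top[of m]
  proof eventually_elim
    case (elim n)
    have "(\<Sum>d<n. c d / d * x ^ d) = (\<Sum>d<m. c d / d * x ^ d) + (\<Sum>d = m..<n. c d / d * x ^ d)"
      using elim sum.atLeastLessThan_concat[of 0 m n "\<lambda>d. c d / d * x ^ d"] by (simp add: lessThan_atLeast0)
    thus ?case using tail_bound[OF assms] by simp
  qed
qed simp

lemma continuous_series: "continuous_on {0..1} (\<lambda>x. \<Sum>d. c d / d * x ^ d)"
proof (rule uniform_limit_theorem)
  show "uniform_limit {0..1} (\<lambda>n x. \<Sum>d<n. c d / d * x ^ d) (\<lambda>x. \<Sum>d. c d / d * x ^ d) sequentially"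
    unfolding uniform_limit_iff
  proof (intro allI impI)
    fix e :: real assume e: "e > 0"
    obtain N where N: "real N > M / e" using reals_Archimedean2 by blast
    show "\<forall>\<^sub>F n in sequentially. \<forall>x\<in>{0..1}. dist (\<Sum>d<n. c d / d * x ^ d) (\<Sum>d. c d / d * x ^ d) < e"
      using eventually_ge_at_top[of "Suc N"]
    proof eventually_elim
      case (elim m)
      have "M / e < real m" using N elim by linarith
      hence "M / m < e" using elim e by (simp add: field_simps)
      have "dist (\<Sum>d<m. c d / d * x ^ d) (\<Sum>d. c d / d * x ^ d) < e" if "x \<in> {0..1}" for x
        using suminf_tail_bound[of m x] elim that \<open>M / m < e\<close>
        by (simp add: dist_real_def abs_minus_commute)
      thus ?case by blast
    qed
  qed
qed (auto simp: divide_inverse intro!: always_eventually continuous_intros)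

lemma sum_divisor_sums:
  fixes f :: "nat \<Rightarrow> real"
  shows "(\<Sum>n = 1..N. \<Sum>d | d dvd n. f d) = (\<Sum>d = 1..N. f d * real (N div d))"
proof -
  have "(\<Sum>n = 1..N. \<Sum>d | d dvd n. f d) = (\<Sum>n = 1..N. \<Sum>d = 1..N. if d dvd n then f d else 0)"
  proof (rule sum.cong[OF refl])
    fix n assume n: "n \<in> {1..N}"
    have *: "{d. d dvd n} = {d \<in> {1..N}. d dvd n}"
      using n by (auto dest: dvd_imp_le intro: Nat.gr0I simp: Suc_le_eq dvd_pos_nat)
    show "(\<Sum>d | d dvd n. f d) = (\<Sum>d = 1..N. if d dvd n then f d else 0)"
      unfolding * by (rule sum.inter_filter) simp
  qed
  also have "\<dots> = (\<Sum>d = 1..N. \<Sum>n = 1..N. if d dvd n then f d else 0)" by (rule sum.swap)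
  also have "\<dots> = (\<Sum>d = 1..N. f d * real (N div d))"
  proof (rule sum.cong[OF refl])
    fix d assume d: "d \<in> {1..N}"
    have "{n \<in> {1..N}. d dvd n} = (\<lambda>k. d * k) ` {1..N div d}"
    proof (intro equalityI subsetI)
      fix n assume "n \<in> {n \<in> {1..N}. d dvd n}"
      then obtain k where k: "n = d * k" "1 \<le> d * k" "d * k \<le> N" by auto
      hence "k \<in> {1..N div d}" using d by (auto simp: less_eq_div_iff_mult_less_eq mult.commute intro: Nat.gr0I)
      thus "n \<in> (\<lambda>k. d * k) ` {1..N div d}" using k by blast
    next
      fix n assume "n \<in> (\<lambda>k. d * k) ` {1..N div d}"
      thus "n \<in> {n \<in> {1..N}. d dvd n}" using d by (auto simp: less_eq_div_iff_mult_less_eq mult.commute)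
    qed
    moreover have "inj_on (\<lambda>k. d * k) {1..N div d}" using d by (auto intro: inj_onI)
    ultimately have "card {n \<in> {1..N}. d dvd n} = N div d" by (simp add: card_image)
    thus "(\<Sum>n = 1..N. if d dvd n then f d else 0) = f d * real (N div d)"
      by (simp add: sum.inter_filter[symmetric])
  qed
  finally show ?thesis .
qed

text \<open>After exchanging the sums, \<open>c d\<close> is weighted by N div d. For d below a cut
  D the weight is N / d up to an error less than 1; above D the weights decrease in d, so Abel
  summation bounds that part by M N / D. First D is chosen, then N.\<close>

theorem mean_divisor_sum:
  "(\<lambda>N. (\<Sum>n = 1..N. \<Sum>d | d dvd n. c d) / N) \<longlonglongrightarrow> (\<Sum>d. c d / d)"
proof (rule LIMSEQ_I)
  fix e :: real assume e: "e > 0"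
  \<comment> \<open>The constant 4 leaves room for two tails of size M / D, that of the divisor sum
    and that of the series, within e / 2.\<close>
  obtain D0 where D0: "real D0 > 4 * M / e" using reals_Archimedean2 by blast
  define D where "D = Suc D0"
  have "4 * M / e < real D" using D0 by (simp add: D_def)
  hence D: "2 * M / D < e / 2" "D > 0" using e by (auto simp: field_simps D_def)
  define K where "K = (\<Sum>d = 1..<D. \<bar>c d\<bar>)"
  have K0: "K \<ge> 0" unfolding K_def by (simp add: sum_nonneg)
  obtain N0 where N0: "real N0 > 2 * K / e" using reals_Archimedean2 by blast
  show "\<exists>no. \<forall>N\<ge>no. norm ((\<Sum>n = 1..N. \<Sum>d | d dvd n. c d) / N - (\<Sum>d. c d / d)) < e"
  proof (intro exI[of _ "N0 + D"] allI impI)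
    fix N assume N: "N \<ge> N0 + D"
    have Npos: "N > 0" using N D by auto
    have "2 * K / e < real N" using N0 N by linarith
    hence KN: "K / N < e / 2" using Npos e by (simp add: field_simps)
    have t1: "\<bar>\<Sum>d = D..<Suc N. c d * real (N div d)\<bar> \<le> M * real (N div D)"
    proof (rule abel_inequality)
      fix d assume "d \<ge> D"
      thus "real (N div Suc d) \<le> real (N div d)" using D by (simp add: div_le_mono2)
    qed (use bounded_sums in auto)
    also have "\<dots> \<le> M * (real N / real D)"
      using M_nonneg by (intro mult_left_mono of_nat_div_le_of_nat)
    finally have t1': "\<bar>(\<Sum>d = D..<Suc N. c d * real (N div d)) / N\<bar> \<le> M / D"
      using Npos D by (simp add: field_simps)
    have t2: "\<bar>(\<Sum>d. c d / d) - (\<Sum>d<D. c d / d)\<bar> \<le> M / D"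
      using suminf_tail_bound[of D 1] D by simp
    have "(\<Sum>n = 1..N. \<Sum>d | d dvd n. c d) = (\<Sum>d = 1..<Suc N. c d * real (N div d))"
      unfolding sum_divisor_sums by (simp add: atLeastLessThanSuc_atLeastAtMost)
    also have "\<dots> = (\<Sum>d = 1..<D. c d * real (N div d)) + (\<Sum>d = D..<Suc N. c d * real (N div d))"
      using N D by (intro sum.atLeastLessThan_concat[symmetric]) auto
    finally have split: "(\<Sum>n = 1..N. \<Sum>d | d dvd n. c d) = \<dots>" .
    \<comment> \<open>The term d = 0 is zero because division by zero yields zero.\<close>
    have first: "(\<Sum>d<D. c d / d) = (\<Sum>d = 1..<D. c d / d)"
    proof -
      have "{..<D} = insert 0 {1..<D}" using D by auto
      thus ?thesis by simp
    qed
    have "\<bar>(\<Sum>d = 1..<D. c d * real (N div d)) / N - (\<Sum>d = 1..<D. c d / d)\<bar>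
        = \<bar>\<Sum>d = 1..<D. c d * (real (N div d) / N - 1 / d)\<bar>"
      by (simp add: sum_divide_distrib sum_subtractf[symmetric] algebra_simps)
    also have "\<dots> \<le> (\<Sum>d = 1..<D. \<bar>c d\<bar> * (1 / N))"
    proof (intro order.trans[OF sum_abs] sum_mono)
      fix d assume d: "d \<in> {1..<D}"
      have "real N / d - 1 < real (N div d)" "real (N div d) \<le> real N / d"
        using floor_divide_of_nat_eq[of N d, where 'a=real] by linarith+
      hence "\<bar>real (N div d) - real N / d\<bar> \<le> 1" by linarith
      hence "\<bar>real (N div d) - real N / d\<bar> / N \<le> 1 / N" by (intro divide_right_mono) auto
      moreover have "real (N div d) / N - 1 / d = (real (N div d) - real N / d) / N"
        using Npos d by (simp add: field_simps)
      ultimately have "\<bar>real (N div d) / N - 1 / d\<bar> \<le> 1 / N" by (simp add: abs_divide)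
      thus "\<bar>c d * (real (N div d) / N - 1 / d)\<bar> \<le> \<bar>c d\<bar> * (1 / N)"
        unfolding abs_mult by (intro mult_left_mono) auto
    qed
    also have "\<dots> = K / N" unfolding K_def by (simp add: sum_divide_distrib)
    finally have t3: "\<bar>(\<Sum>d = 1..<D. c d * real (N div d)) / N - (\<Sum>d = 1..<D. c d / d)\<bar> \<le> K / N" .
    have "\<bar>(\<Sum>n = 1..N. \<Sum>d | d dvd n. c d) / N - (\<Sum>d. c d / d)\<bar> \<le> K / N + M / D + M / D"
      using t1' t2 t3 unfolding split first add_divide_distrib by linarith
    also have "\<dots> < e" using KN D(1) by linarith
    finally show "norm ((\<Sum>n = 1..N. \<Sum>d | d dvd n. c d) / N - (\<Sum>d. c d / d)) < e" by simp
  qed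
qed

end

section \<open>Gauss sums and \<open>L(1, \<chi>)\<close>\<close>

lemma ln_norm_series:
  fixes z :: complex and x :: real
  assumes "norm z = 1" "0 \<le> x" "x < 1"
  shows "(\<lambda>n. Re (z ^ n) / n * x ^ n) sums (- ln (norm (1 - x * z)))"
proof -
  have n: "norm (- (x * z)) < 1" using assms by (simp add: norm_mult)
  hence ne: "1 + - (x * z) \<noteq> 0" by (metis add_eq_0_iff norm_minus_cancel norm_one order_less_irrefl)
  have "(\<lambda>n. - ((- (- (x * z))) ^ n) / of_nat n) sums ln (1 + - (x * z))"
    using Ln_series'[OF n] .
  hence "(\<lambda>n. Re (- ((- (- (x * z))) ^ n) / of_nat n)) sums Re (ln (1 + - (x * z)))"
    by (rule sums_Re)
  hence *: "(\<lambda>n. - Re (- ((- (- (x * z))) ^ n) / of_nat n)) sums - Re (ln (1 + - (x * z)))"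
    by (rule sums_minus)
  have "- Re (- ((- (- (x * z))) ^ n) / of_nat n) = Re (z ^ n) / n * x ^ n" for n
  proof -
    have "(x * z) ^ n = of_real (x ^ n) * z ^ n" by (simp add: power_mult_distrib)
    thus ?thesis by simp
  qed
  moreover have "Re (ln (1 + - (x * z))) = ln (norm (1 - x * z))" using ne by simp
  ultimately show ?thesis using * by (simp only:)
qed

context quad_prime
begin

definition gauss_sum :: "complex \<Rightarrow> complex" where
  "gauss_sum z = (\<Sum>a = 1..<p. of_int (chi a) * z ^ a)"

lemma root_power_mod:
  assumes "z ^ p = (1 :: complex)"
  shows "z ^ (n mod p) = z ^ n"
proof -
  have "z ^ n = z ^ (p * (n div p) + n mod p)" by simp
  also have "\<dots> = z ^ (n mod p)" unfolding power_add power_mult assms by simp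
  finally show ?thesis ..
qed

lemma root_power_ne_1:
  assumes "z ^ p = (1 :: complex)" "z \<noteq> 1" "\<not> p dvd n"
  shows "z ^ n \<noteq> 1"
proof
  assume n1: "z ^ n = 1"
  have "coprime n p" using prime_imp_coprime[OF prime_p assms(3)] by (simp add: coprime_commute)
  then obtain k where "[n * k = 1] (mod p)" using cong_solve_coprime_nat[of n p] by auto
  hence "(n * k) mod p = 1" using p_ge_5 by (simp add: Cong.cong_def)
  hence "z = z ^ (n * k)" using root_power_mod[OF assms(1), of "n * k"] by simp
  also have "\<dots> = 1" by (simp add: power_mult n1)
  finally show False using assms(2) by simp
qed

lemma gauss_sum_power:
  assumes "z ^ p = 1" "z \<noteq> 1"
  shows "gauss_sum (z ^ n) = of_int (chi n) * gauss_sum z"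
proof (cases "p dvd n")
  case True
  hence "z ^ n = 1" using assms(1) by (auto simp: power_mult elim!: dvdE)
  hence "gauss_sum (z ^ n) = of_int (\<Sum>a = 1..<p. chi a)" unfolding gauss_sum_def by simp
  thus ?thesis using True sum_chi chi_eq_0_iff[of n] by (metis mult_zero_left of_int_0)
next
  case False
  have chi2: "chi n * chi n = 1" using False chi_cases[of n] chi_eq_0_iff[of n] by auto
  have "gauss_sum z = (\<Sum>a = 1..<p. of_int (chi ((a * n) mod p)) * z ^ ((a * n) mod p))"
    using sum.reindex_bij_betw[OF mult_mod_bij[OF False], of "\<lambda>a. of_int (chi a) * z ^ a"]
    unfolding gauss_sum_def by simp
  also have "\<dots> = (\<Sum>a = 1..<p. of_int (chi n) * (of_int (chi a) * (z ^ n) ^ a))"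
    by (simp add: root_power_mod[OF assms(1)] chi_mult power_mult[symmetric] mult.commute mult.left_commute)
  also have "\<dots> = of_int (chi n) * gauss_sum (z ^ n)" unfolding gauss_sum_def by (simp add: sum_distrib_left)
  finally have "of_int (chi n) * gauss_sum z = of_int (chi n * chi n) * gauss_sum (z ^ n)" by simp
  thus ?thesis using chi2 by simp
qed

lemma root_sum:
  assumes "z ^ p = (1 :: complex)" "z \<noteq> 1"
  shows "(\<Sum>n<p. z ^ n) = 0"
  using geometric_sum[OF assms(2), of p] assms(1) by simp

lemma root_norm: "z ^ p = (1 :: complex) \<Longrightarrow> norm z = 1"
  using p_ge_5 power_eq_iff_eq_base[of p "norm z" 1] norm_power[of z p] by simp

lemma root_cnj:
  assumes "z ^ p = (1 :: complex)" "n \<le> p"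
  shows "cnj (z ^ n) = z ^ (p - n)"
proof -
  have n: "norm (z ^ n) = 1" using root_norm[OF assms(1)] by (simp add: norm_power)
  have "z ^ n * z ^ (p - n) = 1" using assms by (simp add: power_add[symmetric])
  moreover have "z ^ n * cnj (z ^ n) = 1" using n by (simp only: complex_norm_square[symmetric]) simp
  moreover have "z ^ n \<noteq> 0" using n by (metis norm_zero zero_neq_one)
  ultimately show ?thesis by (metis mult_cancel_left)
qed

lemma minus_bij: "bij_betw (\<lambda>a. p - a) {1..<p} {1..<p}"
  by (rule bij_betwI[where g = "\<lambda>a. p - a"]) auto

lemma gauss_sum_real:
  assumes "z ^ p = 1"
  shows "cnj (gauss_sum z) = gauss_sum z"
proof -
  have "cnj (gauss_sum z) = (\<Sum>a = 1..<p. of_int (chi a) * z ^ (p - a))"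
    unfolding gauss_sum_def cnj_sum
    by (intro sum.cong refl) (simp add: root_cnj[OF assms, symmetric])
  also have "\<dots> = (\<Sum>a = 1..<p. of_int (chi (p - a)) * z ^ (p - a))"
    by (intro sum.cong refl) (simp add: chi_p_minus)
  also have "\<dots> = gauss_sum z" unfolding gauss_sum_def
    using sum.reindex_bij_betw[OF minus_bij, of "\<lambda>a. of_int (chi a) * z ^ a"] by simp
  finally show ?thesis .
qed

text \<open>Sum over n the identity between chi(n)^2 times the square of the Gauss sum and the
  squared absolute value of the Gauss sum at z^n. Orthogonality of the powers leaves only the
  diagonal a = b, and both sides acquire the factor p - 1.\<close>

lemma gauss_sum_square:
  assumes z: "z ^ p = 1" "z \<noteq> 1"
  shows "gauss_sum z ^ 2 = of_nat p"
proof -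
  have sq: "of_int (chi n ^ 2) * gauss_sum z ^ 2 =
      (\<Sum>a = 1..<p. \<Sum>b = 1..<p. of_int (chi a * chi b) * (z ^ (a + (p - b))) ^ n)" for n
  proof -
    have zn: "(z ^ n) ^ p = 1" using z by (metis power_mult mult.commute power_one)
    have "of_int (chi n ^ 2) * gauss_sum z ^ 2 = gauss_sum (z ^ n) * cnj (gauss_sum (z ^ n))"
      unfolding gauss_sum_real[OF zn] unfolding gauss_sum_power[OF z] by (simp add: power2_eq_square)
    also have "cnj (gauss_sum (z ^ n)) = (\<Sum>b = 1..<p. of_int (chi b) * (z ^ n) ^ (p - b))"
      unfolding gauss_sum_def cnj_sum by (intro sum.cong refl) (simp add: root_cnj[OF zn, symmetric])
    finally have "of_int (chi n ^ 2) * gauss_sum z ^ 2 =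
        (\<Sum>a = 1..<p. \<Sum>b = 1..<p. (of_int (chi a) * (z ^ n) ^ a) * (of_int (chi b) * (z ^ n) ^ (p - b)))"
      unfolding gauss_sum_def[of "z ^ n"] sum_product .
    also have "\<dots> = (\<Sum>a = 1..<p. \<Sum>b = 1..<p. of_int (chi a * chi b) * (z ^ (a + (p - b))) ^ n)"
    proof (intro sum.cong refl)
      fix a b
      have "(z ^ (a + (p - b))) ^ n = (z ^ n) ^ a * (z ^ n) ^ (p - b)"
        by (simp only: power_add[symmetric] power_mult[symmetric] mult.commute[of _ n] distrib_left)
      thus "(of_int (chi a) * (z ^ n) ^ a) * (of_int (chi b) * (z ^ n) ^ (p - b)) =
          of_int (chi a * chi b) * (z ^ (a + (p - b))) ^ n" by simp
    qed
    finally show ?thesis .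
  qed
  have orth: "(\<Sum>n<p. (z ^ (a + (p - b))) ^ n) = (if a = b then of_nat p else 0)"
    if "a \<in> {1..<p}" "b \<in> {1..<p}" for a b
  proof (cases "a = b")
    case True
    have "a + (p - b) = p" using that True by auto
    thus ?thesis using True z by simp
  next
    case False
    have "\<not> p dvd a + (p - b)"
    proof
      assume "p dvd a + (p - b)"
      then obtain k where k: "a + (p - b) = p * k" by (elim dvdE)
      have "p * k < p * 2" "0 < p * k" "p * k \<noteq> p * 1" unfolding k[symmetric] using that False by auto
      moreover from this have "k \<noteq> 0" "k \<noteq> 1" by auto
      hence "p * 2 \<le> p * k" by (intro mult_le_mono2) linarith
      ultimately show False by linarith
    qed
    hence "z ^ (a + (p - b)) \<noteq> 1" using root_power_ne_1[OF z] by blast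
    moreover have "(z ^ (a + (p - b))) ^ p = 1" using z by (metis power_mult mult.commute power_one)
    ultimately show ?thesis using root_sum False by simp
  qed
  have chi2: "chi n ^ 2 = 1" if "n \<in> {1..<p}" for n
    using that chi_cases[of n] chi_eq_0_iff[of n] by (auto dest: dvd_imp_le)
  have "{..<p} = insert 0 {1..<p}" using p_ge_5 by auto
  hence "(\<Sum>n<p. of_int (chi n ^ 2) :: complex) = (\<Sum>n = 1..<p. of_int (chi n ^ 2))" by simp
  also have "\<dots> = (\<Sum>n = 1..<p. 1)" by (intro sum.cong refl) (simp only: chi2 of_int_1)
  finally have cnt: "(\<Sum>n<p. of_int (chi n ^ 2) :: complex) = of_nat (p - 1)" by simp
  have "of_nat (p - 1) * gauss_sum z ^ 2 = (\<Sum>n<p. of_int (chi n ^ 2) * gauss_sum z ^ 2)"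
    unfolding cnt[symmetric] by (simp add: sum_distrib_right)
  also have "\<dots> = (\<Sum>n<p. \<Sum>a = 1..<p. \<Sum>b = 1..<p. of_int (chi a * chi b) * (z ^ (a + (p - b))) ^ n)"
    by (simp only: sq)
  also have "\<dots> = (\<Sum>a = 1..<p. \<Sum>n<p. \<Sum>b = 1..<p. of_int (chi a * chi b) * (z ^ (a + (p - b))) ^ n)"
    by (rule sum.swap)
  also have "\<dots> = (\<Sum>a = 1..<p. \<Sum>b = 1..<p. \<Sum>n<p. of_int (chi a * chi b) * (z ^ (a + (p - b))) ^ n)"
    by (intro sum.cong refl sum.swap)
  also have "\<dots> = (\<Sum>a = 1..<p. \<Sum>b = 1..<p. if a = b then of_int (chi a ^ 2) * of_nat p else 0)"
  proof (intro sum.cong refl)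
    fix a b assume ab: "a \<in> {1..<p}" "b \<in> {1..<p}"
    have "(\<Sum>n<p. of_int (chi a * chi b) * (z ^ (a + (p - b))) ^ n) =
        of_int (chi a * chi b) * (\<Sum>n<p. (z ^ (a + (p - b))) ^ n)" by (rule sum_distrib_left[symmetric])
    thus "(\<Sum>n<p. of_int (chi a * chi b) * (z ^ (a + (p - b))) ^ n) =
        (if a = b then of_int (chi a ^ 2) * of_nat p else 0)"
      unfolding orth[OF ab] by (simp add: power2_eq_square)
  qed
  also have "\<dots> = (\<Sum>a = 1..<p. of_nat p)"
  proof (intro sum.cong refl)
    fix a assume a: "a \<in> {1..<p}"
    have "(\<Sum>b = 1..<p. if a = b then of_int (chi a ^ 2) * of_nat p else 0) = (of_int (chi a ^ 2) * of_nat p :: complex)"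
      using a by (subst sum.delta') auto
    thus "(\<Sum>b = 1..<p. if a = b then of_int (chi a ^ 2) * of_nat p else 0) = (of_nat p :: complex)"
      unfolding chi2[OF a] by simp
  qed
  also have "\<dots> = of_nat (p - 1) * of_nat p" by simp
  finally show ?thesis using p_ge_5 by (subst (asm) mult_cancel_left) auto
qed

text \<open>The square fixes the Gauss sum only up to sign. Instead of determining the sign for the
  standard root, the root is replaced by a non-residue power if the sign is negative.\<close>

lemma root_exists:
  obtains z :: complex where "z ^ p = 1" "z \<noteq> 1" "gauss_sum z = of_real (sqrt p)"
proof -
  define w where "w = cis (2 * pi / p)"
  have w1: "w ^ p = 1" unfolding w_def Complex.DeMoivre using p_ge_5 by simp
  have w2: "w \<noteq> 1"
  proof
    assume "w = 1"
    hence "Re (cis (2 * pi / p)) = 1" unfolding w_def by simp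
    hence "cos (2 * pi / p) = 1" by simp
    moreover have "cos (2 * pi / p) < cos 0" using p_ge_5
      by (intro cos_monotone_0_pi) (auto simp: field_simps)
    ultimately show False by simp
  qed
  define r where "r = Re (gauss_sum w)"
  have expq: "gauss_sum w = of_real r"
    using gauss_sum_real[OF w1] unfolding r_def by (simp add: complex_eq_iff)
  have "of_real (r ^ 2) = complex_of_real (real p)" using gauss_sum_square[OF w1 w2] expq by simp
  hence "r ^ 2 = real p" by (simp only: of_real_eq_iff)
  hence r: "r = sqrt p \<or> r = - sqrt p" by (metis real_sqrt_abs abs_if minus_minus)
  obtain g where g: "coprime g p" "ord p g = p - 1" "chi g = -1" by (rule primroot_exists)
  have ng: "\<not> p dvd g" using g(3) chi_eq_0_iff[of g] by auto
  show ?thesis using r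
  proof
    assume "r = sqrt p" thus ?thesis using that w1 w2 expq by blast
  next
    assume "r = - sqrt p"
    hence "gauss_sum (w ^ g) = of_real (sqrt p)" using gauss_sum_power[OF w1 w2, of g] g(3) expq by simp
    moreover have "(w ^ g) ^ p = 1" using w1 by (metis power_mult mult.commute power_one)
    ultimately show ?thesis using that root_power_ne_1[OF w1 w2 ng] by blast
  qed
qed

sublocale chi_real: bounded_sums "\<lambda>n. real_of_int (chi n)" "real p"
proof
  fix m n
  have "real_of_int \<bar>\<Sum>d = m..<n. chi d\<bar> \<le> real_of_int (int p)" using chi_sum_bound by (simp only: of_int_le_iff)
  thus "\<bar>\<Sum>d = m..<n. real_of_int (chi d)\<bar> \<le> real p" by simp
qed

definition L1 :: real where "L1 = (\<Sum>n. real_of_int (chi n) / n)"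

text \<open>The Gauss sum expands \<open>sqrt p * chi n\<close> in the powers z^(a n), so for x < 1
  the series becomes a combination of logarithms of 1 - x z^a. Both sides are continuous as x tends
  to 1 from the left.\<close>

theorem L1_eq:
  assumes z: "z ^ p = 1" "z \<noteq> 1" and g: "gauss_sum z = of_real (sqrt p)"
  shows "sqrt p * L1 = - (\<Sum>a = 1..<p. chi a * ln (norm (1 - z ^ a)))"
proof -
  define F where "F = (\<lambda>x. \<Sum>n. real_of_int (chi n) / n * x ^ n)"
  define G where "G = (\<lambda>x :: real. - (\<Sum>a = 1..<p. chi a * ln (norm (1 - x * z ^ a))))"
  have ne: "1 - z ^ a \<noteq> 0" if "a \<in> {1..<p}" for a
    using root_power_ne_1[OF z, of a] that nat_dvd_not_less[of a p] by auto
  have FG: "sqrt p * F x = G x" if x: "0 \<le> x" "x < 1" for x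
  proof -
    have "(\<lambda>n. \<Sum>a = 1..<p. chi a * (Re ((z ^ a) ^ n) / n * x ^ n)) sums
        (\<Sum>a = 1..<p. chi a * (- ln (norm (1 - x * z ^ a))))"
      by (intro sums_sum sums_mult ln_norm_series x) (simp add: norm_power root_norm[OF z(1)])
    also have "(\<lambda>n. \<Sum>a = 1..<p. chi a * (Re ((z ^ a) ^ n) / n * x ^ n)) =
        (\<lambda>n. sqrt p * (chi n / n * x ^ n))"
    proof
      fix n
      have "(\<Sum>a = 1..<p. chi a * Re ((z ^ a) ^ n)) = Re (gauss_sum (z ^ n))"
        unfolding gauss_sum_def by (simp add: power_mult[symmetric] mult.commute)
      also have "\<dots> = chi n * sqrt p" unfolding gauss_sum_power[OF z] g by simp
      finally have *: "(\<Sum>a = 1..<p. chi a * Re ((z ^ a) ^ n)) = chi n * sqrt p" .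
      have "(\<Sum>a = 1..<p. chi a * (Re ((z ^ a) ^ n) / n * x ^ n)) =
          (\<Sum>a = 1..<p. chi a * Re ((z ^ a) ^ n)) * (x ^ n / n)"
        unfolding sum_distrib_right by (intro sum.cong refl) simp
      thus "(\<Sum>a = 1..<p. chi a * (Re ((z ^ a) ^ n) / n * x ^ n)) = sqrt p * (chi n / n * x ^ n)"
        unfolding * by simp
    qed
    finally have "(\<lambda>n. sqrt p * (chi n / n * x ^ n)) sums G x" unfolding G_def by (simp add: sum_negf)
    moreover have "(\<lambda>n. sqrt p * (chi n / n * x ^ n)) sums (sqrt p * F x)"
      unfolding F_def using chi_real.summable_series[of x] x by (intro sums_mult summable_sums) auto
    ultimately show ?thesis using sums_unique2 by blast
  qed
  have at_bot: "at_left (1::real) = at 1 within {0..<1}"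
    by (rule at_within_nhd[of _ "{0<..<2}"]) auto
  have "continuous (at 1 within {0..1}) F"
    using chi_real.continuous_series unfolding F_def continuous_on_eq_continuous_within by auto
  hence "continuous (at 1 within {0..<1}) F" by (rule continuous_within_subset) auto
  hence F1: "((\<lambda>x. sqrt p * F x) \<longlongrightarrow> sqrt p * F 1) (at_left 1)"
    unfolding at_bot continuous_within by (intro tendsto_intros)
  have "isCont G 1" unfolding G_def using ne
    by (intro continuous_intros) simp_all
  hence G1: "(G \<longlongrightarrow> G 1) (at_left 1)"
    unfolding isCont_def by (rule tendsto_within_subset) simp
  have "eventually (\<lambda>x. sqrt p * F x = G x) (at_left 1)"
    unfolding eventually_at_left_field using FG by (intro exI[of _ 0]) simp
  hence "((\<lambda>x. sqrt p * F x) \<longlongrightarrow> G 1) (at_left 1)"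
    by (intro Lim_transform_eventually[OF G1]) (auto elim: eventually_mono)
  hence "sqrt p * F 1 = G 1" by (rule tendsto_unique[OF trivial_limit_at_left_real F1])
  thus ?thesis unfolding F_def G_def L1_def by simp
qed

theorem mean_ideal_count:
  "(\<lambda>N. (\<Sum>n = 1..N. real (ideal_count n)) / N) \<longlonglongrightarrow> L1"
proof -
  have "(\<Sum>n = 1..N. real (ideal_count n)) = (\<Sum>n = 1..N. \<Sum>d | d dvd n. real_of_int (chi d))" for N
  proof (intro sum.cong refl)
    fix n assume "n \<in> {1..N}"
    hence "real_of_int (int (ideal_count n)) = real_of_int (\<Sum>d | d dvd n. chi d)"
      by (subst ideal_count_eq) auto
    thus "real (ideal_count n) = (\<Sum>d | d dvd n. real_of_int (chi d))" by simp
  qed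
  thus ?thesis using chi_real.mean_divisor_sum unfolding L1_def by simp
qed

end

section \<open>Lattice points in a hyperbolic sector\<close>

lemma card_progression:
  fixes a c lo hi :: real
  assumes "a > 0" "lo \<le> hi"
  shows "finite {k::int. lo < a * k + c \<and> a * k + c \<le> hi}"
    and "\<bar>real (card {k::int. lo < a * k + c \<and> a * k + c \<le> hi}) - (hi - lo) / a\<bar> \<le> 1"
proof -
  have eq: "{k::int. lo < a * k + c \<and> a * k + c \<le> hi} = {\<lfloor>(lo - c) / a\<rfloor><..\<lfloor>(hi - c) / a\<rfloor>}"
    using assms(1) by (auto simp: le_floor_iff floor_less_iff field_simps)
  show "finite {k::int. lo < a * k + c \<and> a * k + c \<le> hi}" unfolding eq by simp
  have le: "\<lfloor>(lo - c) / a\<rfloor> \<le> \<lfloor>(hi - c) / a\<rfloor>"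
    using assms by (intro floor_mono divide_right_mono) auto
  have "(hi - lo) / a = (hi - c) / a - (lo - c) / a" by (simp add: diff_divide_distrib)
  thus "\<bar>real (card {k::int. lo < a * k + c \<and> a * k + c \<le> hi}) - (hi - lo) / a\<bar> \<le> 1"
    unfolding eq using le by (simp add: of_nat_diff) linarith
qed

locale hyperbolic_sector =
  fixes s E a \<beta> :: real
  assumes s: "s > 0" and E: "E > 1" and a: "a > 0"
begin

text \<open>In the application x' is a lattice element and x its conjugate, which differ by an
  integer multiple of s = sqrt p. The inequalities between x and x' pick one element from each orbit
  of units, and x x' is the norm.\<close>

definition sector :: "real \<Rightarrow> (int \<times> int) set" where
  "sector Y = {(k, n). let x = a * k + n * \<beta>; x' = x - n * s
     in x > 0 \<and> x' > 0 \<and> x' \<le> x \<and> x < E * x' \<and> x * x' \<le> Y}"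

text \<open>Row \<open>n\<close> of the sector is the interval \<open>lo n < x \<le> hi Y n\<close>: the lower end comes from \<open>x < E (x - n s)\<close>,
  the upper one solves \<open>x (x - n s) = Y\<close>. The length \<open>hi - lo\<close> is decreasing in \<open>n\<close> and vanishes at \<open>apex Y\<close>.\<close>

definition hi :: "real \<Rightarrow> real \<Rightarrow> real" where
  "hi Y x = (x * s + sqrt ((x * s)\<^sup>2 + 4 * Y)) / 2"

definition lo :: "real \<Rightarrow> real" where "lo x = x * s * E / (E - 1)"

text \<open>An antiderivative of \<open>hi - lo\<close>. For the first part take w =
  \<open>hi Y x\<close> as the variable: then x = (w - Y / w) / s, and integrating w dx gives (w^2 /
  2 + Y ln w) / s.\<close>

definition primitive :: "real \<Rightarrow> real \<Rightarrow> real" where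
  "primitive Y x = ((hi Y x)\<^sup>2 / 2 + Y * ln (hi Y x)) / s - x\<^sup>2 * s * E / (2 * (E - 1))"

definition apex :: "real \<Rightarrow> real" where "apex Y = sqrt Y * (E - 1) / (s * sqrt E)"

lemma hi_root:
  assumes "Y > 0"
  shows "hi Y x * (hi Y x - x * s) = Y"
proof -
  have "(sqrt ((x * s)\<^sup>2 + 4 * Y))\<^sup>2 = (x * s)\<^sup>2 + 4 * Y" using assms by (intro real_sqrt_pow2) auto
  moreover have "hi Y x * (hi Y x - x * s) = ((sqrt ((x * s)\<^sup>2 + 4 * Y))\<^sup>2 - (x * s)\<^sup>2) / 4"
    unfolding hi_def by (simp add: field_simps power2_eq_square)
  ultimately show ?thesis by simp
qed

lemma hi_pos:
  assumes "Y > 0"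
  shows "hi Y x > 0" "hi Y x > x * s"
proof -
  have "sqrt ((x * s)\<^sup>2) < sqrt ((x * s)\<^sup>2 + 4 * Y)" using assms by (intro real_sqrt_less_mono) simp
  hence "\<bar>x * s\<bar> < sqrt ((x * s)\<^sup>2 + 4 * Y)" by simp
  moreover have "hi Y x = x * s / 2 + sqrt ((x * s)\<^sup>2 + 4 * Y) / 2" unfolding hi_def by (simp add: add_divide_distrib)
  ultimately show "hi Y x > 0" "hi Y x > x * s" by linarith+
qed

lemma hi_mono:
  assumes "Y > 0" "0 \<le> x" "x \<le> y"
  shows "hi Y x \<le> hi Y y"
proof -
  have "x * s \<le> y * s" "0 \<le> x * s" using assms s by auto
  moreover from this have "(x * s)\<^sup>2 \<le> (y * s)\<^sup>2" by (intro power_mono)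
  hence "sqrt ((x * s)\<^sup>2 + 4 * Y) \<le> sqrt ((y * s)\<^sup>2 + 4 * Y)" by (intro real_sqrt_le_mono) simp
  ultimately show ?thesis unfolding hi_def by (intro divide_right_mono add_mono) auto
qed

lemma le_hi_iff:
  assumes "Y > 0" "x > 0" "x > t * s"
  shows "x \<le> hi Y t \<longleftrightarrow> x * (x - t * s) \<le> Y"
proof
  assume "x \<le> hi Y t"
  hence "x * (x - t * s) \<le> hi Y t * (hi Y t - t * s)"
    using assms by (intro mult_mono) (auto intro: order.strict_implies_order)
  thus "x * (x - t * s) \<le> Y" using hi_root[OF assms(1)] by simp
next
  assume a: "x * (x - t * s) \<le> Y"
  show "x \<le> hi Y t"
  proof (rule ccontr)
    assume "\<not> x \<le> hi Y t"
    hence "hi Y t * (hi Y t - t * s) < x * (x - t * s)"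
      using assms hi_pos[OF assms(1), of t] by (intro mult_strict_mono) auto
    thus False using a hi_root[OF assms(1), of t] by simp
  qed
qed

lemma lo_ge: "x \<ge> 0 \<Longrightarrow> lo x \<ge> x * s"
  unfolding lo_def using s E by (simp add: field_simps)

text \<open>In this form the length is a decreasing term minus an increasing one, so its
  monotonicity is visible.\<close>

lemma len_eq:
  assumes "Y > 0"
  shows "hi Y x - lo x = Y / hi Y x - x * s / (E - 1)"
proof -
  have "Y / hi Y x = hi Y x - x * s"
    using hi_root[OF assms, of x] hi_pos[OF assms, of x] by (simp add: field_simps)
  moreover have "lo x = x * s + x * s / (E - 1)" unfolding lo_def using E by (simp add: field_simps)
  ultimately show ?thesis by simp
qed

lemma len_antimono:
  assumes "Y > 0" "0 \<le> x" "x \<le> y"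
  shows "hi Y y - lo y \<le> hi Y x - lo x"
  unfolding len_eq[OF assms(1)]
  using hi_mono[OF assms] hi_pos[OF assms(1)] assms s E
  by (intro diff_mono divide_left_mono divide_right_mono mult_right_mono) auto

lemma apex_pos: "Y > 0 \<Longrightarrow> apex Y > 0"
  unfolding apex_def using s E by simp

lemma hi_0: "Y > 0 \<Longrightarrow> hi Y 0 = sqrt Y"
  unfolding hi_def by (simp add: real_sqrt_mult)

lemma lo_apex: "Y > 0 \<Longrightarrow> lo (apex Y) = sqrt Y * sqrt E"
proof -
  have "E / sqrt E = sqrt E" using E by (simp add: real_div_sqrt)
  moreover have "y * d / (s * e) * s = y / e * d" for y d e using s by simp
  hence *: "apex Y * s = sqrt Y / sqrt E * (E - 1)" unfolding apex_def .
  have "lo (apex Y) = sqrt Y * (E / sqrt E)" unfolding lo_def * using E by simp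
  ultimately show ?thesis by simp
qed

lemma hi_apex:
  assumes "Y > 0"
  shows "hi Y (apex Y) = sqrt Y * sqrt E"
proof -
  define e where "e = sqrt E"
  define y where "y = sqrt Y"
  have e: "E = e\<^sup>2" "e > 1" "Y = y\<^sup>2" "y > 0" using E assms unfolding e_def y_def by auto
  \<comment> \<open>At the apex x = E x' and x x' = Y, hence x = y e and x' = y / e. So
    \<open>apex Y * s\<close> is x - x', and the square root in \<open>hi\<close> is x + x'.\<close>
  have t: "apex Y * s = y * (e - 1 / e)" unfolding apex_def e_def[symmetric] y_def[symmetric] using s e
    unfolding e(1) by (simp add: field_simps power2_eq_square)
  have "(apex Y * s)\<^sup>2 + 4 * Y = (y * (e + 1 / e))\<^sup>2" unfolding t unfolding e(3) using e(2)
    by (simp add: field_simps power2_eq_square)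
  hence "sqrt ((apex Y * s)\<^sup>2 + 4 * Y) = y * (e + 1 / e)" using e by simp
  thus ?thesis unfolding hi_def t e_def[symmetric] y_def[symmetric] by (simp add: field_simps)
qed

lemma lo_less_hi_iff:
  assumes "Y > 0" "x \<ge> 0"
  shows "lo x < hi Y x \<longleftrightarrow> x < apex Y"
proof
  assume "lo x < hi Y x"
  thus "x < apex Y"
    using len_antimono[OF assms(1) less_imp_le[OF apex_pos[OF assms(1)]], of x] lo_apex hi_apex assms
    by fastforce
next
  assume x: "x < apex Y"
  have "hi Y (apex Y) - lo (apex Y) < hi Y x - lo x"
  proof -
    have "Y / hi Y (apex Y) \<le> Y / hi Y x"
      using hi_mono[OF assms, of "apex Y"] hi_pos[OF assms(1)] assms x by (intro divide_left_mono) auto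
    moreover have "x * s / (E - 1) < apex Y * s / (E - 1)"
      using s E x by (intro divide_strict_right_mono mult_strict_right_mono) auto
    ultimately show ?thesis unfolding len_eq[OF assms(1)] by linarith
  qed
  thus "lo x < hi Y x" using lo_apex hi_apex assms by simp
qed

lemma primitive_deriv:
  assumes "Y > 0"
  shows "(primitive Y has_real_derivative (hi Y x - lo x)) (at x)"
proof -
  define r where "r = sqrt ((x * s)\<^sup>2 + 4 * Y)"
  have pos: "(x * s)\<^sup>2 + 4 * Y > 0" using assms by (intro add_nonneg_pos) auto
  hence r: "r > 0" unfolding r_def by simp
  have hir: "hi Y x = (x * s + r) / 2" unfolding hi_def r_def ..
  have hp: "hi Y x > 0" using hi_pos[OF assms] by simp
  have sq: "((\<lambda>x. sqrt ((x * s)\<^sup>2 + 4 * Y)) has_real_derivative x * s * s / r) (at x)"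
  proof -
    have "((\<lambda>x. (x * s)\<^sup>2 + 4 * Y) has_real_derivative 2 * (x * s) * s) (at x)"
      by (auto intro!: derivative_eq_intros)
    from DERIV_chain2[OF DERIV_real_sqrt[OF pos] this]
    show ?thesis unfolding r_def by (simp add: field_simps)
  qed
  have "(hi Y has_real_derivative (s + x * s * s / r) / 2) (at x)"
  proof -
    have "((\<lambda>x. x * s) has_real_derivative s) (at x)" by (auto intro!: derivative_eq_intros)
    from DERIV_cdivide[OF DERIV_add[OF this sq], of 2] show ?thesis unfolding hi_def[abs_def] .
  qed
  also have "(s + x * s * s / r) / 2 = s * hi Y x / r" unfolding hir using r by (simp add: field_simps)
  finally have dh: "(hi Y has_real_derivative s * hi Y x / r) (at x)" .
  have "(primitive Y has_real_derivative
     ((2 * hi Y x * (s * hi Y x / r)) / 2 + Y * (s * hi Y x / r / hi Y x)) / s - 2 * x * s * E / (2 * (E - 1))) (at x)"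
  proof -
    have "((\<lambda>x. (hi Y x)\<^sup>2) has_real_derivative 2 * hi Y x * (s * hi Y x / r)) (at x)"
      using DERIV_mult[OF dh dh] by (simp add: power2_eq_square algebra_simps)
    moreover have "((\<lambda>x. ln (hi Y x)) has_real_derivative s * hi Y x / r / hi Y x) (at x)"
      using DERIV_chain2[OF DERIV_ln_divide[OF hp] dh] hp by simp
    moreover have "((\<lambda>x. x\<^sup>2 * s * E) has_real_derivative 2 * x * s * E) (at x)"
      by (auto intro!: derivative_eq_intros)
    ultimately show ?thesis unfolding primitive_def[abs_def]
      by (intro DERIV_diff DERIV_cdivide DERIV_add DERIV_cmult)
  qed
  also have "((2 * hi Y x * (s * hi Y x / r)) / 2 + Y * (s * hi Y x / r / hi Y x)) / s = (hi Y x * hi Y x + Y) / r"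
    using s hp r by (simp add: field_simps)
  also have "hi Y x * hi Y x + Y = hi Y x * r"
    using hi_root[OF assms, of x] unfolding hir by (simp add: field_simps)
  also have "2 * x * s * E / (2 * (E - 1)) = lo x"
    unfolding lo_def using E by (simp add: divide_simps)
  also have "hi Y x * r / r = hi Y x" using r by simp
  finally show ?thesis .
qed

lemma primitive_mvt:
  assumes "Y > 0" "0 \<le> x" "x \<le> y"
  shows "primitive Y y - primitive Y x \<le> (y - x) * (hi Y x - lo x)"
    and "primitive Y y - primitive Y x \<ge> (y - x) * (hi Y y - lo y)"
proof -
  have "primitive Y y - primitive Y x \<le> (y - x) * (hi Y x - lo x) \<and>
        primitive Y y - primitive Y x \<ge> (y - x) * (hi Y y - lo y)"
  proof (cases "x = y")
    case False
    hence "x < y" using assms by simp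
    from MVT2[OF this, of "primitive Y" "\<lambda>x. hi Y x - lo x"] primitive_deriv[OF assms(1)]
    obtain z where z: "x < z" "z < y" "primitive Y y - primitive Y x = (y - x) * (hi Y z - lo z)" by blast
    show ?thesis unfolding z(3) using len_antimono[OF assms(1)] z assms by (auto intro!: mult_left_mono)
  qed simp
  thus "primitive Y y - primitive Y x \<le> (y - x) * (hi Y x - lo x)"
    "primitive Y y - primitive Y x \<ge> (y - x) * (hi Y y - lo y)" by auto
qed

text \<open>The quadratic terms cancel; only the logarithm of \<open>hi\<close> survives, and it is
  the source of ln eps in the class number formula.\<close>

lemma primitive_diff:
  assumes "Y > 0"
  shows "primitive Y (apex Y) - primitive Y 0 = Y * ln E / (2 * s)"
proof -
  have t: "(apex Y)\<^sup>2 * s * E / (2 * (E - 1)) = Y * (E - 1) / (2 * s)"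
    unfolding apex_def using assms s E by (simp add: power_divide power_mult_distrib) (simp add: field_simps power2_eq_square)
  have l: "ln (sqrt Y * sqrt E) = ln Y / 2 + ln E / 2" "ln (sqrt Y) = ln Y / 2"
    using assms E by (simp_all add: ln_mult ln_sqrt)
  have "primitive Y (apex Y) = (Y * E / 2 + Y * (ln Y / 2 + ln E / 2)) / s - Y * (E - 1) / (2 * s)"
    unfolding primitive_def hi_apex[OF assms] t l using assms E by (simp add: power_mult_distrib)
  moreover have "primitive Y 0 = (Y / 2 + Y * (ln Y / 2)) / s"
    unfolding primitive_def hi_0[OF assms] l using assms by simp
  ultimately have "primitive Y (apex Y) - primitive Y 0 =
      (Y * E / 2 + Y * (ln Y / 2 + ln E / 2)) / s - Y * (E - 1) / (2 * s) - (Y / 2 + Y * (ln Y / 2)) / s" by simp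
  also have "\<dots> = Y * ln E / (2 * s)" using s by (simp add: field_simps)
  finally show ?thesis .
qed

definition rows :: "real \<Rightarrow> nat" where "rows Y = nat \<lceil>apex Y\<rceil>"

lemma rows: "real n < apex Y \<longleftrightarrow> n < rows Y"
  unfolding rows_def by (simp add: zless_nat_eq_int_zless less_ceiling_iff)

lemma rows_le: "Y > 0 \<Longrightarrow> real (rows Y) \<le> apex Y + 1"
  unfolding rows_def using apex_pos[of Y] by linarith

text \<open>Comparison of sum and integral for a decreasing function: the error is at most the value
  at 0, which is sqrt Y.\<close>

lemma sum_len_bounds:
  assumes "Y > 0"
  shows "\<bar>(\<Sum>n<rows Y. hi Y n - lo n) - Y * ln E / (2 * s)\<bar> \<le> sqrt Y"
proof -
  \<comment> \<open>Capping the argument at \<open>apex Y\<close> takes care of the last row, whose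
    unit interval may extend past the apex.\<close>
  let ?K = "\<lambda>n. primitive Y (min (real n) (apex Y))"
  have apex: "apex Y > 0" using apex_pos assms by blast
  have R: "rows Y > 0" using rows[of 0 Y] apex by simp
  have Kend: "?K (rows Y) = primitive Y (apex Y)" using rows[of "rows Y" Y] by (simp add: min_def)
  have "?K (rows Y) - ?K 0 = (\<Sum>n<rows Y. ?K (Suc n) - ?K n)" by (rule sum_lessThan_telescope[symmetric])
  also have "\<dots> \<le> (\<Sum>n<rows Y. hi Y n - lo n)"
  proof (rule sum_mono)
    fix n assume "n \<in> {..<rows Y}"
    hence n: "real n < apex Y" using rows by auto
    have "?K (Suc n) - ?K n \<le> (min (real (Suc n)) (apex Y) - real n) * (hi Y n - lo n)"
      using primitive_mvt(1)[OF assms, of "real n" "min (real (Suc n)) (apex Y)"] n by (simp add: min_def)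
    also have "\<dots> \<le> 1 * (hi Y n - lo n)"
      using n lo_less_hi_iff[OF assms, of n] by (intro mult_right_mono) auto
    finally show "?K (Suc n) - ?K n \<le> hi Y n - lo n" by simp
  qed
  finally have lower: "primitive Y (apex Y) - primitive Y 0 \<le> (\<Sum>n<rows Y. hi Y n - lo n)"
    using Kend apex by simp
  have "(\<Sum>n<rows Y. hi Y n - lo n) = hi Y 0 - lo 0 + (\<Sum>n<rows Y - 1. hi Y (Suc n) - lo (Suc n))"
    using R sum.lessThan_Suc_shift[of "\<lambda>n. hi Y n - lo n" "rows Y - 1"] by simp
  also have "(\<Sum>n<rows Y - 1. hi Y (Suc n) - lo (Suc n)) \<le> (\<Sum>n<rows Y - 1. ?K (Suc n) - ?K n)"
  proof (rule sum_mono)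
    fix n assume "n \<in> {..<rows Y - 1}"
    hence n: "real (Suc n) < apex Y" unfolding rows by auto
    thus "hi Y (Suc n) - lo (Suc n) \<le> ?K (Suc n) - ?K n"
      using primitive_mvt(2)[OF assms, of "real n" "real (Suc n)"] by (simp add: min_def)
  qed
  also have "\<dots> = ?K (rows Y - 1) - ?K 0" by (rule sum_lessThan_telescope)
  also have "?K (rows Y - 1) \<le> primitive Y (apex Y)"
  proof -
    have t: "real (rows Y - 1) < apex Y" unfolding rows using R by simp
    have "(apex Y - real (rows Y - 1)) * (hi Y (apex Y) - lo (apex Y)) \<le> primitive Y (apex Y) - primitive Y (real (rows Y - 1))"
      using t by (intro primitive_mvt(2)[OF assms]) auto
    thus ?thesis using t hi_apex lo_apex assms by simp
  qed
  finally have upper: "(\<Sum>n<rows Y. hi Y n - lo n) \<le> sqrt Y + (primitive Y (apex Y) - primitive Y 0)"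
    using hi_0[OF assms] apex by (simp add: lo_def)
  show ?thesis using lower upper assms unfolding primitive_diff[OF assms] by (simp add: abs_le_iff)
qed

lemma sector_eq:
  assumes "Y > 0"
  shows "sector Y = (\<Union>n<rows Y. (\<lambda>k. (k, int n)) ` {k::int. lo n < a * k + n * \<beta> \<and> a * k + n * \<beta> \<le> hi Y n})"
proof -
  have row: "(x > 0 \<and> x - n * s > 0 \<and> x - n * s \<le> x \<and> x < E * (x - n * s) \<and> x * (x - n * s) \<le> Y)
      \<longleftrightarrow> (n < rows Y \<and> lo n < x \<and> x \<le> hi Y n)" for x and n :: nat
  proof
    assume h: "x > 0 \<and> x - n * s > 0 \<and> x - n * s \<le> x \<and> x < E * (x - n * s) \<and> x * (x - n * s) \<le> Y"
    hence "lo n < x" unfolding lo_def using E by (simp add: field_simps)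
    moreover have "x \<le> hi Y n" using h le_hi_iff[OF assms, of x "real n"] by simp
    ultimately show "n < rows Y \<and> lo n < x \<and> x \<le> hi Y n"
      using rows lo_less_hi_iff[OF assms, of n] by auto
  next
    assume h: "n < rows Y \<and> lo n < x \<and> x \<le> hi Y n"
    have "0 \<le> n * s" using s by simp
    hence x: "x > n * s" "x > 0" using lo_ge[of "real n"] h by auto
    moreover have "x < E * (x - n * s)" using h unfolding lo_def using E by (simp add: field_simps)
    ultimately show "x > 0 \<and> x - n * s > 0 \<and> x - n * s \<le> x \<and> x < E * (x - n * s) \<and> x * (x - n * s) \<le> Y"
      using h le_hi_iff[OF assms x(2,1)] s by auto
  qed
  show ?thesis
  proof (intro equalityI subsetI)
    fix q assume q: "q \<in> sector Y"
    obtain k n where kn: "q = (k, n)" by fastforce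
    \<comment> \<open>The condition x' \<le> x says exactly that n s is nonnegative.\<close>
    have "n \<ge> 0" using q s unfolding sector_def kn by (auto simp: Let_def zero_le_mult_iff)
    then obtain m where m: "n = int m" using nonneg_int_cases by blast
    show "q \<in> (\<Union>n<rows Y. (\<lambda>k. (k, int n)) ` {k::int. lo n < a * k + n * \<beta> \<and> a * k + n * \<beta> \<le> hi Y n})"
      using q row[of "a * k + m * \<beta>" m] unfolding sector_def kn m by (auto simp: Let_def)
  next
    fix q assume "q \<in> (\<Union>n<rows Y. (\<lambda>k. (k, int n)) ` {k::int. lo n < a * k + n * \<beta> \<and> a * k + n * \<beta> \<le> hi Y n})"
    then obtain k n where kn: "q = (k, int n)" "n < rows Y" "lo n < a * k + n * \<beta>" "a * k + n * \<beta> \<le> hi Y n" by auto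
    thus "q \<in> sector Y" using row[of "a * k + n * \<beta>" n] unfolding sector_def by (auto simp: Let_def)
  qed
qed

text \<open>Counting integers in a row costs an error of at most 1; the number of rows and the error
  of the sum of lengths are both of order sqrt Y.\<close>

lemma card_sector:
  assumes "Y > 0"
  shows "finite (sector Y)" and "\<bar>real (card (sector Y)) - Y * ln E / (2 * s * a)\<bar> \<le> sqrt Y / a + apex Y + 1"
proof -
  let ?R = "\<lambda>n::nat. {k::int. lo n < a * k + n * \<beta> \<and> a * k + n * \<beta> \<le> hi Y n}"
  have le: "lo n \<le> hi Y n" if "n < rows Y" for n :: nat
    using that rows lo_less_hi_iff[OF assms, of n] by auto
  have fin: "finite (?R n)" if "n < rows Y" for n :: nat
    using card_progression(1)[OF a le[OF that]] .
  show "finite (sector Y)" unfolding sector_eq[OF assms] using fin by auto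
  have "card (sector Y) = (\<Sum>n<rows Y. card ((\<lambda>k. (k, int n)) ` ?R n))"
    unfolding sector_eq[OF assms] using fin by (intro card_UN_disjoint) auto
  also have "\<dots> = (\<Sum>n<rows Y. card (?R n))"
    by (intro sum.cong refl card_image) (auto intro: inj_onI)
  finally have c: "card (sector Y) = (\<Sum>n<rows Y. card (?R n))" .
  have "\<bar>real (card (sector Y)) - (\<Sum>n<rows Y. (hi Y n - lo n) / a)\<bar> = \<bar>\<Sum>n<rows Y. real (card (?R n)) - (hi Y n - lo n) / a\<bar>"
    unfolding c by (simp add: sum_subtractf)
  also have "\<dots> \<le> (\<Sum>n<rows Y. 1)"
    by (intro order.trans[OF sum_abs] sum_mono card_progression(2)[OF a le]) auto
  also have "\<dots> \<le> apex Y + 1" using rows_le[OF assms] by simp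
  finally have 1: "\<bar>real (card (sector Y)) - (\<Sum>n<rows Y. (hi Y n - lo n) / a)\<bar> \<le> apex Y + 1" .
  have "(\<Sum>n<rows Y. (hi Y n - lo n) / a) - Y * ln E / (2 * s * a) = ((\<Sum>n<rows Y. hi Y n - lo n) - Y * ln E / (2 * s)) / a"
    by (simp add: sum_divide_distrib diff_divide_distrib)
  hence "\<bar>(\<Sum>n<rows Y. (hi Y n - lo n) / a) - Y * ln E / (2 * s * a)\<bar> \<le> sqrt Y / a"
    using sum_len_bounds[OF assms] a by (simp add: divide_right_mono)
  thus "\<bar>real (card (sector Y)) - Y * ln E / (2 * s * a)\<bar> \<le> sqrt Y / a + apex Y + 1" using 1 by linarith
qed

theorem sector_asymptotics:
  "((\<lambda>Y. real (card (sector Y)) / Y) \<longlongrightarrow> ln E / (2 * s * a)) at_top"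
proof -
  define C where "C = 1 / a + (E - 1) / (s * sqrt E)"
  have "((\<lambda>Y. real (card (sector Y)) / Y - ln E / (2 * s * a)) \<longlongrightarrow> 0) at_top"
  proof (rule Lim_null_comparison)
    show "\<forall>\<^sub>F Y in at_top. norm (real (card (sector Y)) / Y - ln E / (2 * s * a)) \<le> C * (sqrt Y / Y) + 1 / Y"
      using eventually_gt_at_top[of 0]
    proof eventually_elim
      case (elim Y)
      have "real (card (sector Y)) / Y - ln E / (2 * s * a) = (real (card (sector Y)) - Y * ln E / (2 * s * a)) / Y"
        using elim by (simp add: field_simps)
      hence "norm (real (card (sector Y)) / Y - ln E / (2 * s * a)) \<le> (sqrt Y / a + apex Y + 1) / Y"
        using card_sector(2)[OF elim] elim by (simp add: divide_right_mono)
      also have "\<dots> = C * (sqrt Y / Y) + 1 / Y" unfolding C_def apex_def by (simp add: add_divide_distrib algebra_simps)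
      finally show ?case .
    qed
    have "((\<lambda>Y::real. inverse (sqrt Y)) \<longlongrightarrow> 0) at_top"
      by (rule filterlim_compose[OF tendsto_inverse_0_at_top[OF filterlim_ident] sqrt_at_top])
    moreover have "\<forall>\<^sub>F Y::real in at_top. inverse (sqrt Y) = sqrt Y / Y"
      using eventually_gt_at_top[of 0]
    proof eventually_elim
      case (elim Y)
      thus ?case by (simp add: real_div_sqrt field_simps)
    qed
    ultimately have 1: "((\<lambda>Y::real. sqrt Y / Y) \<longlongrightarrow> 0) at_top" by (rule Lim_transform_eventually)
    have 2: "((\<lambda>Y::real. 1 / Y) \<longlongrightarrow> 0) at_top"
      using tendsto_inverse_0_at_top[OF filterlim_ident] by (simp add: divide_inverse)
    show "((\<lambda>Y. C * (sqrt Y / Y) + 1 / Y) \<longlongrightarrow> 0) at_top"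
      using tendsto_add[OF tendsto_mult[OF tendsto_const 1, of C] 2] by simp
  qed
  thus ?thesis by (rule LIM_zero_cancel)
qed

end

section \<open>The ring of integers\<close>

text \<open>If r = a / b is reduced, then b^k divides D for every k, which forces b = 1.\<close>

lemma rat_power_denominator:
  fixes r :: real and D :: int
  assumes "r \<in> \<rat>" "D \<noteq> 0" "\<And>k. of_int D * r ^ k \<in> \<int>"
  shows "r \<in> \<int>"
proof -
  obtain a b where ab: "b > 0" "coprime a b" "r = of_int a / of_int b"
    using assms(1) by (elim Rats_cases')
  have dv: "b ^ k dvd D" for k
  proof -
    obtain c where "of_int D * r ^ k = of_int c" using assms(3)[of k] by (elim Ints_cases)
    hence "real_of_int (D * a ^ k) = real_of_int (c * b ^ k)"
      using ab by (simp add: power_divide field_simps)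
    hence "D * a ^ k = c * b ^ k" by (simp only: of_int_eq_iff)
    hence "b ^ k dvd D * a ^ k" by simp
    moreover have "coprime (b ^ k) (a ^ k)" using ab(2) by (simp add: coprime_commute)
    ultimately show ?thesis by (simp add: coprime_dvd_mult_left_iff)
  qed
  have "b = 1"
  proof (rule ccontr)
    assume "b \<noteq> 1"
    hence "b \<ge> 2" using ab by linarith
    define k where "k = nat \<bar>D\<bar>"
    have "int k < 2 ^ k" using less_exp[of k] by (metis of_nat_less_iff of_nat_numeral of_nat_power)
    also have "2 ^ k \<le> b ^ k" using \<open>b \<ge> 2\<close> by (intro power_mono) auto
    also have "b ^ k \<le> \<bar>D\<bar>" using dvd_imp_le_int[OF assms(2) dv[of k]] ab by simp
    finally show False unfolding k_def by simp
  qed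
  thus ?thesis using ab by simp
qed

context quad_prime
begin

definition sp :: real where "sp = sqrt (real p)"

definition omega :: real where "omega = (1 + sp) / 2"

abbreviation "K \<equiv> quadratic_field p"

abbreviation "OK \<equiv> ring_of_integers p"

lemma sp_pos: "sp > 0" and sp_sq: "sp * sp = real p"
  using p_ge_5 unfolding sp_def by auto

lemma sp_irrational: "sp \<notin> \<rat>"
proof
  assume "sp \<in> \<rat>"
  hence "sp \<in> \<int>" unfolding sp_def
    by (intro rational_algebraic_int_is_int algebraic_int_sqrt) auto
  then obtain k where k: "sp = of_int k" by (elim Ints_cases)
  hence "real_of_int (k * k) = real_of_int (int p)" using sp_sq by simp
  hence k2: "k * k = int p" by (simp only: of_int_eq_iff)
  hence "int p dvd k * k" by simp
  hence "int p dvd k" using prime_p prime_dvd_mult_iff[of "int p" k k] by simp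
  then obtain j where "k = int p * j" by (elim dvdE)
  hence "int p * (int p * j * j) = int p * 1" using k2 by (simp add: algebra_simps)
  hence "int p * (j * j) = 1" using p_ge_5 by (simp only: mult_cancel_left) (simp add: mult.assoc)
  thus False using p_ge_5 by (simp add: zmult_eq_1_iff)
qed

lemma rat_unique:
  assumes "x \<in> \<rat>" "y \<in> \<rat>" "x' \<in> \<rat>" "y' \<in> \<rat>" "x + y * sp = x' + y' * sp"
  shows "x = x'" "y = y'"
proof -
  show "y = y'"
  proof (rule ccontr)
    assume "y \<noteq> y'"
    hence "sp = (x' - x) / (y - y')" using assms(5) by (simp add: field_simps)
    hence "sp \<in> \<rat>" using assms by (auto intro: Rats_divide Rats_diff)
    thus False using sp_irrational by blast
  qed
  thus "x = x'" using assms(5) by simp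
qed

text \<open>The field is a set of reals, so conjugation has to be recovered from the rational
  coordinates, which are unique by irrationality of \<open>sp\<close>. Outside the field the value
  is unspecified.\<close>

definition cj :: "real \<Rightarrow> real" where
  "cj z = (THE w. \<exists>x\<in>\<rat>. \<exists>y\<in>\<rat>. z = x + y * sp \<and> w = x - y * sp)"

lemma cj_eq:
  assumes "x \<in> \<rat>" "y \<in> \<rat>"
  shows "cj (x + y * sp) = x - y * sp"
  unfolding cj_def
proof (rule the_equality)
  fix w assume "\<exists>x'\<in>\<rat>. \<exists>y'\<in>\<rat>. x + y * sp = x' + y' * sp \<and> w = x' - y' * sp"
  thus "w = x - y * sp" using rat_unique assms by metis
qed (use assms in blast)

lemma K_iff: "z \<in> K \<longleftrightarrow> (\<exists>x\<in>\<rat>. \<exists>y\<in>\<rat>. z = x + y * sp)"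
  unfolding quadratic_field_def sp_def by blast

lemma KI: "x \<in> \<rat> \<Longrightarrow> y \<in> \<rat> \<Longrightarrow> x + y * sp \<in> K"
  unfolding K_iff by blast

lemma KE:
  assumes "z \<in> K"
  obtains x y where "x \<in> \<rat>" "y \<in> \<rat>" "z = x + y * sp" "cj z = x - y * sp"
  using assms cj_eq unfolding K_iff by blast

lemma K_Rats [simp, intro]: "x \<in> \<rat> \<Longrightarrow> x \<in> K"
  using KI[of x 0] by simp

lemma cj_Rats [simp]: "x \<in> \<rat> \<Longrightarrow> cj x = x"
  using cj_eq[of x 0] by simp

lemma K_add [intro]: assumes "z \<in> K" "w \<in> K" shows "z + w \<in> K"
  and cj_add: "cj (z + w) = cj z + cj w"
proof -
  obtain x y x' y' where z: "x \<in> \<rat>" "y \<in> \<rat>" "z = x + y * sp" "cj z = x - y * sp"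
    and w: "x' \<in> \<rat>" "y' \<in> \<rat>" "w = x' + y' * sp" "cj w = x' - y' * sp"
    using assms KE by metis
  have "z + w = (x + x') + (y + y') * sp" using z w by (simp add: algebra_simps)
  thus "z + w \<in> K" "cj (z + w) = cj z + cj w" using KI[of "x+x'" "y+y'"] cj_eq[of "x+x'" "y+y'"] z w
    by (auto simp: Rats_add algebra_simps)
qed

lemma K_mult [intro]: assumes "z \<in> K" "w \<in> K" shows "z * w \<in> K"
  and cj_mult: "cj (z * w) = cj z * cj w"
proof -
  obtain x y x' y' where z: "x \<in> \<rat>" "y \<in> \<rat>" "z = x + y * sp" "cj z = x - y * sp"
    and w: "x' \<in> \<rat>" "y' \<in> \<rat>" "w = x' + y' * sp" "cj w = x' - y' * sp"
    using assms KE by metis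
  have *: "(x + y * sp) * (x' + y' * sp) = (x * x' + y * y' * real p) + (x * y' + y * x') * sp"
    "(x - y * sp) * (x' - y' * sp) = (x * x' + y * y' * real p) - (x * y' + y * x') * sp"
    unfolding sp_sq[symmetric] by (simp_all add: algebra_simps)
  have r: "x * x' + y * y' * real p \<in> \<rat>" "x * y' + y * x' \<in> \<rat>" using z w by auto
  show "z * w \<in> K" "cj (z * w) = cj z * cj w" using KI[OF r] cj_eq[OF r] z w * by simp_all
qed

lemma K_minus [intro]: assumes "z \<in> K" shows "- z \<in> K" and cj_minus: "cj (- z) = - cj z"
  using K_mult[OF K_Rats[of "-1"] assms] cj_mult[OF K_Rats[of "-1"] assms] by auto

lemma K_diff [intro]: assumes "z \<in> K" "w \<in> K" shows "z - w \<in> K" and cj_diff: "cj (z - w) = cj z - cj w"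
  using K_add[OF assms(1) K_minus(1)[OF assms(2)]] cj_add[OF assms(1) K_minus(1)[OF assms(2)]]
    cj_minus[OF assms(2)] by auto

lemma cj_in_K [simp, intro]: assumes "z \<in> K" shows "cj z \<in> K" and cj_cj: "cj (cj z) = z"
proof -
  obtain x y where z: "x \<in> \<rat>" "y \<in> \<rat>" "z = x + y * sp" "cj z = x - y * sp" using assms KE by metis
  have "cj z = x + (-y) * sp" using z by simp
  thus "cj z \<in> K" "cj (cj z) = z" using KI[of x "-y"] cj_eq[of x "-y"] z by auto
qed

lemma cj_eq_0_iff: assumes "z \<in> K" shows "cj z = 0 \<longleftrightarrow> z = 0"
  using cj_cj[OF assms] cj_Rats[of 0] by (metis Rats_0)

definition nrm :: "real \<Rightarrow> real" where "nrm z = z * cj z"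

lemma nrm_Rats: assumes "z \<in> K" shows "nrm z \<in> \<rat>"
proof -
  obtain x y where z: "x \<in> \<rat>" "y \<in> \<rat>" "z = x + y * sp" "cj z = x - y * sp" using assms KE by metis
  have "nrm z = x * x - y * y * real p" unfolding nrm_def z(4) unfolding z(3) sp_sq[symmetric] by (simp add: algebra_simps)
  thus ?thesis using z by auto
qed

lemma nrm_mult: "z \<in> K \<Longrightarrow> w \<in> K \<Longrightarrow> nrm (z * w) = nrm z * nrm w"
  unfolding nrm_def by (simp add: cj_mult)

lemma nrm_eq_0_iff: "z \<in> K \<Longrightarrow> nrm z = 0 \<longleftrightarrow> z = 0"
  unfolding nrm_def by (auto simp: cj_eq_0_iff)

lemma K_inverse [intro]: assumes "z \<in> K" shows "inverse z \<in> K" and cj_inverse: "cj (inverse z) = inverse (cj z)"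
proof -
  have "inverse z \<in> K \<and> cj (inverse z) = inverse (cj z)"
  proof (cases "z = 0")
    case False
    hence n: "nrm z \<noteq> 0" "cj z \<noteq> 0" using assms nrm_eq_0_iff cj_eq_0_iff by auto
    have "inverse z = cj z * inverse (nrm z)" unfolding nrm_def using False n by (simp add: field_simps)
    hence 1: "inverse z \<in> K" using assms nrm_Rats by (auto intro!: K_mult)
    have "cj (inverse z * z) = 1" using False by simp
    hence "cj (inverse z) * cj z = 1" using cj_mult[OF 1 assms] by simp
    thus ?thesis using 1 n by (simp add: field_simps)
  qed auto
  thus "inverse z \<in> K" "cj (inverse z) = inverse (cj z)" by auto
qed

lemma K_divide [intro]: assumes "z \<in> K" "w \<in> K" shows "z / w \<in> K" and cj_divide: "cj (z / w) = cj z / cj w"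
  unfolding divide_inverse using assms K_mult K_inverse cj_mult cj_inverse by auto

lemma K_power [intro]: assumes "z \<in> K" shows "z ^ n \<in> K" and cj_power: "cj (z ^ n) = cj z ^ n"
proof -
  have "z ^ n \<in> K \<and> cj (z ^ n) = cj z ^ n"
    by (induction n) (auto simp: cj_mult assms K_mult)
  thus "z ^ n \<in> K" "cj (z ^ n) = cj z ^ n" by auto
qed

lemma K_powi [intro]: assumes "z \<in> K" shows "z powi n \<in> K" and cj_powi: "cj (z powi n) = cj z powi n"
  unfolding power_int_def using assms K_power K_inverse cj_power cj_inverse by auto

lemma omega_K [simp, intro]: "omega \<in> K" and cj_omega: "cj omega = 1 - omega"
proof -
  have *: "omega = 1 / 2 + (1 / 2) * sp" unfolding omega_def by simp
  show "omega \<in> K" unfolding * by (intro KI) auto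
  have "cj omega = 1 / 2 - (1 / 2) * sp" unfolding * by (intro cj_eq) auto
  thus "cj omega = 1 - omega" unfolding omega_def by (simp add: field_simps)
qed

lemma omega_sq: "omega * omega = omega + of_int q0"
proof -
  have "real p = 4 * of_int q0 + 1" using p_eq by (metis of_int_add of_int_mult of_int_1 of_int_numeral of_int_of_nat_eq)
  thus ?thesis unfolding omega_def using sp_sq by (simp add: field_simps)
qed

lemma omega_minus_cj: "omega - cj omega = sp"
  unfolding cj_omega unfolding omega_def by (simp add: field_simps)

definition el :: "int \<Rightarrow> int \<Rightarrow> real" where "el m n = of_int m + of_int n * omega"

lemma el_K [simp, intro]: "el m n \<in> K"
  unfolding el_def by (rule K_add(1)[OF K_Rats K_mult(1)[OF K_Rats omega_K]]) auto

lemma cj_el: "cj (el m n) = el (m + n) (- n)"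
proof -
  have "cj (el m n) = cj (of_int m) + cj (of_int n * omega)" unfolding el_def by (rule cj_add) auto
  also have "cj (of_int n * omega) = of_int n * (1 - omega)" by (subst cj_mult) (auto simp: cj_omega)
  finally show ?thesis unfolding el_def by (simp add: algebra_simps)
qed

lemma el_eq_iff: "el m n = el m' n' \<longleftrightarrow> m = m' \<and> n = n'"
proof
  assume e: "el m n = el m' n'"
  have *: "el m n = (of_int m + of_int n / 2) + (of_int n / 2) * sp" for m n
    unfolding el_def omega_def by (simp add: field_simps)
  have r: "(of_int m + of_int n / 2 :: real) \<in> \<rat>" "(of_int n / 2 :: real) \<in> \<rat>" for m n :: int by auto
  have "(of_int n / 2 :: real) = of_int n' / 2" "(of_int m + of_int n / 2 :: real) = of_int m' + of_int n' / 2"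
    using rat_unique[OF r r] e unfolding * by blast+
  thus "m = m' \<and> n = n'" by simp
qed auto

lemma el_add: "el m n + el m' n' = el (m + m') (n + n')"
  unfolding el_def by (simp add: algebra_simps)

lemma el_mult: "el m n * el m' n' = el (m * m' + n * n' * q0) (m * n' + n * m' + n * n')"
proof -
  have "el m n * el m' n' = of_int (m * m') + of_int (m * n' + n * m') * omega + of_int (n * n') * (omega * omega)"
    unfolding el_def by (simp add: algebra_simps)
  thus ?thesis unfolding omega_sq el_def by (simp add: algebra_simps)
qed

lemma nrm_el: "nrm (el m n) = of_int (m * m + m * n - n * n * q0)"
  unfolding nrm_def cj_el el_mult unfolding el_def by (simp add: algebra_simps)

lemma algebraic_int_quadratic:
  fixes z :: real and t n :: int
  assumes "z * z = of_int t * z + of_int n"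
  shows "algebraic_int z"
proof (rule algebraic_int.intros)
  show "lead_coeff [:- real_of_int n, - real_of_int t, 1:] = 1" by simp
  show "poly [:- real_of_int n, - real_of_int t, 1:] z = 0" using assms by (simp add: algebra_simps)
  show "\<forall>i. Polynomial.coeff [:- real_of_int n, - real_of_int t, 1:] i \<in> \<int>"
    by (auto simp: coeff_pCons split: nat.split)
qed

lemma carrier_OK: "carrier OK = {z \<in> K. algebraic_int z}"
  unfolding ring_of_integers_def by simp

text \<open>The powers of an algebraic integer of the field have a common denominator; applied to \<open>z\<close> and \<open>z + 1\<close>
  this makes the norm and the trace of \<open>z\<close> integers.\<close>

lemma alg_int_powers:
  assumes "z \<in> K" "algebraic_int z"
  obtains D :: int where "D \<noteq> 0" "\<And>k. \<exists>i j :: int. of_int D * z ^ k = of_int i + of_int j * sp"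
proof -
  define M where "M = {of_int i + of_int j * sp | i j :: int. True}"
  have MI: "of_int i + of_int j * sp \<in> M" for i j unfolding M_def by blast
  have M_add: "x + y \<in> M" if xy: "x \<in> M" "y \<in> M" for x y
  proof -
    obtain i j i' j' where "x = of_int i + of_int j * sp" "y = of_int i' + of_int j' * sp"
      using xy unfolding M_def by blast
    thus ?thesis using MI[of "i + i'" "j + j'"] by (simp add: algebra_simps)
  qed
  have M_mult: "x * y \<in> M" if xy: "x \<in> M" "y \<in> M" for x y
  proof -
    obtain i j i' j' where "x = of_int i + of_int j * sp" "y = of_int i' + of_int j' * sp"
      using xy unfolding M_def by blast
    hence "x * y = of_int (i * i') + of_int (i * j' + j * i') * sp + of_int (j * j') * (sp * sp)"
      by (simp add: algebra_simps)
    thus ?thesis using MI[of "i * i' + j * j' * int p" "i * j' + j * i'"] unfolding sp_sq by (simp add: algebra_simps)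
  qed
  have M_int: "of_int i \<in> M" for i using MI[of i 0] by simp
  have M_pow: "x ^ n \<in> M" if "x \<in> M" for x n
    using that by (induction n) (use M_int[of 1] M_mult in auto)
  have M_sum: "(\<Sum>i\<in>A. f i) \<in> M" if "\<And>i. i \<in> A \<Longrightarrow> f i \<in> M" for f and A :: "nat set"
    using that by (induction A rule: infinite_finite_induct) (use M_int[of 0] M_add in auto)
  obtain f where f: "lead_coeff f = 1" "\<forall>i. Polynomial.coeff f i \<in> \<int>" "poly f z = 0"
    using assms(2) by (auto elim: algebraic_int.cases)
  define n where "n = degree f"
  have "poly f z = (\<Sum>i<n. Polynomial.coeff f i * z ^ i) + z ^ n"
    unfolding poly_altdef n_def using f(1) by (simp add: lessThan_Suc_atMost[symmetric])
  hence zn: "z ^ n = - (\<Sum>i<n. Polynomial.coeff f i * z ^ i)" using f(3) by simp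
  obtain x y where xy: "x \<in> \<rat>" "y \<in> \<rat>" "z = x + y * sp" using assms(1) KE by metis
  obtain a b where ab: "b > 0" "x = of_int a / of_int b" using xy(1) by (elim Rats_cases')
  obtain c d where cd: "d > 0" "y = of_int c / of_int d" using xy(2) by (elim Rats_cases')
  define e where "e = b * d"
  have e0: "e \<noteq> 0" using ab cd unfolding e_def by simp
  have "of_int e * z = of_int (a * d) + of_int (c * b) * sp"
    unfolding e_def xy(3) ab(2) cd(2) using ab(1) cd(1) by (simp add: field_simps)
  hence ez: "of_int e * z \<in> M" using MI by metis
  \<comment> \<open>The factor e^n clears the denominators of all z^k with k < n; the monic relation
    \<open>zn\<close> reduces higher powers to lower ones with integer coefficients.\<close>
  have "of_int (e ^ n) * z ^ k \<in> M" for k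
  proof (induction k rule: less_induct)
    case (less k)
    show ?case
    proof (cases "k < n")
      case True
      have *: "of_int (e ^ n) * z ^ k = of_int (e ^ (n - k)) * (of_int e * z) ^ k"
        using True by (simp add: power_mult_distrib mult.assoc[symmetric] power_add[symmetric])
      show ?thesis unfolding * by (rule M_mult[OF M_int M_pow[OF ez]])
    next
      case False
      hence "z ^ k = z ^ n * z ^ (k - n)" by (simp add: power_add[symmetric])
      also have "\<dots> = (\<Sum>i<n. - Polynomial.coeff f i * z ^ (i + (k - n)))"
        unfolding zn by (simp add: sum_distrib_right power_add mult.assoc sum_negf)
      finally have "of_int (e ^ n) * z ^ k = (\<Sum>i<n. - Polynomial.coeff f i * (of_int (e ^ n) * z ^ (i + (k - n))))"
        by (simp add: sum_distrib_left mult.left_commute mult.assoc)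
      moreover have "- Polynomial.coeff f i * (of_int (e ^ n) * z ^ (i + (k - n))) \<in> M" if i: "i < n" for i
      proof -
        have "- Polynomial.coeff f i \<in> \<int>" using f(2) by simp
        then obtain g where "- Polynomial.coeff f i = of_int g" by (elim Ints_cases)
        moreover have "of_int (e ^ n) * z ^ (i + (k - n)) \<in> M" using less[of "i + (k - n)"] i False by simp
        ultimately show ?thesis using M_mult[OF M_int] by metis
      qed
      ultimately show ?thesis using M_sum[of "{..<n}"] by simp
    qed
  qed
  thus ?thesis using that[of "e ^ n"] e0 unfolding M_def by force
qed

lemma nrm_int_of_powers:
  assumes "z \<in> K" "D \<noteq> (0::int)" "\<And>k. \<exists>i j :: int. of_int D * z ^ k = of_int i + of_int j * sp"
  shows "nrm z \<in> \<int>"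
proof (rule rat_power_denominator)
  show "nrm z \<in> \<rat>" using nrm_Rats assms(1) by blast
  show "D * D \<noteq> 0" using assms(2) by simp
  fix k
  obtain i j :: int where ij: "of_int D * z ^ k = of_int i + of_int j * sp" using assms(3) by blast
  have "cj (of_int D * z ^ k) = of_int D * cj z ^ k"
    using assms(1) K_power by (simp add: cj_mult cj_power)
  hence "of_int D * cj z ^ k = of_int i - of_int j * sp" unfolding ij using cj_eq[of "of_int i" "of_int j"] by simp
  hence "of_int (D * D) * nrm z ^ k = (of_int i + of_int j * sp) * (of_int i - of_int j * sp)"
    using ij unfolding nrm_def by (metis (no_types, lifting) mult.assoc mult.left_commute of_int_mult power_mult_distrib)
  also have "\<dots> = of_int (i * i) - of_int (j * j) * (sp * sp)" by (simp add: algebra_simps)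
  also have "\<dots> = of_int (i * i - j * j * int p)" unfolding sp_sq by simp
  finally show "of_int (D * D) * nrm z ^ k \<in> \<int>" using Ints_of_int by metis
qed

text \<open>With integral trace T and norm n, the number T^2 - 4 n equals p w^2 for w = 2 y, and w
  is an integer because p is squarefree. As p is odd, T and w have the same parity, which is what
  membership in the lattice of 1 and omega requires.\<close>

theorem OK_iff: "z \<in> carrier OK \<longleftrightarrow> (\<exists>m n. z = el m n)"
proof
  assume "\<exists>m n. z = el m n"
  then obtain m n where z: "z = el m n" by blast
  have "z * z = of_int (2 * m + n) * z + of_int (n * n * q0 - m * m - m * n)"
    unfolding z el_mult unfolding el_def by (simp add: algebra_simps)
  hence "algebraic_int z" by (rule algebraic_int_quadratic)
  thus "z \<in> carrier OK" unfolding carrier_OK z by simp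
next
  assume "z \<in> carrier OK"
  hence zK: "z \<in> K" and za: "algebraic_int z" unfolding carrier_OK by auto
  obtain D where D: "D \<noteq> 0" "\<And>k. \<exists>i j :: int. of_int D * z ^ k = of_int i + of_int j * sp"
    using alg_int_powers[OF zK za] by blast
  have N: "nrm z \<in> \<int>" by (rule nrm_int_of_powers[OF zK D])
  have N1: "nrm (z + 1) \<in> \<int>"
  proof (rule nrm_int_of_powers[OF _ D(1)])
    show "z + 1 \<in> K" using zK by auto
    fix k
    obtain f g where fg: "\<And>k. of_int D * z ^ k = of_int (f k) + of_int (g k :: int) * sp" using D(2) by metis
    have "of_int D * (z + 1) ^ k = (\<Sum>i\<le>k. of_nat (k choose i) * (of_int D * z ^ i))"
      unfolding binomial_ring by (simp add: sum_distrib_left mult_ac)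
    also have "\<dots> = of_int (\<Sum>i\<le>k. int (k choose i) * f i) + of_int (\<Sum>i\<le>k. int (k choose i) * g i) * sp"
      unfolding fg by (simp add: distrib_left sum.distrib sum_distrib_right mult.assoc)
    finally show "\<exists>i j :: int. of_int D * (z + 1) ^ k = of_int i + of_int j * sp" by blast
  qed
  obtain x y where xy: "x \<in> \<rat>" "y \<in> \<rat>" "z = x + y * sp" "cj z = x - y * sp" using zK KE by metis
  have tr: "2 * x = nrm (z + 1) - nrm z - 1"
    using zK unfolding nrm_def by (simp add: cj_add xy(3,4) algebra_simps cj_eq xy)
  hence "2 * x \<in> \<int>" using N N1 by (metis Ints_1 Ints_diff)
  then obtain T where T: "2 * x = of_int T" by (elim Ints_cases)
  obtain n where n: "nrm z = of_int n" using N by (elim Ints_cases)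
  have nn: "nrm z = x * x - y * y * real p" unfolding nrm_def xy(4) unfolding xy(3) sp_sq[symmetric] by (simp add: algebra_simps)
  have "(real p * (2 * y)) * (real p * (2 * y)) = real p * ((2 * x) * (2 * x) - 4 * nrm z)"
    unfolding nn by (simp add: algebra_simps)
  hence v2: "(real p * (2 * y)) * (real p * (2 * y)) = of_int 0 * (real p * (2 * y)) + of_int (int p * (T * T - 4 * n))"
    unfolding T n by simp
  hence "algebraic_int (real p * (2 * y))" by (rule algebraic_int_quadratic)
  hence "real p * (2 * y) \<in> \<int>" using xy by (intro rational_algebraic_int_is_int) auto
  then obtain v where v: "real p * (2 * y) = of_int v" by (elim Ints_cases)
  have "real_of_int (v * v) = of_int (int p * (T * T - 4 * n))" using v2 unfolding v by simp
  hence vv: "v * v = int p * (T * T - 4 * n)" by (simp only: of_int_eq_iff)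
  hence "int p dvd v * v" by simp
  hence "int p dvd v" using prime_p prime_dvd_mult_iff[of "int p" v v] by simp
  then obtain w where w: "v = int p * w" by (elim dvdE)
  have yw: "2 * y = of_int w" using v w p_ge_5 by simp
  have "int p * (int p * (w * w)) = int p * (T * T - 4 * n)" using vv w by (simp add: algebra_simps)
  hence "int p * (w * w) = T * T - 4 * n" using p_ge_5 by simp
  hence "even T \<longleftrightarrow> even w" using p_eq by (metis dvd_triv_left even_diff even_mult_iff even_numeral odd_one even_add)
  hence "even (T - w)" by simp
  then obtain m where m: "T - w = 2 * m" by (elim evenE)
  have half: "x = of_int T / 2" "y = of_int w / 2" using T yw by auto
  have "z = of_int T / 2 + of_int w / 2 * sp" unfolding xy(3) half ..
  also have "T = 2 * m + w" using m by simp
  finally have "z = el m w" unfolding el_def omega_def by (simp add: field_simps)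
  thus "\<exists>m n. z = el m n" by blast
qed

lemma OK_el [simp, intro]: "el m n \<in> carrier OK"
  unfolding OK_iff by blast

lemma OK_E: assumes "z \<in> carrier OK" obtains m n where "z = el m n"
  using assms OK_iff by blast

lemma OK_K: "z \<in> carrier OK \<Longrightarrow> z \<in> K"
  unfolding carrier_OK by simp

lemma OK_int [simp, intro]: "of_int m \<in> carrier OK"
  using OK_el[of m 0] unfolding el_def by simp

lemma OK_0 [simp]: "0 \<in> carrier OK" and OK_1 [simp]: "1 \<in> carrier OK"
  using OK_int[of 0] OK_int[of 1] by auto

lemma OK_add: "z \<in> carrier OK \<Longrightarrow> w \<in> carrier OK \<Longrightarrow> z + w \<in> carrier OK"
  and OK_mult: "z \<in> carrier OK \<Longrightarrow> w \<in> carrier OK \<Longrightarrow> z * w \<in> carrier OK"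
  and OK_cj: "z \<in> carrier OK \<Longrightarrow> cj z \<in> carrier OK"
  unfolding OK_iff by (metis el_add, metis el_mult, metis cj_el)

lemma OK_minus: "z \<in> carrier OK \<Longrightarrow> - z \<in> carrier OK"
  using OK_mult[OF OK_int[of "-1"]] by simp

lemma OK_sel [simp]: "mult OK = (*)" "one OK = 1" "zero OK = 0" "add OK = (+)"
  unfolding ring_of_integers_def by auto

lemma OK_cring: "cring OK"
proof (rule cringI)
  show "abelian_group OK"
  proof (rule abelian_groupI)
    fix x assume "x \<in> carrier OK"
    thus "\<exists>y\<in>carrier OK. y \<oplus>\<^bsub>OK\<^esub> x = \<zero>\<^bsub>OK\<^esub>" using OK_minus by (intro bexI[of _ "-x"]) auto
  qed (auto simp: OK_add)
  show "Group.comm_monoid OK"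
    by (rule Group.comm_monoidI) (auto simp: OK_mult)
qed (auto simp: algebra_simps)

lemma OK_Units: "u \<in> Units OK \<longleftrightarrow> u \<in> carrier OK \<and> (\<exists>v\<in>carrier OK. u * v = 1)"
  unfolding Units_def by (auto simp: mult.commute)

lemma OK_nrm: assumes "z \<in> carrier OK" obtains n where "nrm z = of_int n"
  using assms nrm_el OK_iff by metis

lemma unit_nrm: assumes "u \<in> Units OK" shows "nrm u = 1 \<or> nrm u = -1"
proof -
  obtain v where uv: "u \<in> carrier OK" "v \<in> carrier OK" "u * v = 1" using assms OK_Units by auto
  obtain m n where mn: "nrm u = of_int m" "nrm v = of_int n" using uv OK_nrm by metis
  have "nrm u * nrm v = 1" using nrm_mult[of u v] uv OK_K by (simp add: nrm_def)
  hence "real_of_int (m * n) = real_of_int 1" using mn by simp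
  hence "m * n = 1" by (simp only: of_int_eq_iff)
  thus ?thesis using mn by (auto simp: zmult_eq_1_iff)
qed

lemma ideal_iff: "ideal I OK \<longleftrightarrow> I \<subseteq> carrier OK \<and> 0 \<in> I \<and> (\<forall>x\<in>I. \<forall>y\<in>I. x + y \<in> I)
    \<and> (\<forall>r\<in>carrier OK. \<forall>x\<in>I. r * x \<in> I)"
proof
  assume "ideal I OK"
  then interpret ideal I OK .
  show "I \<subseteq> carrier OK \<and> 0 \<in> I \<and> (\<forall>x\<in>I. \<forall>y\<in>I. x + y \<in> I) \<and> (\<forall>r\<in>carrier OK. \<forall>x\<in>I. r * x \<in> I)"
    using a_subset additive_subgroup.zero_closed[OF is_additive_subgroup]
      additive_subgroup.a_closed[OF is_additive_subgroup] I_l_closed by auto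
next
  assume h: "I \<subseteq> carrier OK \<and> 0 \<in> I \<and> (\<forall>x\<in>I. \<forall>y\<in>I. x + y \<in> I) \<and> (\<forall>r\<in>carrier OK. \<forall>x\<in>I. r * x \<in> I)"
  interpret R: cring OK by (rule OK_cring)
  show "ideal I OK"
  proof (rule idealI)
    show "ring OK" by (rule R.ring_axioms)
    show "subgroup I (add_monoid OK)"
    proof (rule group.subgroupI[OF R.a_group])
      fix x assume x: "x \<in> I"
      hence "- x \<in> I" using h OK_int[of "-1"] by (metis mult_minus1 of_int_1 of_int_minus)
      moreover have "inv\<^bsub>add_monoid OK\<^esub> x = - x"
        unfolding a_inv_def[symmetric] using x h OK_minus[of x] by (intro R.minus_equality) auto
      ultimately show "inv\<^bsub>add_monoid OK\<^esub> x \<in> I" by simp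
    qed (use h in auto)
    fix a x assume "a \<in> I" "x \<in> carrier OK"
    thus "x \<otimes>\<^bsub>OK\<^esub> a \<in> I" "a \<otimes>\<^bsub>OK\<^esub> x \<in> I" using h by (simp_all add: mult.commute[of a x])
  qed
qed

end

section \<open>Ideals in normal form\<close>

lemma int_subgroup_generator:
  fixes S :: "int set"
  assumes "m \<in> S" "m \<noteq> 0" "\<And>x y. x \<in> S \<Longrightarrow> y \<in> S \<Longrightarrow> x - y \<in> S"
  shows "\<exists>d::nat. d > 0 \<and> int d \<in> S \<and> (\<forall>n. n \<in> S \<longleftrightarrow> int d dvd n)"
proof -
  have z: "0 \<in> S" using assms(3)[OF assms(1,1)] by simp
  have neg: "- x \<in> S" if "x \<in> S" for x using assms(3)[OF z that] by simp
  have add: "x + y \<in> S" if "x \<in> S" "y \<in> S" for x y using assms(3)[OF that(1) neg[OF that(2)]] by simp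
  have mult: "int k * x \<in> S" if "x \<in> S" for k x
    by (induction k) (auto simp: z algebra_simps intro: add that)
  have multi: "k * x \<in> S" if "x \<in> S" for k x
  proof (cases "k \<ge> 0")
    case True
    thus ?thesis using mult[OF that, of "nat k"] by simp
  next
    case False
    thus ?thesis using neg[OF mult[OF that, of "nat (- k)"]] by simp
  qed
  let ?P = "\<lambda>d::nat. d > 0 \<and> int d \<in> S"
  have "?P (nat \<bar>m\<bar>)" using assms(1,2) neg[OF assms(1)] by (auto simp: abs_if)
  hence ex: "\<exists>d. ?P d" by blast
  define d where "d = (LEAST d. ?P d)"
  have d: "d > 0" "int d \<in> S" using LeastI_ex[OF ex] unfolding d_def by auto
  have "int d dvd n" if n: "n \<in> S" for n
  proof (rule ccontr)
    assume nd: "\<not> int d dvd n"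
    have "n - (n div int d) * int d \<in> S" using assms(3)[OF n multi[OF d(2)]] .
    hence "n mod int d \<in> S" by (simp add: minus_div_mult_eq_mod)
    moreover have "n mod int d \<noteq> 0" using nd by (simp add: dvd_eq_mod_eq_0)
    moreover have "0 \<le> n mod int d" "n mod int d < int d" using d(1) by simp_all
    ultimately have "?P (nat (n mod int d))" "nat (n mod int d) < d" by (simp_all add: nat_less_iff)
    thus False using not_less_Least[of _ ?P] unfolding d_def by blast
  qed
  moreover have "n \<in> S" if "int d dvd n" for n using that multi[OF d(2)] by (auto elim!: dvdE simp: mult.commute)
  ultimately show ?thesis using d by blast
qed

definition zspan :: "real \<Rightarrow> real \<Rightarrow> real set" where
  "zspan \<alpha> \<beta> = {of_int x * \<alpha> + of_int y * \<beta> | x y :: int. True}"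

lemma zspanI: "of_int x * \<alpha> + of_int y * \<beta> \<in> zspan \<alpha> \<beta>"
  unfolding zspan_def by blast

lemma zspan_basis: "\<alpha> \<in> zspan \<alpha> \<beta>" "\<beta> \<in> zspan \<alpha> \<beta>"
  using zspanI[of 1 \<alpha> 0 \<beta>] zspanI[of 0 \<alpha> 1 \<beta>] by auto

lemma zspanE:
  assumes "z \<in> zspan \<alpha> \<beta>"
  obtains x y :: int where "z = of_int x * \<alpha> + of_int y * \<beta>"
  using assms unfolding zspan_def by blast

lemma zspan_scale: "(*) c ` zspan \<alpha> \<beta> = zspan (c * \<alpha>) (c * \<beta>)"
proof (intro equalityI subsetI)
  fix z assume "z \<in> (*) c ` zspan \<alpha> \<beta>"
  then obtain w where w: "w \<in> zspan \<alpha> \<beta>" "z = c * w" by blast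
  then obtain x y :: int where "w = of_int x * \<alpha> + of_int y * \<beta>" by (elim zspanE)
  hence "z = c * (of_int x * \<alpha> + of_int y * \<beta>)" using w by simp
  thus "z \<in> zspan (c * \<alpha>) (c * \<beta>)" using zspanI[of x "c * \<alpha>" y "c * \<beta>"] by (simp add: algebra_simps)
next
  fix z assume "z \<in> zspan (c * \<alpha>) (c * \<beta>)"
  then obtain x y :: int where "z = of_int x * (c * \<alpha>) + of_int y * (c * \<beta>)" by (elim zspanE)
  hence "z = c * (of_int x * \<alpha> + of_int y * \<beta>)" by (simp add: algebra_simps)
  thus "z \<in> (*) c ` zspan \<alpha> \<beta>" using zspanI by blast
qed

context quad_prime
begin

abbreviation "nz \<equiv> nonzero_ideals p"

definition det :: "real \<Rightarrow> real \<Rightarrow> real" where "det \<alpha> \<beta> = \<alpha> * cj \<beta> - cj \<alpha> * \<beta>"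

lemma cj_int_comb:
  assumes "\<alpha> \<in> K" "\<beta> \<in> K"
  shows "of_int x * \<alpha> + of_int y * \<beta> \<in> K"
    and "cj (of_int x * \<alpha> + of_int y * \<beta>) = of_int x * cj \<alpha> + of_int y * cj \<beta>"
proof -
  have 1: "of_int x * \<alpha> \<in> K" "of_int y * \<beta> \<in> K" using assms by (auto intro!: K_mult)
  show "of_int x * \<alpha> + of_int y * \<beta> \<in> K" using 1 by (rule K_add)
  show "cj (of_int x * \<alpha> + of_int y * \<beta>) = of_int x * cj \<alpha> + of_int y * cj \<beta>"
    using assms by (simp add: cj_add[OF 1] cj_mult)
qed

lemma det_change:
  fixes x y z w :: int
  assumes "\<alpha> \<in> K" "\<beta> \<in> K"
  shows "det (of_int x * \<alpha> + of_int y * \<beta>) (of_int z * \<alpha> + of_int w * \<beta>) = of_int (x * w - y * z) * det \<alpha> \<beta>"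
  unfolding det_def cj_int_comb[OF assms] by (simp add: algebra_simps)

text \<open>Up to sign \<open>det\<close> is the covolume of the lattice. Two bases are related by
  integer matrices in both directions, whose determinants multiply to 1 unless the lattice is
  degenerate.\<close>

lemma zspan_det_unique:
  assumes K: "\<alpha> \<in> K" "\<beta> \<in> K" "\<gamma> \<in> K" "\<delta> \<in> K" and eq: "zspan \<alpha> \<beta> = zspan \<gamma> \<delta>"
  shows "\<bar>det \<alpha> \<beta>\<bar> = \<bar>det \<gamma> \<delta>\<bar>"
proof -
  have "\<exists>k::int. det \<gamma> \<delta> = of_int k * det \<alpha> \<beta>"
    if "\<alpha> \<in> K" "\<beta> \<in> K" "\<gamma> \<in> zspan \<alpha> \<beta>" "\<delta> \<in> zspan \<alpha> \<beta>" for \<alpha> \<beta> \<gamma> \<delta>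
    using that det_change by (elim zspanE) metis
  from this[OF K(1,2)] this[OF K(3,4)] obtain k k' :: int
    where k: "det \<gamma> \<delta> = of_int k * det \<alpha> \<beta>" "det \<alpha> \<beta> = of_int k' * det \<gamma> \<delta>"
    using zspan_basis eq by metis
  show ?thesis
  proof (cases "det \<alpha> \<beta> = 0")
    case False
    have "det \<alpha> \<beta> = of_int k' * (of_int k * det \<alpha> \<beta>)" unfolding k(1)[symmetric] by (rule k(2))
    hence "det \<alpha> \<beta> = of_int (k' * k) * det \<alpha> \<beta>" by simp
    hence "real_of_int (k' * k) = of_int 1" using False by (simp del: of_int_mult)
    hence "k' * k = 1" by (simp only: of_int_eq_iff)
    hence "k = 1 \<or> k = -1" by (auto simp: zmult_eq_1_iff)
    thus ?thesis using k(1) by auto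
  next
    case True
    thus ?thesis using k(1) by simp
  qed
qed

text \<open>Parameters of the Hermite normal form d (a, omega - b) of an ideal:
  \<open>b \<in> Rho a\<close> is the condition for closure under multiplication by omega, together
  with the reduction of b modulo a that makes the form unique.\<close>

definition hnf :: "nat \<Rightarrow> nat \<Rightarrow> int \<Rightarrow> bool" where
  "hnf d a b \<longleftrightarrow> d > 0 \<and> a > 0 \<and> b \<in> Rho a"

definition hnf_ideal :: "nat \<Rightarrow> nat \<Rightarrow> int \<Rightarrow> real set" where
  "hnf_ideal d a b = zspan (of_nat (d * a)) (of_nat d * (omega - of_int b))"

lemma hnf_ideal_el: "of_int x * of_nat (d * a) + of_int y * (of_nat d * (omega - of_int b)) =
    el (x * int d * int a - y * int d * b) (y * int d)"
  unfolding el_def by (simp add: algebra_simps)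

lemma hnf_ideal_mem: "el m n \<in> hnf_ideal d a b \<longleftrightarrow> (\<exists>x y. m = x * int d * int a - y * int d * b \<and> n = y * int d)"
proof
  assume "el m n \<in> hnf_ideal d a b"
  thus "\<exists>x y. m = x * int d * int a - y * int d * b \<and> n = y * int d"
    unfolding hnf_ideal_def by (elim zspanE) (use el_eq_iff hnf_ideal_el in metis)
next
  assume "\<exists>x y. m = x * int d * int a - y * int d * b \<and> n = y * int d"
  thus "el m n \<in> hnf_ideal d a b" unfolding hnf_ideal_def using zspanI hnf_ideal_el by metis
qed

lemma hnf_ideal_subset: "hnf_ideal d a b \<subseteq> carrier OK"
  unfolding hnf_ideal_def by (auto elim!: zspanE simp only: hnf_ideal_el OK_el)

lemma hnf_ideal_ideal:
  assumes "hnf d a b"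
  shows "hnf_ideal d a b \<in> nz"
proof -
  have pos: "d > 0" "a > 0" and dv: "int a dvd froot b" using assms unfolding hnf_def Rho_def by auto
  obtain c where c: "froot b = int a * c" using dv by (elim dvdE)
  have add: "x + y \<in> hnf_ideal d a b" if xy: "x \<in> hnf_ideal d a b" "y \<in> hnf_ideal d a b" for x y
  proof -
    obtain x1 x2 y1 y2 :: int where "x = of_int x1 * of_nat (d * a) + of_int x2 * (of_nat d * (omega - of_int b))"
      "y = of_int y1 * of_nat (d * a) + of_int y2 * (of_nat d * (omega - of_int b))"
      using xy unfolding hnf_ideal_def by (elim zspanE) blast
    hence "x + y = of_int (x1 + y1) * of_nat (d * a) + of_int (x2 + y2) * (of_nat d * (omega - of_int b))"
      by (simp add: algebra_simps)
    thus ?thesis unfolding hnf_ideal_def using zspanI by metis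
  qed
  have mult: "el m n * el m' n' \<in> hnf_ideal d a b" if el: "el m' n' \<in> hnf_ideal d a b" for m n m' n'
  proof -
    obtain x y where xy: "m' = x * int d * int a - y * int d * b" "n' = y * int d" using el hnf_ideal_mem by auto
    \<comment> \<open>Coordinates of the product in the given basis; writing \<open>froot b\<close>
      as a multiple of a makes them integers.\<close>
    define y' where "y' = m * y + n * x * int a - n * y * b + n * y"
    define x' where "x' = m * x + n * x * b - n * y * c"
    have q: "q0 = b * b - b - int a * c" using c unfolding froot_def power2_eq_square by simp
    have "el m n * el m' n' = el (x' * int d * int a - y' * int d * b) (y' * int d)"
      unfolding el_mult el_eq_iff xy q x'_def y'_def by (simp add: algebra_simps)
    thus ?thesis using hnf_ideal_mem by metis
  qed
  have "ideal (hnf_ideal d a b) OK"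
    unfolding ideal_iff
  proof (intro conjI ballI)
    show "0 \<in> hnf_ideal d a b" unfolding hnf_ideal_def using zspanI[of 0 _ 0] by force
    fix r x assume "r \<in> carrier OK" "x \<in> hnf_ideal d a b"
    thus "r * x \<in> hnf_ideal d a b" using mult hnf_ideal_subset OK_E by (metis subsetD)
  qed (use hnf_ideal_subset add in auto)
  have "of_nat (d * a) \<in> hnf_ideal d a b" unfolding hnf_ideal_def by (rule zspan_basis)
  moreover have "real (d * a) \<noteq> 0" using pos by simp
  ultimately have "hnf_ideal d a b \<noteq> {0}" by blast
  with \<open>ideal (hnf_ideal d a b) OK\<close> show ?thesis unfolding nonzero_ideals_def by simp
qed

text \<open>Let c generate the integers in I and let d generate the omega-coordinates of its
  elements. Multiplication by omega shows that d divides c and also the integer part b0 of an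
  element with omega-coordinate d. The quotient c / d is a, and subtracting multiples of c reduces b
  modulo a.\<close>

lemma hnf_ideal_exists:
  assumes "I \<in> nz"
  obtains d a b where "hnf d a b" "I = hnf_ideal d a b"
proof -
  have I: "I \<subseteq> carrier OK" "0 \<in> I" "\<And>x y. x \<in> I \<Longrightarrow> y \<in> I \<Longrightarrow> x + y \<in> I"
    "\<And>r x. r \<in> carrier OK \<Longrightarrow> x \<in> I \<Longrightarrow> r * x \<in> I" and I0: "I \<noteq> {0}"
    using assms ideal_iff unfolding nonzero_ideals_def by auto
  have Iint: "of_int k * x \<in> I" if "x \<in> I" for k x using I(4)[OF OK_int that] .
  have Idiff: "x - y \<in> I" if "x \<in> I" "y \<in> I" for x y using I(3)[OF that(1) Iint[OF that(2), of "-1"]] by simp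
  obtain z where z: "z \<in> I" "z \<noteq> 0" using I(2) I0 by auto
  have zO: "z \<in> carrier OK" using z I(1) by auto
  then obtain N where N: "nrm z = of_int N" using OK_nrm by blast
  have "N \<noteq> 0" using N nrm_eq_0_iff[OF OK_K[OF zO]] z by auto
  have "cj z * z \<in> I" using I(4)[OF OK_cj[OF zO] z(1)] .
  hence NI: "of_int N \<in> I" using N unfolding nrm_def by (simp add: mult.commute)
  obtain c :: nat where c: "c > 0" "of_int (int c) \<in> I" "\<And>n. of_int n \<in> I \<longleftrightarrow> int c dvd n"
  proof -
    have 1: "N \<in> {n. of_int n \<in> I}" using NI by simp
    have 2: "x - y \<in> {n. of_int n \<in> I}" if "x \<in> {n. of_int n \<in> I}" "y \<in> {n. of_int n \<in> I}" for x y
      using Idiff[of "of_int x" "of_int y"] that by simp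
    show ?thesis using int_subgroup_generator[OF 1 \<open>N \<noteq> 0\<close> 2] that by auto
  qed
  have om: "omega \<in> carrier OK" using OK_el[of 0 1] unfolding el_def by simp
  have "omega * of_int (int c) \<in> I" using I(4)[OF om c(2)] .
  hence cn: "el 0 (int c) \<in> I" unfolding el_def by (simp add: mult.commute)
  let ?S = "{n. \<exists>m. el m n \<in> I}"
  have Sdiff: "x - y \<in> ?S" if "x \<in> ?S" "y \<in> ?S" for x y
  proof -
    obtain m m' where m: "el m x \<in> I" "el m' y \<in> I" using \<open>x \<in> ?S\<close> \<open>y \<in> ?S\<close> by blast
    have "el m x - el m' y = el (m - m') (x - y)" unfolding el_def by (simp add: algebra_simps)
    thus ?thesis using Idiff[OF m] by auto
  qed
  have cS: "int c \<in> ?S" "int c \<noteq> 0" using cn c(1) by auto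
  obtain d :: nat where d: "d > 0" "int d \<in> ?S" "\<And>n. n \<in> ?S \<longleftrightarrow> int d dvd n"
    using int_subgroup_generator[OF cS Sdiff] by blast
  have "int d dvd int c" using d(3) cn by blast
  then obtain a' where a': "int c = int d * a'" by (elim dvdE)
  define a where "a = nat a'"
  have a'pos: "a' > 0" using a' c(1) d(1) by (metis of_nat_0_less_iff zero_less_mult_pos)
  hence ca: "int c = int d * int a" and apos: "a > 0" using a' unfolding a_def by auto
  obtain b0 where b0: "el b0 (int d) \<in> I" using d(2) by blast
  have "omega * el b0 (int d) = el (int d * q0) (b0 + int d)"
    using el_mult[of 0 1 b0 "int d"] unfolding el_def by simp
  hence "el (int d * q0) (b0 + int d) \<in> I" using I(4)[OF om b0] by simp
  hence "int d dvd b0 + int d" using d(3) by blast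
  hence "int d dvd b0" by simp
  then obtain b1 where b1: "b0 = int d * b1" by (elim dvdE)
  define b where "b = (- b1) mod int a"
  obtain k where k: "- b1 = b + int a * k" unfolding b_def by (metis add.commute mult_div_mod_eq)
  have bI: "el (- int d * b) (int d) \<in> I"
  proof -
    have "el b0 (int d) + of_int k * of_int (int c) \<in> I" using I(3)[OF b0 Iint[OF c(2)]] .
    also have "el b0 (int d) + of_int k * of_int (int c) = el (b0 + k * int c) (int d)"
      unfolding el_def by simp
    also have "b0 + k * int c = - int d * b"
    proof -
      have b: "b = - b1 - int a * k" using k by linarith
      show ?thesis unfolding b1 ca b by (simp add: algebra_simps)
    qed
    finally show ?thesis .
  qed
  \<comment> \<open>Multiplying the second generator by the conjugate of omega - b yields the
    integer d \<open>froot b\<close>, which must be a multiple of c = d a.\<close>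
  have "cj (el (- b) 1) * el (- int d * b) (int d) \<in> I" by (rule I(4)[OF OK_cj[OF OK_el] bI])
  also have "cj (el (- b) 1) * el (- int d * b) (int d) = of_int (int d * froot b)"
    unfolding cj_el el_mult unfolding el_def froot_def by (simp add: algebra_simps power2_eq_square)
  finally have "int c dvd int d * froot b" using c(3) by blast
  hence "int a dvd froot b" unfolding ca using d(1) by simp
  hence hnf: "hnf d a b" unfolding hnf_def Rho_def b_def using d(1) apos by auto
  have "I = hnf_ideal d a b"
  proof (intro equalityI subsetI)
    fix w assume w: "w \<in> I"
    then obtain m n where mn: "w = el m n" using I(1) OK_E by blast
    hence "int d dvd n" using d(3) w by blast
    then obtain y where y: "n = int d * y" by (elim dvdE)
    have mem: "w - of_int y * el (- int d * b) (int d) \<in> I" using Idiff[OF w Iint[OF bI]] .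
    have eq: "w - of_int y * el (- int d * b) (int d) = of_int (m + y * int d * b)"
      unfolding mn y el_def by (simp add: algebra_simps)
    have "int c dvd m + y * int d * b" using c(3) mem unfolding eq by blast
    then obtain x where "m + y * int d * b = int c * x" by (elim dvdE)
    hence "m = x * int d * int a - y * int d * b" unfolding ca by (simp add: algebra_simps)
    thus "w \<in> hnf_ideal d a b" unfolding mn hnf_ideal_mem using y by (auto simp: mult.commute)
  next
    fix w assume "w \<in> hnf_ideal d a b"
    then obtain x y :: int where "w = of_int x * of_nat (d * a) + of_int y * (of_nat d * (omega - of_int b))"
      unfolding hnf_ideal_def by (elim zspanE)
    also have "\<dots> = of_int x * of_int (int c) + of_int y * el (- int d * b) (int d)"
      unfolding ca el_def by (simp add: algebra_simps)
    finally show "w \<in> I" using I(3)[OF Iint[OF c(2)] Iint[OF bI]] by simp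
  qed
  thus ?thesis using that hnf by blast
qed

lemma hnf_ideal_inj:
  assumes t: "hnf d a b" "hnf d' a' b'" and eq: "hnf_ideal d a b = hnf_ideal d' a' b'"
  shows "d = d' \<and> a = a' \<and> b = b'"
proof -
  have pos: "d > 0" "a > 0" "d' > 0" "a' > 0" "0 \<le> b" "b < int a" "0 \<le> b'" "b' < int a'"
    using t unfolding hnf_def Rho_def by auto
  have mem1: "el (- int d * b) (int d) \<in> hnf_ideal d a b" "el (int d * int a) 0 \<in> hnf_ideal d a b" for d a b
    unfolding hnf_ideal_mem by (rule exI[of _ 0], rule exI[of _ 1], simp) (rule exI[of _ 1], rule exI[of _ 0], simp)
  have dd: "int d' dvd int d" if e: "hnf_ideal d a b = hnf_ideal d' a' b'" for d a b d' a' b'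
  proof -
    obtain y where "int d = y * int d'" using mem1(1)[where d = d and b = b and a = a] unfolding e hnf_ideal_mem by blast
    thus ?thesis by simp
  qed
  have d: "d = d'" using dd[OF eq] dd[OF eq[symmetric]] by (simp add: dvd_antisym)
  have aa: "int a' dvd int a" if e: "hnf_ideal d a b = hnf_ideal d a' b'" "d > 0" for d a b a' b'
  proof -
    obtain x y where xy: "int d * int a = x * int d * int a' - y * int d * b'" "0 = y * int d"
      using mem1(2)[where d = d and b = b and a = a] unfolding e(1) hnf_ideal_mem by blast
    hence "int d * int a = int d * (x * int a')" using e(2) by simp
    thus ?thesis using e(2) by simp
  qed
  have a: "a = a'" using aa[OF eq[unfolded d]] aa[OF eq[unfolded d, symmetric]] pos d by (simp add: dvd_antisym)
  obtain x y where xy: "- int d * b = x * int d * int a' - y * int d * b'" "int d = y * int d"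
    using mem1(1)[where d = d and b = b and a = a] unfolding eq unfolding d hnf_ideal_mem by blast
  hence "y = 1" using pos by simp
  hence "int d * b = int d * (b' - x * int a)" using xy(1) a by (simp add: algebra_simps)
  hence "b = b' - x * int a" using pos by simp
  hence "[b = b'] (mod int a)" by (simp add: cong_iff_dvd_diff)
  hence "b = b'" using pos a by (simp add: Cong.cong_def)
  thus ?thesis using a d by simp
qed

lemma hnf_ideal_basis_K: "(of_nat (d * a) :: real) \<in> K" "of_nat d * (omega - of_int b) \<in> K"
  by (auto intro!: K_mult K_diff)

lemma det_hnf_ideal: "\<bar>det (of_nat (d * a)) (of_nat d * (omega - of_int b))\<bar> = of_nat (d\<^sup>2 * a) * sp"
proof -
  have 1: "omega - of_int b \<in> K" by (rule K_diff) auto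
  have 2: "cj (omega - of_int b) = cj omega - of_int b" by (subst cj_diff) auto
  have "det (of_nat (d * a)) (of_nat d * (omega - of_int b)) = of_nat (d\<^sup>2 * a) * (cj omega - omega)"
    unfolding det_def cj_mult[OF K_Rats[of "of_nat d"] 1, OF Rats_of_nat] 2
    by (simp add: algebra_simps power2_eq_square)
  also have "cj omega - omega = - sp" using omega_minus_cj by simp
  finally show ?thesis using sp_pos by (simp add: abs_mult)
qed

text \<open>The determinant of a basis shows that this norm is multiplied by \<open>\<bar>nrm c\<bar>\<close> when the ideal is multiplied by \<open>c\<close>.\<close>

definition inorm :: "real set \<Rightarrow> nat" where
  "inorm I = (THE n. \<exists>d a b. hnf d a b \<and> I = hnf_ideal d a b \<and> n = d\<^sup>2 * a)"

lemma inorm_hnf_ideal: "hnf d a b \<Longrightarrow> inorm (hnf_ideal d a b) = d\<^sup>2 * a"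
  unfolding inorm_def
proof (rule the_equality)
  fix n assume t: "hnf d a b" and "\<exists>d' a' b'. hnf d' a' b' \<and> hnf_ideal d a b = hnf_ideal d' a' b' \<and> n = d'\<^sup>2 * a'"
  then obtain d' a' b' where "hnf d' a' b'" "hnf_ideal d a b = hnf_ideal d' a' b'" "n = d'\<^sup>2 * a'" by blast
  thus "n = d\<^sup>2 * a" using hnf_ideal_inj[OF t] by simp
qed blast

lemma inorm_pos: "I \<in> nz \<Longrightarrow> inorm I > 0"
proof (elim hnf_ideal_exists)
  fix d a b assume "hnf d a b" "I = hnf_ideal d a b"
  thus "inorm I > 0" using inorm_hnf_ideal[of d a b] by (simp add: hnf_def)
qed

lemma inorm_scale:
  assumes "I \<in> nz" "J \<in> nz" "c \<in> K" "I = (*) c ` J"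
  shows "real (inorm I) = \<bar>nrm c\<bar> * real (inorm J)"
proof -
  obtain d a b where 1: "hnf d a b" "I = hnf_ideal d a b" using assms(1) by (rule hnf_ideal_exists)
  obtain d' a' b' where 2: "hnf d' a' b'" "J = hnf_ideal d' a' b'" using assms(2) by (rule hnf_ideal_exists)
  let ?x = "of_nat (d' * a') :: real" and ?y = "of_nat d' * (omega - of_int b')"
  have e: "zspan (of_nat (d * a)) (of_nat d * (omega - of_int b)) = zspan (c * ?x) (c * ?y)"
    using assms(4) unfolding 1 2 hnf_ideal_def zspan_scale .
  have "\<bar>det (of_nat (d * a)) (of_nat d * (omega - of_int b))\<bar> = \<bar>det (c * ?x) (c * ?y)\<bar>"
    by (rule zspan_det_unique[OF hnf_ideal_basis_K _ _ e]) (use assms(3) hnf_ideal_basis_K K_mult in auto)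
  also have "det (c * ?x) (c * ?y) = nrm c * det ?x ?y"
    unfolding det_def nrm_def cj_mult[OF assms(3) hnf_ideal_basis_K(1)] cj_mult[OF assms(3) hnf_ideal_basis_K(2)]
    by (simp add: algebra_simps)
  finally have "real (d\<^sup>2 * a) * sp = \<bar>nrm c\<bar> * (real (d'\<^sup>2 * a') * sp)"
    unfolding abs_mult det_hnf_ideal .
  hence "real (d\<^sup>2 * a) = \<bar>nrm c\<bar> * real (d'\<^sup>2 * a')" using sp_pos by simp
  thus ?thesis unfolding 1(2) 2(2) inorm_hnf_ideal[OF 1(1)] inorm_hnf_ideal[OF 2(1)] .
qed

text \<open>For a fixed norm, d determines a as n divided by d^2, so the only remaining freedom is
  the root b modulo a.\<close>

lemma card_inorm:
  assumes "n > 0"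
  shows "finite {I \<in> nz. inorm I = n}" and "card {I \<in> nz. inorm I = n} = ideal_count n"
proof -
  define D where "D = {d. d\<^sup>2 dvd n}"
  have Dsub: "D \<subseteq> {d. d dvd n}" unfolding D_def by (auto simp: power2_eq_square elim: dvd_mult_left)
  have finD: "finite D" using Dsub assms finite_divisors_nat finite_subset by blast
  let ?S = "SIGMA d:D. Rho (n div d\<^sup>2)"
  let ?f = "\<lambda>(d, b). hnf_ideal d (n div d\<^sup>2) b"
  have pos: "d > 0" "n div d\<^sup>2 > 0" "d\<^sup>2 * (n div d\<^sup>2) = n" if "d \<in> D" for d
    using that assms unfolding D_def by (auto intro!: Nat.gr0I)
  have hnf: "hnf d (n div d\<^sup>2) b" if "(d, b) \<in> ?S" for d b
    using that pos unfolding hnf_def by auto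
  have "inj_on ?f ?S"
  proof (rule inj_onI)
    fix u v assume uv: "u \<in> ?S" "v \<in> ?S" "?f u = ?f v"
    obtain d b d' b' where e: "u = (d, b)" "v = (d', b')" by fastforce
    show "u = v" using hnf_ideal_inj[OF hnf[of d b] hnf[of d' b']] uv unfolding e by simp
  qed
  moreover have "?f ` ?S = {I \<in> nz. inorm I = n}"
  proof (intro equalityI subsetI)
    fix I assume "I \<in> ?f ` ?S"
    then obtain d b where db: "(d, b) \<in> ?S" "I = hnf_ideal d (n div d\<^sup>2) b" by auto
    hence "d \<in> D" by simp
    thus "I \<in> {I \<in> nz. inorm I = n}"
      using hnf_ideal_ideal[OF hnf[OF db(1)]] inorm_hnf_ideal[OF hnf[OF db(1)]] pos(3) db(2) by simp
  next
    fix I assume I: "I \<in> {I \<in> nz. inorm I = n}"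
    then obtain d a b where t: "hnf d a b" "I = hnf_ideal d a b" using hnf_ideal_exists by blast
    hence n: "n = d\<^sup>2 * a" using inorm_hnf_ideal I by auto
    have "d > 0" "b \<in> Rho a" using t(1) unfolding hnf_def by auto
    hence "(d, b) \<in> ?S" "I = ?f (d, b)" using t(2) unfolding n D_def by auto
    thus "I \<in> ?f ` ?S" by blast
  qed
  ultimately have b: "bij_betw ?f ?S {I \<in> nz. inorm I = n}" unfolding bij_betw_def by blast
  have "finite ?S" using finD by (intro finite_SigmaI) auto
  thus "finite {I \<in> nz. inorm I = n}" by (simp only: bij_betw_finite[OF b])
  have "card {I \<in> nz. inorm I = n} = card ?S" by (rule bij_betw_same_card[OF b, symmetric])
  also have "\<dots> = (\<Sum>d\<in>D. rho (n div d\<^sup>2))" unfolding rho_def using finD by (subst card_SigmaI) auto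
  also have "\<dots> = (\<Sum>d\<in>{d \<in> {d. d dvd n}. d\<^sup>2 dvd n}. rho (n div d\<^sup>2))"
    using Dsub by (intro sum.cong) (auto simp: D_def)
  also have "\<dots> = ideal_count n" unfolding ideal_count_def using assms by (intro sum.inter_filter) auto
  finally show "card {I \<in> nz. inorm I = n} = ideal_count n" .
qed

lemma card_inorm_le:
  shows "finite {I \<in> nz. inorm I \<le> N}" and "card {I \<in> nz. inorm I \<le> N} = (\<Sum>n = 1..N. ideal_count n)"
proof -
  have eq: "{I \<in> nz. inorm I \<le> N} = (\<Union>n\<in>{1..N}. {I \<in> nz. inorm I = n})"
    using inorm_pos by (auto simp: Suc_le_eq)
  show "finite {I \<in> nz. inorm I \<le> N}" unfolding eq using card_inorm(1) by auto
  show "card {I \<in> nz. inorm I \<le> N} = (\<Sum>n = 1..N. ideal_count n)"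
    unfolding eq using card_inorm by (subst card_UN_disjoint) auto
qed

end

section \<open>Units and the class number formula\<close>

text \<open>p divides one of the coprime factors; removing it leaves two coprime numbers whose
  product is a square.\<close>

lemma prime_square_factor:
  fixes X Y U p :: nat
  assumes "prime p" "coprime X Y" "X > 0" "Y > 0" "X * Y = p * U\<^sup>2"
  shows "\<exists>s>0. X = s\<^sup>2 \<or> Y = s\<^sup>2"
proof -
  have aux: "\<exists>s>0. X = s\<^sup>2" if h: "coprime X Y" "X > 0" "Y > 0" "X * Y = p * U\<^sup>2" "p dvd Y" for X Y
  proof -
    obtain Y' where Y': "Y = p * Y'" using h(5) by (elim dvdE)
    have "p * (X * Y') = p * U\<^sup>2" using h(4) unfolding Y' by (simp add: algebra_simps)
    hence "X * Y' = U\<^sup>2" using assms(1) by (simp add: prime_gt_0_nat)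
    hence "is_nth_power 2 (X * Y')" by (simp add: is_nth_power_def)
    moreover have "coprime X Y'" using h(1) unfolding Y' by simp
    moreover have "Y' > 0" using h(3) Y' by (auto intro: Nat.gr0I)
    ultimately have "is_nth_power 2 X" using is_nth_power_mult_coprime_natD(1) h(2) by blast
    then obtain s where "X = s\<^sup>2" by (auto simp: is_nth_power_def)
    thus ?thesis using h(2) by (intro exI[of _ s]) (auto intro: Nat.gr0I)
  qed
  have "p dvd X * Y" using assms(5) by simp
  hence "p dvd X \<or> p dvd Y" using assms(1) by (simp add: prime_dvd_mult_iff)
  thus ?thesis
  proof
    assume "p dvd Y"
    thus ?thesis using aux[OF assms(2-5)] by blast
  next
    assume "p dvd X"
    thus ?thesis using aux[of Y X] assms by (auto simp: coprime_commute mult.commute)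
  qed
qed

text \<open>The equation reads (t + 2) (t - 2) = p u^2. The two factors are coprime for odd t; for
  even t, dividing by 16 leads to two consecutive integers instead.\<close>

lemma pell4_square:
  fixes p t u :: nat
  assumes p: "prime p" "p mod 4 = 1" and u: "u > 0" and eq: "t * t = p * u * u + 4"
  shows "\<exists>s>0. t + 2 = s\<^sup>2 \<or> t = s\<^sup>2 + 2"
proof -
  have p0: "p > 0" using p by (simp add: prime_gt_0_nat)
  have oddp: "odd p" using p(2) by presburger
  have t2: "t > 2"
  proof (rule ccontr)
    assume "\<not> t > 2"
    hence "t * t \<le> 2 * 2" by (intro mult_le_mono) auto
    thus False using eq p0 u by simp
  qed
  show ?thesis
  proof (cases "odd t")
    case True
    have c: "coprime (t + 2) (t - 2)"
    proof (rule coprimeI)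
      fix c assume c: "c dvd t + 2" "c dvd t - 2"
      hence "c dvd (t + 2) - (t - 2)" by (rule dvd_diff_nat)
      hence "c dvd 2 ^ 2" using t2 by simp
      moreover have "odd c" using c(1) True by (metis dvd_trans even_add even_numeral)
      hence "coprime c (2 ^ 2)" by (subst coprime_power_right_iff) simp
      ultimately show "is_unit c" using coprime_common_divisor[of c "2^2" c] by simp
    qed
    have "int ((t + 2) * (t - 2)) = int (p * u\<^sup>2)"
      using t2 eq by (simp add: of_nat_diff power2_eq_square algebra_simps flip: of_nat_mult)
    hence "(t + 2) * (t - 2) = p * u\<^sup>2" by (simp only: of_nat_eq_iff)
    from prime_square_factor[OF p(1) c _ _ this] t2 show ?thesis by fastforce
  next
    case False
    hence "even t" by simp
    then obtain T where T: "t = 2 * T" by (elim evenE)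
    have "even (p * u * u)" using eq T by (metis even_add even_mult_iff even_numeral dvd_triv_left)
    hence "even u" using oddp by auto
    then obtain U where U: "u = 2 * U" by (elim evenE)
    have TU: "T * T = p * U * U + 1" using eq unfolding T U by simp
    \<comment> \<open>If T were even, p U^2 and hence U^2 would be -1 modulo 4.\<close>
    have "odd T"
    proof
      assume "even T"
      then obtain S where S: "T = 2 * S" by (elim evenE)
      obtain r where r: "p = 4 * r + 1" using p(2) by (metis mod_mult_div_eq add.commute)
      have e: "4 * (S * S) = 4 * (r * U * U) + U * U + 1" using TU unfolding S r by (simp add: algebra_simps)
      show False
      proof (cases "even U")
        case True
        then obtain V where "U = 2 * V" by (elim evenE)
        hence "4 * (S * S) = 4 * (r * U * U) + 4 * (V * V) + 1" using e by simp
        thus False by presburger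
      next
        case False
        then obtain V where "U = 2 * V + 1" by (elim oddE)
        hence "4 * (S * S) = 4 * (r * U * U) + 4 * (V * V + V) + 2" using e by (simp add: algebra_simps)
        thus False by presburger
      qed
    qed
    then obtain B where B: "T = 2 * B + 1" by (elim oddE)
    have BU: "4 * (B * (B + 1)) = p * U * U" using TU unfolding B by (simp add: algebra_simps)
    hence "even (p * U * U)" by (metis dvd_mult2 even_numeral dvd_triv_left even_mult_iff)
    hence "even U" using oddp by auto
    then obtain V where V: "U = 2 * V" by (elim evenE)
    have BV: "(B + 1) * B = p * V\<^sup>2" using BU unfolding V by (simp add: power2_eq_square algebra_simps)
    have "B > 0" using t2 T B by auto
    moreover have "coprime (B + 1) B" by simp
    ultimately obtain s where s: "s > 0" "B + 1 = s\<^sup>2 \<or> B = s\<^sup>2" using prime_square_factor[OF p(1) _ _ _ BV] by auto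
    have "t + 2 = (2 * s)\<^sup>2 \<or> t = (2 * s)\<^sup>2 + 2" using s(2) unfolding T B by (auto simp: power_mult_distrib)
    thus ?thesis using s(1) by (intro exI[of _ "2 * s"]) auto
  qed
qed

lemma powi_bracket:
  fixes E r :: real
  assumes "E > 1" "r > 0"
  obtains j :: int where "E powi j \<le> r" "r < E powi j * E"
proof -
  define j where "j = \<lfloor>log E r\<rfloor>"
  have j: "of_int j \<le> log E r" "log E r < of_int j + 1" unfolding j_def by linarith+
  have r: "E powr (log E r) = r" using assms by simp
  have pj: "E powr of_int j = E powi j" using assms powr_real_of_int' by auto
  have "E powr of_int j \<le> E powr (log E r)" using j assms by (intro powr_mono) auto
  moreover have "E powr (log E r) < E powr (of_int j + 1)" using j assms by (intro powr_less_mono) auto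
  moreover have "E powr (of_int j + 1) = E powr of_int j * E" using assms by (simp add: powr_add)
  ultimately show ?thesis using that[of j] unfolding r pj by simp
qed

locale quad_unit = quad_prime +
  fixes t u :: nat
  assumes t_pos: "t > 0" and u_pos: "u > 0"
    and fund: "fundamental_unit p ((real t + real u * sqrt (real p)) / 2)"
begin

definition eps :: real where "eps = (real t + real u * sp) / 2"

lemma eps_unit: "eps \<in> Units OK" and eps_gt_1: "eps > 1"
  and eps_gen: "\<And>c. c \<in> Units OK \<Longrightarrow> \<exists>n::int. c = eps powi n \<or> c = - (eps powi n)"
  using fund unfolding fundamental_unit_def eps_def sp_def by auto

lemma eps_OK: "eps \<in> carrier OK"
  using eps_unit OK_Units by blast

lemma eps_K [simp, intro]: "eps \<in> K"
  using eps_OK OK_K by blast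

lemma cj_eps: "cj eps = (real t - real u * sp) / 2"
proof -
  have *: "eps = real t / 2 + (real u / 2) * sp" unfolding eps_def by (simp add: field_simps)
  have "cj eps = real t / 2 - (real u / 2) * sp" unfolding * by (rule cj_eq) auto
  thus ?thesis by (simp add: field_simps)
qed

lemma nrm_eps_eq: "4 * nrm eps = real t * real t - real p * real u * real u"
  unfolding nrm_def cj_eps unfolding eps_def sp_sq[symmetric] by (simp add: field_simps)

lemma eps_powi_pos: "eps powi n > 0"
  using eps_gt_1 by simp

text \<open>If the norm were \<open>1\<close>, then \<open>(\<epsilon> \<plusminus> 1)\<^sup>2 = (t \<plusminus> 2) \<epsilon>\<close>; one of \<open>t \<plusminus> 2\<close> is a square, so \<open>\<surd>\<epsilon>\<close> would be a unit.\<close>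

theorem nrm_eps: "nrm eps = -1"
proof (rule ccontr)
  assume "nrm eps \<noteq> -1"
  hence n1: "nrm eps = 1" using unit_nrm[OF eps_unit] by auto
  hence "real (t * t) = real (p * u * u + 4)" using nrm_eps_eq by simp
  hence "t * t = p * u * u + 4" by (simp only: of_nat_eq_iff)
  then obtain s where s: "s > 0" "t + 2 = s\<^sup>2 \<or> t = s\<^sup>2 + 2"
    using pell4_square[OF prime_p p_mod_4 u_pos] by blast
  have tr: "eps + cj eps = real t" unfolding cj_eps unfolding eps_def by (simp add: field_simps)
  have sqrt_eq: "sqrt eps = w / real s" if "w > 0" "w * w = eps * real (s\<^sup>2)" for w
  proof -
    have "(w / real s)\<^sup>2 = eps" using that s(1) by (simp add: power2_eq_square power_divide)
    moreover have "w / real s \<ge> 0" using that by simp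
    ultimately show ?thesis by (metis real_sqrt_unique)
  qed
  have "sqrt eps \<in> K" using s(2)
  proof
    assume "t + 2 = s\<^sup>2"
    hence "real (s\<^sup>2) = real t + 2" by (metis of_nat_add of_nat_numeral)
    hence "(eps + 1) * (eps + 1) = eps * real (s\<^sup>2)"
      unfolding tr[symmetric] using n1 unfolding nrm_def by (simp add: algebra_simps)
    hence "sqrt eps = (eps + 1) / real s" using eps_gt_1 by (intro sqrt_eq) auto
    thus ?thesis by (simp add: K_divide K_add)
  next
    assume "t = s\<^sup>2 + 2"
    hence "real t = real (s\<^sup>2) + 2" by (metis of_nat_add of_nat_numeral)
    hence s2: "real (s\<^sup>2) = real t - 2" by simp
    have "(eps - 1) * (eps - 1) = eps * real (s\<^sup>2)"
      unfolding s2 tr[symmetric] using n1 unfolding nrm_def by (simp add: algebra_simps)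
    hence "sqrt eps = (eps - 1) / real s" using eps_gt_1 by (intro sqrt_eq) auto
    thus ?thesis by (simp add: K_divide K_diff)
  qed
  moreover have "algebraic_int (sqrt eps)" using eps_OK unfolding carrier_OK by auto
  ultimately have sO: "sqrt eps \<in> carrier OK" unfolding carrier_OK by blast
  have ss: "sqrt eps * sqrt eps = eps" using eps_gt_1 by simp
  obtain v where v: "v \<in> carrier OK" "eps * v = 1" using eps_unit OK_Units by auto
  have "sqrt eps * (sqrt eps * v) = 1" using v ss by (simp add: mult.assoc[symmetric])
  hence "sqrt eps \<in> Units OK" using sO OK_mult[OF sO v(1)] OK_Units by blast
  then obtain n :: int where "sqrt eps = eps powi n \<or> sqrt eps = - (eps powi n)" using eps_gen by blast
  moreover have "sqrt eps > 0" using eps_gt_1 by simp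
  ultimately have "sqrt eps = eps powi n" using eps_powi_pos[of n] by linarith
  hence e1: "eps powi (n + n) = eps powi 1" using ss eps_gt_1 by (subst power_int_add) auto
  have "n + n \<noteq> 1" by presburger
  hence "n + n < 1 \<or> 1 < n + n" by linarith
  thus False using e1 power_int_strict_increasing[of "n + n" 1 eps] power_int_strict_increasing[of 1 "n + n" eps] eps_gt_1
    by auto
qed

lemma pell: "real t * real t - real p * real u * real u = -4"
  using nrm_eps_eq nrm_eps by simp

lemma cj_eps_inverse: "cj eps = - inverse eps"
  using nrm_eps eps_gt_1 unfolding nrm_def by (simp add: field_simps)

lemma Units_mult: "a \<in> Units OK \<Longrightarrow> b \<in> Units OK \<Longrightarrow> a * b \<in> Units OK"
proof -
  assume a: "a \<in> Units OK" and b: "b \<in> Units OK"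
  obtain v w where "v \<in> carrier OK" "w \<in> carrier OK" "a * v = 1" "b * w = 1" using a b OK_Units by auto
  moreover from this have "(a * b) * (v * w) = 1" by (metis mult.assoc mult.commute mult_1)
  ultimately show ?thesis using a b OK_mult OK_Units by blast
qed

lemma Units_1: "1 \<in> Units OK" and Units_m1: "-1 \<in> Units OK"
  using OK_Units OK_int[of "-1"] by auto

lemma Units_inverse: "a \<in> Units OK \<Longrightarrow> inverse a \<in> Units OK"
proof -
  assume a: "a \<in> Units OK"
  obtain v where v: "v \<in> carrier OK" "a * v = 1" "a \<in> carrier OK" using a OK_Units by auto
  hence "inverse a = v" by (metis inverse_unique)
  thus ?thesis using v OK_Units by (metis mult.commute)
qed

lemma Units_powi: "a \<in> Units OK \<Longrightarrow> a powi n \<in> Units OK"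
proof -
  assume a: "a \<in> Units OK"
  have "a ^ k \<in> Units OK" for k by (induction k) (auto simp: Units_1 intro: Units_mult a)
  thus ?thesis unfolding power_int_def power_inverse using Units_inverse by auto
qed

lemma Units_K: "a \<in> Units OK \<Longrightarrow> a \<in> K"
  using OK_Units OK_K by blast

text \<open>As \<open>\<epsilon>\<close> has norm \<open>-1\<close>, the totally positive units are its even powers, and multiplying \<open>z\<close> by \<open>\<epsilon>\<^sup>2\<close> divides
  \<open>cj z / z\<close> by \<open>E\<close>. So \<open>1 \<le> cj z / z < E\<close> on positive elements is a fundamental domain for all units.\<close>

definition E :: real where "E = eps ^ 4"

lemma E_gt_1: "E > 1"
  unfolding E_def using eps_gt_1 by (intro one_less_power) auto

lemma E_powi: "E powi k = eps powi (2 * k) * eps powi (2 * k)"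
proof -
  have "eps powi (2 * k) * eps powi (2 * k) = eps powi (4 * k)"
    using eps_gt_1 by (simp add: power_int_add[symmetric])
  also have "\<dots> = (eps powi 4) powi k" by (rule power_int_mult)
  finally show ?thesis unfolding E_def by simp
qed

lemma cj_even_power: "cj (eps powi (2 * k)) = inverse (eps powi (2 * k))"
  unfolding cj_powi[OF eps_K] cj_eps_inverse
  by (simp add: power_int_minus_left_even power_int_inverse)

lemma positive_unit:
  assumes "c \<in> Units OK" "c > 0" "cj c > 0"
  obtains k :: int where "c = eps powi (2 * k)"
proof -
  obtain n :: int where n: "c = eps powi n \<or> c = - (eps powi n)" using eps_gen[OF assms(1)] by blast
  hence c: "c = eps powi n" using assms(2) eps_powi_pos[of n] by linarith
  have "even n"
  proof (rule ccontr)
    assume "odd n"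
    hence "cj c = - (inverse eps powi n)" unfolding c cj_powi[OF eps_K] cj_eps_inverse
      by (simp add: power_int_minus_left_odd)
    moreover have "inverse eps powi n > 0" using eps_gt_1 by (intro zero_less_power_int) auto
    ultimately show False using assms(3) by linarith
  qed
  then obtain k where "n = 2 * k" by (elim evenE)
  thus ?thesis using that c by blast
qed

text \<open>Since cj eps < 0 < eps, a factor 1, -1, eps or -eps makes both conjugates positive. A
  further factor eps^(2 j) divides the ratio of the conjugates by E^j and moves it into the interval
  from 1 to E.\<close>

lemma normalise_unit:
  assumes z: "z \<in> K" "z \<noteq> 0"
  obtains v where "v \<in> Units OK" "v * z > 0" "cj (v * z) > 0" "v * z \<le> cj (v * z)" "cj (v * z) < E * (v * z)"
proof -
  have cz: "cj z \<noteq> 0" using z cj_eq_0_iff by blast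
  have ce: "cj eps < 0" using cj_eps_inverse eps_gt_1 by simp
  have "\<exists>v\<in>Units OK. v * z > 0 \<and> cj (v * z) > 0"
  proof -
    consider "z > 0" "cj z > 0" | "z < 0" "cj z < 0" | "z > 0" "cj z < 0" | "z < 0" "cj z > 0"
      using z(2) cz by linarith
    thus ?thesis
    proof cases
      case 1
      thus ?thesis using Units_1 by (intro bexI[of _ 1]) auto
    next
      case 2
      thus ?thesis using Units_m1 cj_minus[OF z(1)] by (intro bexI[of _ "-1"]) auto
    next
      case 3
      have "cj (eps * z) = cj eps * cj z" by (rule cj_mult[OF eps_K z(1)])
      thus ?thesis using 3 eps_unit eps_gt_1 ce by (intro bexI[of _ eps]) (auto simp: mult_neg_neg)
    next
      case 4
      have "cj (- eps * z) = - cj eps * cj z"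
        using cj_mult[OF K_minus(1)[OF eps_K] z(1)] cj_minus[OF eps_K] by simp
      moreover have "- eps \<in> Units OK" using Units_mult[OF Units_m1 eps_unit] by simp
      ultimately show ?thesis using 4 eps_gt_1 ce by (intro bexI[of _ "- eps"]) (auto simp: mult_pos_neg mult_neg_pos)
    qed
  qed
  then obtain v where v: "v \<in> Units OK" "v * z > 0" "cj (v * z) > 0" by blast
  define w where "w = v * z"
  have wK: "w \<in> K" unfolding w_def by (rule K_mult(1)[OF Units_K[OF v(1)] z(1)])
  obtain j where j: "E powi j \<le> cj w / w" "cj w / w < E powi j * E"
    by (rule powi_bracket[OF E_gt_1, of "cj w / w"]) (use v in \<open>auto simp: w_def\<close>)
  define q where "q = eps powi (2 * j)"
  have q: "q > 0" "q \<in> Units OK" "q \<in> K" "cj q = inverse q" "E powi j = q * q"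
    unfolding q_def using eps_powi_pos Units_powi[OF eps_unit] K_powi[OF eps_K] cj_even_power E_powi by auto
  have w: "w > 0" "cj w > 0" using v unfolding w_def by auto
  have cqw: "cj (q * w) = cj w / q" using cj_mult[OF q(3) wK] q(4) by (simp add: field_simps)
  have qz: "q * v * z = q * w" unfolding w_def by simp
  show ?thesis
  proof (rule that[of "q * v"])
    show "q * v \<in> Units OK" using Units_mult q v by blast
    show "q * v * z > 0" "cj (q * v * z) > 0" unfolding qz cqw using q w by auto
    show "q * v * z \<le> cj (q * v * z)" unfolding qz cqw using j(1) q w by (simp add: field_simps)
    show "cj (q * v * z) < E * (q * v * z)" unfolding qz cqw using j(2) q w by (simp add: field_simps)
  qed
qed

section \<open>Ideals under scaling and the lattice of an ideal class\<close>

lemma ideal_props: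
  assumes "J \<in> nz"
  shows "J \<subseteq> carrier OK" "0 \<in> J" "\<And>x y. x \<in> J \<Longrightarrow> y \<in> J \<Longrightarrow> x + y \<in> J"
    "\<And>r x. r \<in> carrier OK \<Longrightarrow> x \<in> J \<Longrightarrow> r * x \<in> J" "J \<noteq> {0}"
  using assms ideal_iff unfolding nonzero_ideals_def by auto

lemma ideal_scale:
  assumes J: "J \<in> nz" and c: "c \<noteq> 0" and sub: "(*) c ` J \<subseteq> carrier OK"
  shows "(*) c ` J \<in> nz"
proof -
  note P = ideal_props[OF J]
  have "ideal ((*) c ` J) OK" unfolding ideal_iff
  proof (intro conjI ballI)
    show "0 \<in> (*) c ` J" using P(2) by force
    fix x y assume "x \<in> (*) c ` J" "y \<in> (*) c ` J"
    then obtain x' y' where "x = c * x'" "y = c * y'" "x' \<in> J" "y' \<in> J" by blast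
    thus "x + y \<in> (*) c ` J" using P(3)[of x' y'] by (auto simp: distrib_left[symmetric])
  next
    fix r x assume r: "r \<in> carrier OK" and "x \<in> (*) c ` J"
    then obtain x' where x': "x = c * x'" "x' \<in> J" by blast
    have "r * x = c * (r * x')" unfolding x' by simp
    thus "r * x \<in> (*) c ` J" using P(4)[OF r x'(2)] by blast
  qed (rule sub)
  moreover obtain z where "z \<in> J" "z \<noteq> 0" using P(2,5) by blast
  hence "c * z \<in> (*) c ` J" "c * z \<noteq> 0" using c by auto
  hence "(*) c ` J \<noteq> {0}" by blast
  ultimately show ?thesis unfolding nonzero_ideals_def by simp
qed

lemma unit_scale:
  assumes J: "J \<in> nz" and v: "v \<in> Units OK"
  shows "(*) v ` J = J"
proof -
  have sub: "(*) v ` J \<subseteq> J" if "v \<in> Units OK" for v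
    using ideal_props(4)[OF J] that OK_Units by auto
  have "J \<subseteq> (*) v ` J"
  proof
    fix x assume "x \<in> J"
    hence "inverse v * x \<in> J" using sub[OF Units_inverse[OF v]] by blast
    moreover have "v \<noteq> 0" using v OK_Units by auto
    hence "x = v * (inverse v * x)" by simp
    ultimately show "x \<in> (*) v ` J" by blast
  qed
  thus ?thesis using sub[OF v] by blast
qed

text \<open>Cayley-Hamilton: multiplication by c acts on a lattice of rank two by an integer matrix,
  so c is a zero of its monic characteristic polynomial.\<close>

lemma multiplier_OK:
  assumes J: "J \<in> nz" and c: "c \<in> K" and sub: "(*) c ` J \<subseteq> J"
  shows "c \<in> carrier OK"
proof -
  obtain d a b where t: "hnf d a b" "J = hnf_ideal d a b" using J by (rule hnf_ideal_exists)
  define \<alpha> where "\<alpha> = real (d * a)"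
  define \<beta> where "\<beta> = real d * (omega - of_int b)"
  have JZ: "J = zspan \<alpha> \<beta>" using t(2) unfolding hnf_ideal_def \<alpha>_def \<beta>_def .
  have a0: "\<alpha> \<noteq> 0" using t(1) unfolding \<alpha>_def hnf_def by simp
  have "c * \<alpha> \<in> zspan \<alpha> \<beta>" "c * \<beta> \<in> zspan \<alpha> \<beta>" using sub zspan_basis(1)[of \<alpha> \<beta>] zspan_basis(2)[of \<beta> \<alpha>] unfolding JZ by blast+
  then obtain x y z w :: int where 1: "c * \<alpha> = of_int x * \<alpha> + of_int y * \<beta>"
    and 2: "c * \<beta> = of_int z * \<alpha> + of_int w * \<beta>" by (elim zspanE)
  have "(c - of_int w) * ((c - of_int x) * \<alpha>) = of_int y * ((c - of_int w) * \<beta>)"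
    using 1 by (simp add: algebra_simps)
  also have "(c - of_int w) * \<beta> = of_int z * \<alpha>" using 2 by (simp add: algebra_simps)
  finally have "((c - of_int w) * (c - of_int x)) * \<alpha> = (of_int y * of_int z) * \<alpha>" by (simp add: mult.assoc)
  hence "(c - of_int w) * (c - of_int x) = of_int y * of_int z" using a0 by (simp only: mult_cancel_right) simp
  hence "c * c = of_int (x + w) * c + of_int (y * z - x * w)" by (simp add: algebra_simps)
  hence "algebraic_int c" by (rule algebraic_int_quadratic)
  thus ?thesis unfolding carrier_OK using c by blast
qed

lemma stabiliser_unit:
  assumes J: "J \<in> nz" and c: "c \<in> K" "c \<noteq> 0" and eq: "(*) c ` J = J"
  shows "c \<in> Units OK"
proof -
  have "(*) (inverse c) ` J = (*) (inverse c) ` ((*) c ` J)" unfolding eq ..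
  also have "\<dots> = J" using c(2) by (simp add: image_image mult.assoc[symmetric])
  finally have "inverse c \<in> carrier OK" using multiplier_OK[OF J K_inverse(1)[OF c(1)]] by simp
  moreover have "c \<in> carrier OK" using multiplier_OK[OF J c(1)] eq by simp
  moreover have "c * inverse c = 1" using c(2) by simp
  ultimately show ?thesis using OK_Units by blast
qed

text \<open>\<open>lat a b\<close> enumerates the lattice of all \<open>\<delta>\<close> for which \<open>\<delta> / (d a)\<close> times the ideal \<open>hnf_ideal d a b\<close> is integral.\<close>

definition lat :: "nat \<Rightarrow> int \<Rightarrow> int \<times> int \<Rightarrow> real" where
  "lat a b = (\<lambda>(k, n). of_int k * real a + of_int n * (cj omega - of_int b))"

lemma lat_el: "lat a b (k, n) = el (k * int a + n - n * b) (- n)"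
  unfolding lat_def el_def cj_omega by (simp add: algebra_simps)

lemma lat_OK [simp]: "lat a b kn \<in> carrier OK"
  by (cases kn) (simp add: lat_el)

lemma lat_K [simp]: "lat a b kn \<in> K"
  by (rule OK_K) simp

lemma cj_lat: "cj (lat a b (k, n)) = real a * of_int k + of_int n * (omega - of_int b)"
  unfolding lat_el cj_el unfolding el_def by (simp add: algebra_simps)

lemma lat_cj: "lat a b (k, n) = (real a * of_int k + of_int n * (omega - of_int b)) - of_int n * sp"
proof -
  have c: "cj omega = omega - sp" using omega_minus_cj by simp
  show ?thesis unfolding lat_def c by (simp add: algebra_simps)
qed

abbreviation "sec a b \<equiv> hyperbolic_sector.sector sp E (real a) (omega - of_int b)"

lemma sector_interp: "a > 0 \<Longrightarrow> hyperbolic_sector sp E (real a)"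
  using sp_pos E_gt_1 by unfold_locales auto

lemma sec_iff:
  assumes "a > 0"
  shows "kn \<in> sec a b Y \<longleftrightarrow> (let \<delta> = lat a b kn in
    \<delta> > 0 \<and> cj \<delta> > 0 \<and> \<delta> \<le> cj \<delta> \<and> cj \<delta> < E * \<delta> \<and> nrm \<delta> \<le> Y)"
proof -
  obtain k n where kn: "kn = (k, n)" by fastforce
  define x where "x = real a * of_int k + of_int n * (omega - of_int b)"
  have l: "lat a b (k, n) = x - of_int n * sp" and c: "cj (lat a b (k, n)) = x"
    unfolding x_def by (rule lat_cj, rule cj_lat)
  have "kn \<in> sec a b Y \<longleftrightarrow> x > 0 \<and> x - of_int n * sp > 0 \<and> x - of_int n * sp \<le> x \<and>
      x < E * (x - of_int n * sp) \<and> x * (x - of_int n * sp) \<le> Y"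
    unfolding hyperbolic_sector.sector_def[OF sector_interp[OF assms]] kn x_def
    by (simp only: Let_def mem_Collect_eq prod.case)
  thus ?thesis unfolding Let_def kn nrm_def c unfolding l by (auto simp: mult.commute)
qed

text \<open>The hypotheses say that scaling by \<delta> / (d a) sends both generators of the ideal
  to integers. In coordinates the second one is a single divisibility by a, which is the condition
  defining the lattice.\<close>

lemma lat_mem:
  assumes t: "hnf d a b" and d: "\<delta> \<in> carrier OK" "\<delta> * (omega - of_int b) / real a \<in> carrier OK"
  obtains kn where "\<delta> = lat a b kn"
proof -
  obtain m n where mn: "\<delta> = el m n" using d(1) OK_E by blast
  obtain i j where ij: "\<delta> * (omega - of_int b) / real a = el i j" using d(2) OK_E by blast
  have a0: "real a > 0" using t unfolding hnf_def by simp
  have "omega - of_int b = el (- b) 1" unfolding el_def by simp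
  hence "el m n * el (- b) 1 = real a * el i j" using ij a0 unfolding mn by (simp add: field_simps)
  also have "real a * el i j = el (int a * i) (int a * j)" unfolding el_def by (simp add: algebra_simps)
  finally have "m + n - n * b = int a * j" unfolding el_mult el_eq_iff by simp
  hence "\<delta> = lat a b (j, - n)" unfolding mn lat_el el_eq_iff by (simp add: algebra_simps)
  thus ?thesis using that by blast
qed

lemma lat_scale:
  assumes t: "hnf d a b" and nz: "lat a b kn \<noteq> 0"
  defines "J \<equiv> hnf_ideal d a b" and "c \<equiv> lat a b kn / real (d * a)"
  shows "(*) c ` J \<in> nz" "((*) c ` J, J) \<in> ideal_class_rel p"
    "real (inorm ((*) c ` J)) = \<bar>nrm (lat a b kn)\<bar> / real a"
proof -
  obtain k n where kn: "kn = (k, n)" by fastforce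
  have pos: "d > 0" "a > 0" and dv: "int a dvd froot b" using t unfolding hnf_def Rho_def by auto
  obtain f where f: "froot b = int a * f" using dv by (elim dvdE)
  have J: "J \<in> nz" unfolding J_def using t by (rule hnf_ideal_ideal)
  have c0: "c \<noteq> 0" unfolding c_def using nz pos by simp
  have cK: "c \<in> K" unfolding c_def by (rule K_divide) auto
  have "cj omega - of_int b = el (1 - b) (-1)" "omega - of_int b = el (- b) 1"
    unfolding cj_omega el_def by simp_all
  \<comment> \<open>The product is the norm of omega - b, a multiple of a; this keeps the image of
    the second generator integral.\<close>
  hence fr: "(cj omega - of_int b) * (omega - of_int b) = of_int (froot b)"
    by (simp add: el_mult) (simp add: el_def froot_def power2_eq_square algebra_simps)
  have "c * (real d * (omega - of_int b)) = of_int k * (omega - of_int b) + of_int n * ((cj omega - of_int b) * (omega - of_int b)) / real a"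
    unfolding c_def kn lat_def using pos by (simp add: field_simps)
  also have "\<dots> = el (n * f - k * b) k" unfolding fr f el_def using pos by (simp add: algebra_simps)
  finally have c2: "c * (real d * (omega - of_int b)) = el (n * f - k * b) k" .
  have c1: "c * real (d * a) = lat a b kn" unfolding c_def using pos by simp
  have "(*) c ` J = zspan (lat a b kn) (el (n * f - k * b) k)"
    unfolding J_def hnf_ideal_def zspan_scale c1 c2 ..
  hence "(*) c ` J \<subseteq> carrier OK" by (auto elim!: zspanE intro!: OK_add OK_mult)
  from ideal_scale[OF J c0 this] show I: "(*) c ` J \<in> nz" .
  have "(*) (real (d * a)) ` ((*) c ` J) = (*) (lat a b kn) ` J"
    unfolding image_image c1[symmetric] by (simp add: mult_ac)
  moreover have "real (d * a) \<in> carrier OK - {0}" using pos OK_int[of "int (d * a)"] by simp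
  moreover have "lat a b kn \<in> carrier OK - {0}" using nz by simp
  ultimately show "((*) c ` J, J) \<in> ideal_class_rel p" unfolding ideal_class_rel_def using I J by blast
  have "real (inorm ((*) c ` J)) = \<bar>nrm c\<bar> * real (d\<^sup>2 * a)"
    using inorm_scale[OF I J cK refl] inorm_hnf_ideal[OF t] unfolding J_def by simp
  also have "nrm c = nrm (lat a b kn) / (real (d * a))\<^sup>2"
    unfolding c_def nrm_def by (subst cj_divide) (auto simp: power2_eq_square)
  also have "\<bar>nrm (lat a b kn) / (real (d * a))\<^sup>2\<bar> * real (d\<^sup>2 * a) = \<bar>nrm (lat a b kn)\<bar> / real a"
    using pos by (simp add: abs_divide power_mult_distrib field_simps power2_eq_square)
  finally show "real (inorm ((*) c ` J)) = \<bar>nrm (lat a b kn)\<bar> / real a" .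
qed

lemma ideal_class_relE:
  assumes "(I, J) \<in> ideal_class_rel p"
  obtains c where "I \<in> nz" "J \<in> nz" "c \<in> K" "c \<noteq> 0" "I = (*) c ` J"
proof -
  obtain x y where xy: "x \<in> carrier OK" "x \<noteq> 0" "y \<in> carrier OK" "y \<noteq> 0" "(*) x ` I = (*) y ` J" "I \<in> nz" "J \<in> nz"
    using assms unfolding ideal_class_rel_def by blast
  have "I = (*) (inverse x) ` ((*) x ` I)" using xy(2) by (simp add: image_image mult.assoc[symmetric])
  also have "\<dots> = (*) (y / x) ` J" unfolding xy(5) by (simp add: image_image divide_inverse mult_ac)
  finally show ?thesis using that[of "y / x"] xy OK_K K_divide by simp
qed

text \<open>An ideal of the class of J is c J with c unique up to the stabiliser of J, which
  consists of units. The sector contains exactly one representative of each unit orbit, and its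
  bound on the product of the conjugates is the norm bound scaled by a.\<close>

theorem class_bij:
  assumes t: "hnf d a b"
  defines "J \<equiv> hnf_ideal d a b"
  shows "bij_betw (\<lambda>kn. (*) (lat a b kn / real (d * a)) ` J) (sec a b (real a * real N))
    {I \<in> nz. (I, J) \<in> ideal_class_rel p \<and> inorm I \<le> N}"
proof (rule bij_betwI')
  have pos: "d > 0" "a > 0" using t unfolding hnf_def by auto
  have J: "J \<in> nz" unfolding J_def using t by (rule hnf_ideal_ideal)
  note sec = sec_iff[OF pos(2), unfolded Let_def]
  {
    fix x y assume x: "x \<in> sec a b (real a * real N)" and y: "y \<in> sec a b (real a * real N)"
    show "((*) (lat a b x / real (d * a)) ` J = (*) (lat a b y / real (d * a)) ` J) = (x = y)"
    proof
      assume e: "(*) (lat a b x / real (d * a)) ` J = (*) (lat a b y / real (d * a)) ` J"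
      define z w where "z = lat a b x" and "w = lat a b y"
      have zw: "z > 0" "cj z > 0" "z \<le> cj z" "cj z < E * z" "w > 0" "cj w > 0" "w \<le> cj w" "cj w < E * w"
        using x y unfolding sec z_def w_def by auto
      have K: "z \<in> K" "w \<in> K" unfolding z_def w_def by auto
      have "(*) (z / w) ` J = (*) (real (d * a) / w) ` ((*) (z / real (d * a)) ` J)"
        using pos by (simp add: image_image)
      also have "\<dots> = (*) (real (d * a) / w) ` ((*) (w / real (d * a)) ` J)"
        using e unfolding z_def w_def by simp
      also have "\<dots> = J" using pos zw by (simp add: image_image)
      finally have st: "(*) (z / w) ` J = J" .
      have "z / w \<in> K" using K by (rule K_divide)
      hence "z / w \<in> Units OK" using stabiliser_unit[OF J _ _ st] zw by auto
      moreover have cq: "cj (z / w) = cj z / cj w" using K by (rule cj_divide)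
      ultimately obtain k where k: "z / w = eps powi (2 * k)"
        using positive_unit[of "z / w"] zw by auto
      define q where "q = eps powi (2 * k)"
      have q0: "q > 0" unfolding q_def by (rule eps_powi_pos)
      have zq: "z = q * w" using k zw unfolding q_def by (simp add: field_simps)
      have "cj z / cj w = inverse q" using cq k cj_even_power unfolding q_def by simp
      hence cz: "cj z * q = cj w" using zw q0 by (simp add: field_simps)
      have Eq: "E powi k = q * q" unfolding q_def by (rule E_powi)
      \<comment> \<open>z and w = z / eps^(2 k) both lie in the fundamental domain. Comparing the
        ratios of their conjugates forces -1 < k < 1.\<close>
      have "w \<le> cj w" "cj w < E * w" "q * q * w \<le> cj w" "cj w < E * (q * q * w)"
        using zw(3,4,7,8) q0 unfolding cz[symmetric] zq
        by (auto simp: mult.commute mult.left_commute mult_less_cancel_left_pos)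
      hence "q * q * w < E * w" "w < E * (q * q * w)" by linarith+
      hence "q * q < E" "1 < E * (q * q)" using zw(5) by (simp_all add: mult.assoc[symmetric])
      hence "E powi k < E powi 1" "E powi 0 < E powi (1 + k)" unfolding Eq[symmetric] using E_gt_1
        by (simp_all add: power_int_add)
      hence "k < 1" "0 < 1 + k"
        using E_gt_1 power_int_increasing[of 1 k E] power_int_increasing[of "1 + k" 0 E] by linarith+
      hence "k = 0" by linarith
      hence "z = w" using zq unfolding q_def by simp
      moreover obtain k1 n1 k2 n2 where xy: "x = (k1, n1)" "y = (k2, n2)" by fastforce
      ultimately have cc: "k1 * int a + n1 - n1 * b = k2 * int a + n2 - n2 * b \<and> - n1 = - n2"
        unfolding z_def w_def xy lat_el el_eq_iff by blast
      hence n: "n1 = n2" by (simp only: neg_equal_iff_equal)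
      note kk = conjunct1[OF cc]
      have "k1 * int a = k2 * int a" using kk unfolding n by simp
      thus "x = y" using pos n unfolding xy by simp
    qed simp
  next
    fix x assume x: "x \<in> sec a b (real a * real N)"
    hence p: "lat a b x > 0" "cj (lat a b x) > 0" "nrm (lat a b x) \<le> real a * real N" unfolding sec by auto
    hence ne: "lat a b x \<noteq> 0" by simp
    note S = lat_scale[OF t ne]
    have "\<bar>nrm (lat a b x)\<bar> \<le> real a * real N" using p unfolding nrm_def by simp
    hence "\<bar>nrm (lat a b x)\<bar> / real a \<le> real N" using pos by (simp add: field_simps)
    thus "(*) (lat a b x / real (d * a)) ` J \<in> {I \<in> nz. (I, J) \<in> ideal_class_rel p \<and> inorm I \<le> N}"
      unfolding J_def using S by simp
  next
    fix I assume "I \<in> {I \<in> nz. (I, J) \<in> ideal_class_rel p \<and> inorm I \<le> N}"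
    hence I: "I \<in> nz" "(I, J) \<in> ideal_class_rel p" "inorm I \<le> N" by auto
    obtain c where c: "c \<in> K" "c \<noteq> 0" "I = (*) c ` J" using I(2) by (rule ideal_class_relE)
    have "c * real (d * a) \<in> K" "c * real (d * a) \<noteq> 0" using c pos by (auto intro!: K_mult)
    then obtain v where v: "v \<in> Units OK" and vp: "v * (c * real (d * a)) > 0" "cj (v * (c * real (d * a))) > 0"
      "v * (c * real (d * a)) \<le> cj (v * (c * real (d * a)))"
      "cj (v * (c * real (d * a))) < E * (v * (c * real (d * a)))" by (rule normalise_unit)
    define z where "z = v * (c * real (d * a))"
    have "I = (*) c ` ((*) v ` J)" unfolding unit_scale[OF J v] by (rule c(3))
    also have "\<dots> = (*) (z / real (d * a)) ` J" unfolding z_def using pos by (simp add: image_image mult_ac)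
    finally have Iz: "I = (*) (z / real (d * a)) ` J" .
    have JO: "real (d * a) \<in> J" "real d * (omega - of_int b) \<in> J"
      unfolding J_def hnf_ideal_def by (rule zspan_basis)+
    have "z / real (d * a) * real (d * a) \<in> I" "z / real (d * a) * (real d * (omega - of_int b)) \<in> I"
      unfolding Iz using JO by blast+
    moreover have "z / real (d * a) * real (d * a) = z" using pos by simp
    moreover have "z / real (d * a) * (real d * w) = z * w / real a" for w using pos by (simp add: field_simps)
    ultimately have "z \<in> I" "z * (omega - of_int b) / real a \<in> I" by (simp_all only:)
    hence "z \<in> carrier OK" "z * (omega - of_int b) / real a \<in> carrier OK" using ideal_props(1)[OF I(1)] by auto
    then obtain kn where kn: "z = lat a b kn" by (rule lat_mem[OF t])
    have ne: "lat a b kn \<noteq> 0" using vp(1) kn z_def by simp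
    have "real (inorm I) = \<bar>nrm z\<bar> / real a" using lat_scale(3)[OF t ne] unfolding Iz J_def kn .
    moreover have "nrm z > 0" using vp unfolding nrm_def z_def by simp
    ultimately have "nrm z = real a * real (inorm I)" using pos by simp
    also have "\<dots> \<le> real a * real N" using I(3) by (intro mult_left_mono) auto
    finally have "nrm z \<le> real a * real N" .
    hence "kn \<in> sec a b (real a * real N)" unfolding sec kn[symmetric] using vp unfolding z_def by blast
    thus "\<exists>x\<in>sec a b (real a * real N). I = (*) (lat a b x / real (d * a)) ` J"
      using Iz unfolding kn by blast
  }
qed

text \<open>The scale Y = a N cancels the parameter a of the lattice, so every class has the same
  density; ln E = 4 ln eps supplies the constant.\<close>

lemma class_asymptotics:
  assumes J: "J \<in> nz"
  shows "(\<lambda>N. real (card {I \<in> nz. (I, J) \<in> ideal_class_rel p \<and> inorm I \<le> N}) / real N)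
    \<longlonglongrightarrow> 2 * ln eps / sp"
proof -
  obtain d a b where t: "hnf d a b" "J = hnf_ideal d a b" using J by (rule hnf_ideal_exists)
  have a: "a > 0" using t(1) unfolding hnf_def by simp
  have c: "card {I \<in> nz. (I, J) \<in> ideal_class_rel p \<and> inorm I \<le> N} = card (sec a b (real a * real N))" for N
    using bij_betw_same_card[OF class_bij[OF t(1), of N]] unfolding t(2) by simp
  have f: "filterlim (\<lambda>N. real a * real N) at_top sequentially"
    using a by (intro filterlim_tendsto_pos_mult_at_top[OF tendsto_const] filterlim_real_sequentially) auto
  have "(\<lambda>N. real (card (sec a b (real a * real N))) / (real a * real N)) \<longlonglongrightarrow> ln E / (2 * sp * real a)"
    by (rule filterlim_compose[OF hyperbolic_sector.sector_asymptotics[OF sector_interp[OF a]] f])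
  hence "(\<lambda>N. real a * (real (card (sec a b (real a * real N))) / (real a * real N))) \<longlonglongrightarrow>
      real a * (ln E / (2 * sp * real a))" by (intro tendsto_mult tendsto_const)
  moreover have "real a * (ln E / (2 * sp * real a)) = 2 * ln eps / sp"
    unfolding E_def using a eps_gt_1 by (simp add: ln_realpow field_simps)
  moreover have "real a * (real (card (sec a b (real a * real N))) / (real a * real N)) = real (card (sec a b (real a * real N))) / real N" for N
    using a by simp
  ultimately show ?thesis unfolding c by simp
qed

lemma class_equiv: "equiv nz (ideal_class_rel p)"
proof (rule equivI)
  show "ideal_class_rel p \<subseteq> nz \<times> nz" unfolding ideal_class_rel_def by blast
  have "1 \<in> carrier OK - {0}" by simp
  thus "refl_on nz (ideal_class_rel p)" unfolding refl_on_def ideal_class_rel_def by blast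
  show "sym (ideal_class_rel p)"
  proof (rule symI)
    fix I J assume "(I, J) \<in> ideal_class_rel p"
    then obtain x y where "I \<in> nz" "J \<in> nz" "x \<in> carrier OK - {0}" "y \<in> carrier OK - {0}" "(*) x ` I = (*) y ` J"
      unfolding ideal_class_rel_def by blast
    moreover from this have "(*) y ` J = (*) x ` I" by (simp only:)
    ultimately show "(J, I) \<in> ideal_class_rel p" unfolding ideal_class_rel_def by blast
  qed
  show "trans (ideal_class_rel p)"
  proof (rule transI)
    fix I J L assume IJ: "(I, J) \<in> ideal_class_rel p" and JL: "(J, L) \<in> ideal_class_rel p"
    obtain x y where x: "I \<in> nz" "x \<in> carrier OK - {0}" "y \<in> carrier OK - {0}" "(*) x ` I = (*) y ` J"
      using IJ unfolding ideal_class_rel_def by blast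
    obtain z w where z: "L \<in> nz" "z \<in> carrier OK - {0}" "w \<in> carrier OK - {0}" "(*) z ` J = (*) w ` L"
      using JL unfolding ideal_class_rel_def by blast
    have "(*) (z * x) ` I = (*) z ` ((*) x ` I)" by (simp add: image_image mult.assoc)
    also have "\<dots> = (*) y ` ((*) z ` J)" unfolding x(4) by (simp add: image_image mult.left_commute)
    also have "\<dots> = (*) (y * w) ` L" unfolding z(4) by (simp add: image_image mult.assoc)
    finally have e: "(*) (z * x) ` I = (*) (y * w) ` L" .
    have "z * x \<in> carrier OK - {0}" "y * w \<in> carrier OK - {0}" using x z OK_mult by auto
    thus "(I, L) \<in> ideal_class_rel p" unfolding ideal_class_rel_def using x(1) z(1) e by blast
  qed
qed

text \<open>Finiteness of the class group comes out of the same count: \<open>k\<close> classes already force \<open>k (2 ln \<epsilon> / \<surd>p) \<le> L(1, \<chi>)\<close>.\<close>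

theorem class_number_formula: "real (class_number p) * (2 * ln eps) = sp * L1"
proof -
  let ?Q = "nz // ideal_class_rel p"
  let ?k = "2 * ln eps / sp"
  have k0: "?k > 0" using eps_gt_1 sp_pos by simp
  define cnt where "cnt C N = card {I \<in> C. inorm I \<le> N}" for C N
  have lim: "(\<lambda>N. real (cnt C N) / real N) \<longlonglongrightarrow> ?k" if C: "C \<in> ?Q" for C
  proof -
    obtain J where J: "J \<in> nz" "C = ideal_class_rel p `` {J}" using C by (elim quotientE)
    have sym: "sym (ideal_class_rel p)" using class_equiv by (rule equivE)
    have "I \<in> C \<longleftrightarrow> I \<in> nz \<and> (I, J) \<in> ideal_class_rel p" for I
    proof
      assume "I \<in> C"
      hence "(I, J) \<in> ideal_class_rel p" using sym unfolding J(2) by (simp add: symD)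
      moreover from this have "I \<in> nz" unfolding ideal_class_rel_def by simp
      ultimately show "I \<in> nz \<and> (I, J) \<in> ideal_class_rel p" by simp
    next
      assume "I \<in> nz \<and> (I, J) \<in> ideal_class_rel p"
      thus "I \<in> C" using sym unfolding J(2) by (simp add: symD)
    qed
    hence "{I \<in> C. inorm I \<le> N} = {I \<in> nz. (I, J) \<in> ideal_class_rel p \<and> inorm I \<le> N}" for N by simp
    thus ?thesis using class_asymptotics[OF J(1)] unfolding cnt_def by simp
  qed
  have Csub: "C \<subseteq> nz" if "C \<in> ?Q" for C using that in_quotient_imp_subset[OF class_equiv] by blast
  have fin: "finite {I \<in> C. inorm I \<le> N}" if "C \<in> ?Q" for C N
    by (rule finite_subset[OF _ card_inorm_le(1)[of N]]) (use Csub[OF that] in blast)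
  have union: "(\<Sum>C\<in>F. cnt C N) = card (\<Union>C\<in>F. {I \<in> C. inorm I \<le> N})" if F: "F \<subseteq> ?Q" "finite F" for F N
    unfolding cnt_def
  proof (rule card_UN_disjoint[symmetric])
    show "\<forall>i\<in>F. \<forall>j\<in>F. i \<noteq> j \<longrightarrow> {I \<in> i. inorm I \<le> N} \<inter> {I \<in> j. inorm I \<le> N} = {}"
      using quotient_disj[OF class_equiv] F(1) by blast
  qed (use F fin in auto)
  have limF: "(\<lambda>N. real (\<Sum>C\<in>F. cnt C N) / real N) \<longlonglongrightarrow> real (card F) * ?k" if F: "F \<subseteq> ?Q" "finite F" for F
  proof -
    have "(\<lambda>N. \<Sum>C\<in>F. real (cnt C N) / real N) \<longlonglongrightarrow> (\<Sum>C\<in>F. ?k)"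
      using F(1) by (intro tendsto_sum lim) auto
    thus ?thesis by (simp add: sum_divide_distrib)
  qed
  have total: "card {I \<in> nz. inorm I \<le> N} = (\<Sum>n = 1..N. ideal_count n)" for N by (rule card_inorm_le(2))
  have le: "real (card F) * ?k \<le> L1" if F: "F \<subseteq> ?Q" "finite F" for F
  proof (rule tendsto_le[OF _ mean_ideal_count limF[OF F]])
    have "(\<Sum>C\<in>F. cnt C N) \<le> (\<Sum>n = 1..N. ideal_count n)" for N
      unfolding union[OF F] total[symmetric]
      by (rule card_mono[OF card_inorm_le(1)]) (use Csub F in blast)
    hence "real (\<Sum>C\<in>F. cnt C N) / real N \<le> (\<Sum>n = 1..N. real (ideal_count n)) / real N" for N
      by (intro divide_right_mono) (simp_all flip: of_nat_sum)
    thus "\<forall>\<^sub>F N in sequentially. real (\<Sum>C\<in>F. cnt C N) / real N \<le> (\<Sum>n = 1..N. real (ideal_count n)) / real N"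
      by simp
  qed simp
  have finQ: "finite ?Q"
  proof (rule ccontr)
    assume inf: "infinite ?Q"
    obtain n :: nat where n: "real n > L1 / ?k" using reals_Archimedean2 by blast
    obtain F where F: "F \<subseteq> ?Q" "finite F" "card F = n" using infinite_arbitrarily_large[OF inf] by blast
    have "L1 < real n * ?k" using n k0 by (simp only: pos_divide_less_eq)
    thus False using le[OF F(1,2)] F(3) by simp
  qed
  have "(\<Union>C\<in>?Q. {I \<in> C. inorm I \<le> N}) = {I \<in> nz. inorm I \<le> N}" for N
    using Union_quotient[OF class_equiv] by blast
  hence "(\<Sum>C\<in>?Q. cnt C N) = (\<Sum>n = 1..N. ideal_count n)" for N
    using union[OF order_refl finQ] total by simp
  hence "(\<lambda>N. (\<Sum>n = 1..N. real (ideal_count n)) / real N) \<longlonglongrightarrow> real (card ?Q) * ?k"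
    using limF[OF order_refl finQ] by (simp flip: of_nat_sum)
  hence "L1 = real (card ?Q) * ?k" using LIMSEQ_unique mean_ideal_count by blast
  thus ?thesis unfolding class_number_def using sp_pos by simp
qed

end

section \<open>Congruences modulo powers of \<open>p\<close>\<close>

context quad_prime
begin

text \<open>\<open>padic k x\<close> means \<open>x \<in> p\<^sup>k Z\<^bsub>(p)\<^esub>\<close>.\<close>

definition padic :: "nat \<Rightarrow> rat \<Rightarrow> bool" where
  "padic k x \<longleftrightarrow> (\<exists>a b :: int. \<not> int p dvd b \<and> x = of_nat p ^ k * (of_int a / of_int b))"

lemma p_ne_0 [simp]: "p \<noteq> 0" "(of_nat p :: rat) \<noteq> 0"
  using p_ge_5 by auto

lemma not_dvd_mult: "\<not> int p dvd a \<Longrightarrow> \<not> int p dvd b \<Longrightarrow> \<not> int p dvd a * b"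
  using prime_dvd_mult_iff[of "int p" a b] prime_p by simp

lemma not_dvd_1: "\<not> int p dvd 1"
  using p_ge_5 by (auto simp: zdvd1_eq)

lemma padic_add: assumes "padic k x" "padic k y" shows "padic k (x + y)"
proof -
  obtain a b c d where *: "\<not> int p dvd b" "x = of_nat p ^ k * (of_int a / of_int b)"
    "\<not> int p dvd d" "y = of_nat p ^ k * (of_int c / of_int d)" using assms unfolding padic_def by blast
  have "b \<noteq> 0" "d \<noteq> 0" using * by auto
  hence "x + y = of_nat p ^ k * (of_int (a * d + c * b) / of_int (b * d))"
    unfolding *(2,4) by (simp add: field_simps)
  thus ?thesis unfolding padic_def using not_dvd_mult[OF *(1,3)] by blast
qed

lemma padic_mult: assumes "padic j x" "padic k y" shows "padic (j + k) (x * y)"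
proof -
  obtain a b c d where *: "\<not> int p dvd b" "x = of_nat p ^ j * (of_int a / of_int b)"
    "\<not> int p dvd d" "y = of_nat p ^ k * (of_int c / of_int d)" using assms unfolding padic_def by blast
  have "x * y = of_nat p ^ (j + k) * (of_int (a * c) / of_int (b * d))"
    unfolding *(2,4) by (simp add: power_add field_simps)
  thus ?thesis unfolding padic_def using not_dvd_mult[OF *(1,3)] by blast
qed

lemma padic_of_int: "int p ^ k dvd a \<Longrightarrow> padic k (of_int a)"
proof (elim dvdE)
  fix c assume "a = int p ^ k * c"
  hence "of_int a = of_nat p ^ k * (of_int c / of_int 1 :: rat)" by simp
  thus "padic k (of_int a)" unfolding padic_def using not_dvd_1 by blast
qed

lemma padic_0 [simp]: "padic k 0" using padic_of_int[of k 0] by simp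

lemma padic0_of_int [simp]: "padic 0 (of_int a)" using padic_of_int[of 0 a] by simp
lemma padic0_of_nat [simp]: "padic 0 (of_nat a)" using padic0_of_int[of "int a"] by simp
lemma padic0_1 [simp]: "padic 0 1" using padic0_of_int[of 1] by simp
lemma padic0_numeral [simp]: "padic 0 (numeral n)" using padic0_of_int[of "numeral n"] by simp

lemma padic_p_power: "padic k (of_nat p ^ k)"
  using padic_of_int[of k "int p ^ k"] by simp

lemma padic_p: "padic 1 (of_nat p)" "padic (Suc 0) (of_nat p)"
  using padic_p_power[of 1] by simp_all

lemma padic_mult0: "padic 0 x \<Longrightarrow> padic k y \<Longrightarrow> padic k (x * y)" "padic k y \<Longrightarrow> padic 0 x \<Longrightarrow> padic k (y * x)"
  using padic_mult[of 0 x k y] padic_mult[of k y 0 x] by auto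

lemma padic_minus: "padic k x \<Longrightarrow> padic k (- x)"
  using padic_mult0(1)[OF padic0_of_int[of "-1"], of k x] by simp

lemma padic_diff: "padic k x \<Longrightarrow> padic k y \<Longrightarrow> padic k (x - y)"
  using padic_add[of k x "- y"] padic_minus by simp

lemma padic_sum: "(\<And>i. i \<in> S \<Longrightarrow> padic k (f i)) \<Longrightarrow> padic k (\<Sum>i\<in>S. f i)"
  by (induction S rule: infinite_finite_induct) (auto intro: padic_add)

lemma padic0_prod: "(\<And>i. i \<in> S \<Longrightarrow> padic 0 (f i)) \<Longrightarrow> padic 0 (\<Prod>i\<in>S. f i)"
  by (induction S rule: infinite_finite_induct) (auto intro: padic_mult0)

lemma padic0_power: "padic 0 x \<Longrightarrow> padic 0 (x ^ n)"
  by (induction n) (auto intro: padic_mult0)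

lemma padic_mono: assumes "padic k x" "j \<le> k" shows "padic j x"
proof -
  have "padic j (of_nat p ^ j * (of_nat p ^ (k - j) * y))" if "padic 0 y" for y
    using padic_mult0(2)[OF padic_p_power[of j] padic_mult0(1)[OF padic0_power[OF padic0_of_nat] that]] by simp
  moreover obtain a b where ab: "\<not> int p dvd b" "x = of_nat p ^ k * (of_int a / of_int b)" using assms(1) unfolding padic_def by blast
  moreover have "padic 0 (of_int a / of_int b)" unfolding padic_def using ab by auto
  moreover have "of_nat p ^ k = of_nat p ^ j * (of_nat p ^ (k - j) :: rat)" using assms(2) by (simp add: power_add[symmetric])
  ultimately show ?thesis by (metis mult.assoc)
qed

lemma padic_divide_int: assumes "padic k x" "\<not> int p dvd b" shows "padic k (x / of_int b)"
proof -
  have "padic 0 (of_int 1 / of_int b)" unfolding padic_def using assms(2) by (intro exI[of _ 1] exI[of _ b]) simp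
  from padic_mult0(2)[OF assms(1) this] show ?thesis by simp
qed

lemma padic_cancel_int: assumes "padic k (of_int b * x)" "\<not> int p dvd b" shows "padic k x"
proof -
  have "b \<noteq> 0" using assms(2) by auto
  thus ?thesis using padic_divide_int[OF assms] by simp
qed

lemma padic_p_divide: "padic (Suc k) x \<longleftrightarrow> padic k (x / of_nat p)"
proof
  assume "padic (Suc k) x"
  thus "padic k (x / of_nat p)" unfolding padic_def by fastforce
next
  assume "padic k (x / of_nat p)"
  from padic_mult[OF padic_p(1) this] show "padic (Suc k) x" by simp
qed

lemma padic_of_int_iff: "padic k (of_int a) \<longleftrightarrow> int p ^ k dvd a"
proof
  assume "padic k (of_int a)"
  then obtain c b where cb: "\<not> int p dvd b" "of_int a = of_nat p ^ k * (of_int c / of_int b :: rat)" unfolding padic_def by blast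
  have "b \<noteq> 0" using cb by auto
  hence "(of_int (a * b) :: rat) = of_int (int p ^ k * c)" using cb(2) by (simp add: field_simps)
  hence "a * b = int p ^ k * c" by (simp only: of_int_eq_iff)
  hence "int p ^ k dvd a * b" by simp
  moreover have "coprime (int p ^ k) b" using cb(1) prime_p prime_imp_coprime[of "int p" b] by simp
  ultimately show "int p ^ k dvd a" by (simp add: coprime_dvd_mult_left_iff)
qed (rule padic_of_int)

lemma fact_not_dvd: "k < p \<Longrightarrow> \<not> int p dvd fact k"
  using prime_dvd_fact_iff[OF prime_p, of k] by (metis int_dvd_int_iff not_le of_nat_fact)

lemma padic_divide_fact: "padic j x \<Longrightarrow> k < p \<Longrightarrow> padic j (x / fact k)"
  using padic_divide_int[of j x "fact k"] fact_not_dvd[of k] by simp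

lemma padic_inverse: assumes "padic 0 x" "\<not> padic 1 x" shows "padic 0 (inverse x)"
proof -
  obtain a b where ab: "\<not> int p dvd b" "x = of_int a / of_int b" using assms(1) unfolding padic_def by auto
  have "\<not> int p dvd a"
  proof
    assume "int p dvd a"
    hence "padic 1 (of_int a)" by (intro padic_of_int) simp
    thus False using padic_divide_int ab assms(2) by blast
  qed
  moreover have "inverse x = of_int b / of_int a" unfolding ab(2) by simp
  ultimately show ?thesis unfolding padic_def by auto
qed

lemma Z_localized_iff: "x \<in> Z_localized p \<longleftrightarrow> padic 0 x"
proof -
  obtain a b where ab: "quotient_of x = (a, b)" by fastforce
  have x: "x = of_int a / of_int b" "b > 0" "coprime a b"
    using quotient_of_div[OF ab] quotient_of_denom_pos[OF ab] quotient_of_coprime[OF ab] by auto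
  show ?thesis
  proof
    assume "x \<in> Z_localized p"
    hence "coprime (int p) b" unfolding Z_localized_def by (simp add: ab)
    hence "\<not> int p dvd b" using prime_p not_dvd_1 by (metis coprime_common_divisor dvd_refl)
    thus "padic 0 x" unfolding padic_def using x by auto
  next
    assume "padic 0 x"
    then obtain c d where cd: "\<not> int p dvd d" "x = of_int c / of_int d" unfolding padic_def by auto
    have "d \<noteq> 0" using cd by auto
    hence "(of_int (a * d) :: rat) = of_int (c * b)" using cd(2) x by (simp add: field_simps)
    hence "a * d = c * b" by (simp only: of_int_eq_iff)
    hence "b dvd a * d" by simp
    hence "b dvd d" using x(3) by (simp add: coprime_dvd_mult_right_iff coprime_commute)
    hence "\<not> int p dvd b" using cd(1) dvd_trans by blast
    thus "x \<in> Z_localized p" unfolding Z_localized_def using prime_p prime_imp_coprime[of "int p" b] by (simp add: ab)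
  qed
qed

lemma rat_congI: assumes "padic 0 y" "padic 1 (x - y)" shows "rat_cong p x y"
proof -
  have "padic 0 (y + (x - y))" using padic_mono[OF assms(2), of 0] assms(1) by (intro padic_add) auto
  moreover have "padic 0 ((x - y) / of_nat p)" using assms(2) padic_p_divide[of 0] by simp
  moreover have "x - y = of_nat p * ((x - y) / of_nat p)" by simp
  ultimately show ?thesis using assms(1) unfolding rat_cong_def Z_localized_iff by (intro conjI bexI[of _ "(x - y) / of_nat p"]) (simp_all add: Z_localized_iff)
qed

text \<open>Products of two of the \<open>f i\<close> already lie in p^2, so only the linear terms
  remain.\<close>

lemma padic_prod_one_plus:
  assumes "finite S" "\<And>i. i \<in> S \<Longrightarrow> padic 1 (f i)"
  shows "padic 2 ((\<Prod>i\<in>S. 1 + f i) - (1 + (\<Sum>i\<in>S. f i)))"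
  using assms
proof (induction S rule: finite_induct)
  case (insert i S)
  let ?P = "\<Prod>i\<in>S. 1 + f i" and ?T = "\<Sum>i\<in>S. f i"
  have IH: "padic 2 (?P - (1 + ?T))" using insert by blast
  have "padic 0 (1 + f i)" using insert.prems[of i] padic_mono[of 1 "f i" 0] by (intro padic_add) auto
  hence "padic 2 ((1 + f i) * (?P - (1 + ?T)))" using IH by (rule padic_mult0)
  moreover have "padic 2 (f i * ?T)" using padic_mult[of 1 "f i" 1 ?T] padic_sum[of S 1 f] insert.prems by (simp add: numeral_2_eq_2)
  ultimately have "padic 2 ((1 + f i) * (?P - (1 + ?T)) + f i * ?T)" by (rule padic_add)
  moreover have "(1 + f i) * (?P - (1 + ?T)) + f i * ?T = (1 + f i) * ?P - (1 + (f i + ?T))"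
    by (simp add: algebra_simps)
  ultimately show ?case using insert.hyps by simp
qed simp

section \<open>Power series with p-integral coefficients\<close>

definition fpadic :: "nat \<Rightarrow> nat \<Rightarrow> rat fps \<Rightarrow> bool" where
  "fpadic k n f \<longleftrightarrow> (\<forall>i<n. padic k (fps_nth f i))"

lemma fpadic_add: "fpadic k n f \<Longrightarrow> fpadic k n g \<Longrightarrow> fpadic k n (f + g)"
  and fpadic_diff: "fpadic k n f \<Longrightarrow> fpadic k n g \<Longrightarrow> fpadic k n (f - g)"
  unfolding fpadic_def by (auto intro: padic_add padic_diff)

lemma fpadic_mult: assumes "fpadic j n f" "fpadic k n g" shows "fpadic (j + k) n (f * g)"
  unfolding fpadic_def fps_mult_nth
proof (intro allI impI padic_sum)
  fix i l assume "i < n" "l \<in> {0..i}"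
  thus "padic (j + k) (fps_nth f l * fps_nth g (i - l))"
    using assms unfolding fpadic_def by (intro padic_mult) auto
qed

lemma fpadic_mult0: "fpadic 0 n f \<Longrightarrow> fpadic k n g \<Longrightarrow> fpadic k n (f * g)" "fpadic k n g \<Longrightarrow> fpadic 0 n f \<Longrightarrow> fpadic k n (g * f)"
  using fpadic_mult[of 0 n f k g] fpadic_mult[of k n g 0 f] by auto

lemma fpadic_1 [simp]: "fpadic 0 n 1" unfolding fpadic_def by simp

lemma fpadic0_prod: "(\<And>i. i \<in> S \<Longrightarrow> fpadic 0 n (f i)) \<Longrightarrow> fpadic 0 n (\<Prod>i\<in>S. f i)"
  by (induction S rule: infinite_finite_induct) (auto intro: fpadic_mult0)

lemma fpadic0_power: "fpadic 0 n f \<Longrightarrow> fpadic 0 n (f ^ j)"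
  by (induction j) (auto intro: fpadic_mult0)

lemma fpadic_const: "padic k c \<Longrightarrow> fpadic k n (fps_const c)"
  unfolding fpadic_def by simp

lemma fpadic_mono: "fpadic k n f \<Longrightarrow> n' \<le> n \<Longrightarrow> fpadic k n' f"
  unfolding fpadic_def by auto

lemma fpadic_deriv: "fpadic k (Suc n) f \<Longrightarrow> fpadic k n (fps_deriv f)"
  unfolding fpadic_def by (auto intro!: padic_mult0(1) simp flip: of_nat_Suc)

lemma fpadic_inverse:
  assumes "fpadic 0 n f" "\<not> padic 1 (fps_nth f 0)"
  shows "fpadic 0 n (inverse f)"
  unfolding fpadic_def
proof (intro allI impI)
  fix i assume "i < n"
  have ne: "fps_nth f 0 \<noteq> 0" using assms(2) by auto
  hence inv: "inverse f * f = 1" by (rule inverse_mult_eq_1)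
  from \<open>i < n\<close> show "padic 0 (fps_nth (inverse f) i)"
  proof (induction i rule: less_induct)
    case (less i)
    have i0: "padic 0 (inverse (fps_nth f 0))" using assms less.prems unfolding fpadic_def by (intro padic_inverse) auto
    have "fps_nth (inverse f * f) i = (\<Sum>l<i. fps_nth (inverse f) l * fps_nth f (i - l)) + fps_nth (inverse f) i * fps_nth f 0"
      unfolding fps_mult_nth by (simp add: atLeast0AtMost lessThan_Suc_atMost[symmetric])
    hence "fps_nth (inverse f) i = (fps_nth 1 i - (\<Sum>l<i. fps_nth (inverse f) l * fps_nth f (i - l))) * inverse (fps_nth f 0)"
      unfolding inv using ne by (simp add: field_simps)
    moreover have "padic 0 (fps_nth 1 i - (\<Sum>l<i. fps_nth (inverse f) l * fps_nth f (i - l)))"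
    proof (intro padic_diff padic_sum)
      fix l assume "l \<in> {..<i}"
      thus "padic 0 (fps_nth (inverse f) l * fps_nth f (i - l))"
        using less assms(1) unfolding fpadic_def by (intro padic_mult0(1)) auto
    qed auto
    ultimately show ?case using i0 padic_mult0(1) by metis
  qed
qed

lemma fpadic_cancel:
  assumes "fpadic k n (f * g)" "fpadic 0 n f" "\<not> padic 1 (fps_nth f 0)"
  shows "fpadic k n g"
proof -
  have "fps_nth f 0 \<noteq> 0" using assms(3) by auto
  from inverse_mult_eq_1[OF this] have *: "inverse f * (f * g) = g" by (simp add: mult.assoc[symmetric])
  show ?thesis using fpadic_mult0(1)[OF fpadic_inverse[OF assms(2,3)] assms(1)] unfolding * .
qed

text \<open>The factorials k! are prime to p exactly for k < p. This is the reason for truncating in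
  \<open>fpadic\<close>.\<close>

lemma fpadic_exp: "fpadic 0 p (fps_exp (of_nat a))"
  unfolding fpadic_def by (auto intro!: padic_divide_fact padic0_power)

text \<open>The power series \<open>(e\<^bsup>a y\<^esup> - 1) / y\<close>.\<close>

definition expq :: "nat \<Rightarrow> rat fps" where
  "expq a = Abs_fps (\<lambda>k. of_nat a ^ Suc k / fact (Suc k))"

lemma expq_nth: "fps_nth (expq a) k = of_nat a ^ Suc k / fact (Suc k)"
  unfolding expq_def by simp

lemma expq_0: "fps_nth (expq a) 0 = of_nat a"
  unfolding expq_nth by simp

lemma X_expq: "fps_X * expq a = fps_exp (of_nat a) - 1"
  by (rule fps_ext) (auto simp: expq_nth power_Suc[symmetric] simp del: power_Suc fact_Suc)

lemma fpadic_expq: "fpadic 0 (p - 1) (expq a)"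
  unfolding fpadic_def expq_nth by (auto intro!: padic_divide_fact padic0_power simp del: power_Suc fact_Suc)

lemma fps_X_cancel: "fps_X * f = fps_X * g \<Longrightarrow> f = (g :: rat fps)"
  by simp

lemma expq_geometric: "expq a = (\<Sum>j<a. fps_exp 1 ^ j) * expq 1"
proof (rule fps_X_cancel)
  have "fps_X * expq a = fps_exp 1 ^ a - 1" unfolding X_expq by (simp add: fps_exp_power_mult)
  also have "\<dots> = (fps_exp 1 - 1) * (\<Sum>j<a. fps_exp 1 ^ j)" by (rule power_diff_1_eq)
  also have "fps_exp 1 - 1 = fps_X * expq 1" unfolding X_expq by simp
  finally show "fps_X * expq a = fps_X * ((\<Sum>j<a. fps_exp 1 ^ j) * expq 1)" by (simp add: mult_ac)
qed

text \<open>The logarithmic derivative of (e^y - 1) / y, that is 1 + 1 / (e^y - 1) - 1 / y, a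
  generating series of Bernoulli numbers.\<close>

definition expq_ld :: "rat fps" where "expq_ld = fps_deriv (expq 1) * inverse (expq 1)"

text \<open>\<open>bern_coeff\<close> is \<open>B\<^sub>m / m!\<close> for the Bernoulli number \<open>B\<^sub>m\<close> with \<open>m = half\<close>.\<close>

definition bern_coeff :: rat where "bern_coeff = fps_nth expq_ld (half - 1)"

lemma expq_1_0: "fps_nth (expq 1) 0 \<noteq> 0" "\<not> padic 1 (fps_nth (expq 1) 0)"
  using padic_of_int_iff[of 1 1] not_dvd_1 by (simp_all add: expq_0)

lemma fpadic_expq_ld: "fpadic 0 (p - 2) expq_ld"
  unfolding expq_ld_def
proof (rule fpadic_mult0(1))
  have "Suc (p - 2) = p - 1" using p_ge_5 by simp
  thus "fpadic 0 (p - 2) (fps_deriv (expq 1))" using fpadic_expq[of 1] by (intro fpadic_deriv) simp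
  show "fpadic 0 (p - 2) (inverse (expq 1))"
    by (rule fpadic_mono[OF fpadic_inverse[OF fpadic_expq expq_1_0(2)]]) simp
qed

lemma half_bound: "half - 1 < p - 2" "half < p - 1" "half < p"
  using p_eq_half half_ge_2 by linarith+

lemma padic_bern_coeff: "padic 0 bern_coeff"
  using fpadic_expq_ld half_bound unfolding bern_coeff_def fpadic_def by blast

lemma expq_ld_expq: "expq_ld * expq 1 = fps_deriv (expq 1)"
  unfolding expq_ld_def using expq_1_0(1) by (simp add: mult.assoc inverse_mult_eq_1)

text \<open>\<open>expq a\<close> arises from \<open>expq 1\<close> by substituting a y for y and
  multiplying by a; the constant disappears in the logarithmic derivative and the substitution
  rescales its coefficients.\<close>

lemma expq_log_deriv:
  assumes "a > 0"
  shows "fps_deriv (expq a) * inverse (expq a) = Abs_fps (\<lambda>k. of_nat a ^ Suc k * fps_nth expq_ld k)" (is "_ = ?L")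
proof -
  have "?L * expq a = fps_deriv (expq a)"
  proof (rule fps_ext)
    fix k
    have "fps_nth (?L * expq a) k = (\<Sum>i=0..k. of_nat a ^ (k + 2) * (fps_nth expq_ld i * fps_nth (expq 1) (k - i)))"
      unfolding fps_mult_nth
    proof (intro sum.cong refl)
      fix i assume i: "i \<in> {0..k}"
      have "of_nat a ^ Suc i * of_nat a ^ Suc (k - i) = (of_nat a ^ (k + 2) :: rat)"
        using i by (simp add: power_add[symmetric] flip: power_Suc)
      thus "fps_nth ?L i * fps_nth (expq a) (k - i) = of_nat a ^ (k + 2) * (fps_nth expq_ld i * fps_nth (expq 1) (k - i))"
        unfolding expq_nth by (simp add: mult_ac del: power_Suc fact_Suc)
    qed
    also have "\<dots> = of_nat a ^ (k + 2) * fps_nth (expq_ld * expq 1) k"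
      unfolding fps_mult_nth sum_distrib_left ..
    also have "\<dots> = fps_nth (fps_deriv (expq a)) k" unfolding expq_ld_expq by (simp add: expq_nth del: fact_Suc)
    finally show "fps_nth (?L * expq a) k = fps_nth (fps_deriv (expq a)) k" .
  qed
  moreover have "expq a * inverse (expq a) = 1" using assms expq_0[of a] by (intro inverse_mult_eq_1') simp
  ultimately show ?thesis by (metis mult.assoc mult.right_neutral)
qed

text \<open>The link between the two appearances of Bernoulli numbers: in logarithmic derivatives
  through \<open>expq_ld\<close>, and in power sums through the inverse of \<open>expq 1\<close>.
  They differ only in degrees 0 and 1.\<close>

lemma expq_ld_inverse: "fps_X * expq_ld = inverse (expq 1) + fps_X - 1"
proof -
  have "expq 1 + fps_X * fps_deriv (expq 1) = fps_deriv (fps_X * expq 1)" by simp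
  also have "\<dots> = fps_exp 1" unfolding X_expq by simp
  also have "\<dots> = 1 + fps_X * expq 1" unfolding X_expq by simp
  finally have "fps_X * fps_deriv (expq 1) = 1 + fps_X * expq 1 - expq 1" by (simp add: algebra_simps)
  hence "fps_X * expq_ld = (1 + fps_X * expq 1 - expq 1) * inverse (expq 1)" unfolding expq_ld_def by (simp add: mult.assoc[symmetric])
  also have "\<dots> = inverse (expq 1) + fps_X * (expq 1 * inverse (expq 1)) - expq 1 * inverse (expq 1)" by (simp add: algebra_simps)
  also have "expq 1 * inverse (expq 1) = 1" using expq_1_0(1) by (rule inverse_mult_eq_1')
  finally show ?thesis by simp
qed

lemma bern_coeff_inverse: "fps_nth (inverse (expq 1)) half = bern_coeff"
proof -
  have "fps_nth (fps_X * expq_ld) half = fps_nth (inverse (expq 1) + fps_X - 1) half" unfolding expq_ld_inverse ..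
  thus ?thesis using half_ge_2 unfolding bern_coeff_def by simp
qed

text \<open>The sum of the exponentials is \<open>expq p / expq 1\<close>, and \<open>expq p\<close> is \<open>p\<close> modulo \<open>p\<^sup>2\<close>.\<close>

theorem power_sum_mod_p2: "padic 2 ((\<Sum>j = 1..<p. of_nat j ^ half) - of_nat p * fact half * bern_coeff)"
proof -
  let ?S = "\<Sum>j<p. fps_exp 1 ^ j :: rat fps"
  have S: "?S = expq p * inverse (expq 1)"
    using expq_geometric[of p] inverse_mult_eq_1'[OF expq_1_0(1)] by (simp add: mult.assoc)
  have "fpadic 2 (p - 1) (expq p - fps_const (of_nat p))"
    unfolding fpadic_def
  proof (intro allI impI)
    fix i assume i: "i < p - 1"
    show "padic 2 (fps_nth (expq p - fps_const (of_nat p)) i)"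
    proof (cases i)
      case 0
      thus ?thesis by (simp add: expq_0)
    next
      case (Suc j)
      have "padic 2 (of_nat p ^ Suc i)" by (rule padic_mono[OF padic_p_power]) (simp add: Suc)
      hence "padic 2 (of_nat p ^ Suc i / fact (Suc i))" using i by (intro padic_divide_fact) auto
      thus ?thesis using Suc by (simp add: expq_nth del: fact_Suc power_Suc)
    qed
  qed
  hence "fpadic 2 (p - 1) ((expq p - fps_const (of_nat p)) * inverse (expq 1))"
    using fpadic_inverse[OF fpadic_expq expq_1_0(2)] by (rule fpadic_mult0(2))
  hence "padic 2 (fps_nth ((expq p - fps_const (of_nat p)) * inverse (expq 1)) half)" using half_bound unfolding fpadic_def by blast
  also have "(expq p - fps_const (of_nat p)) * inverse (expq 1) = ?S - fps_const (of_nat p) * inverse (expq 1)"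
    unfolding S by (simp add: left_diff_distrib)
  also have "fps_nth (?S - fps_const (of_nat p) * inverse (expq 1)) half = (\<Sum>j<p. of_nat j ^ half / fact half) - of_nat p * bern_coeff"
    by (simp add: fps_sum_nth fps_exp_power_mult bern_coeff_inverse[unfolded One_nat_def] del: of_nat_power)
  also have "(\<Sum>j<p. of_nat j ^ half / fact half) = (\<Sum>j = 1..<p. of_nat j ^ half / fact half :: rat)"
  proof -
    have "{..<p} = insert 0 {1..<p}" using p_ge_5 by auto
    thus ?thesis using half_ge_2 by (simp add: power_0_left)
  qed
  finally have "padic 2 (fact half * ((\<Sum>j = 1..<p. of_nat j ^ half / fact half) - of_nat p * bern_coeff))"
    using padic0_of_int[of "fact half"] by (intro padic_mult0(1)) simp_all
  thus ?thesis by (simp add: right_diff_distrib sum_divide_distrib[symmetric] mult_ac)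
qed

end

section \<open>The cyclotomic relation\<close>

text \<open>Generic in the ring, so that an identity of integer polynomials obtained at complex
  roots of unity can be transported to the power series e^y.\<close>

definition ev :: "'a :: comm_ring_1 \<Rightarrow> int poly \<Rightarrow> 'a" where
  "ev x f = poly (map_poly of_int f) x"

lemma ev_0 [simp]: "ev x 0 = 0"
  unfolding ev_def by simp

lemma ev_pCons [simp]: "ev x (pCons a f) = of_int a + x * ev x f"
  unfolding ev_def by (simp add: map_poly_pCons)

lemma ev_add [simp]: "ev x (f + g) = ev x f + ev x g"
  by (induction f g rule: poly_induct2) (simp_all add: algebra_simps)

lemma ev_smult [simp]: "ev x (Polynomial.smult c f) = of_int c * ev x f"
  by (induction f) (simp_all add: algebra_simps)

lemma ev_minus [simp]: "ev x (- f) = - ev x f"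
  using ev_smult[of x "-1" f] by simp

lemma ev_diff [simp]: "ev x (f - g) = ev x f - ev x g"
  using ev_add[of x f "- g"] by simp

lemma ev_mult [simp]: "ev x (f * g) = ev x f * ev x g"
  by (induction f) (simp_all add: algebra_simps)

lemma ev_1 [simp]: "ev x 1 = 1"
  using ev_pCons[of x 1 0] by (simp add: one_pCons)

lemma ev_power [simp]: "ev x (f ^ n) = ev x f ^ n"
  by (induction n) simp_all

lemma ev_sum: "ev x (\<Sum>i\<in>A. f i) = (\<Sum>i\<in>A. ev x (f i))"
  by (induction A rule: infinite_finite_induct) simp_all

lemma ev_prod: "ev x (\<Prod>i\<in>A. f i) = (\<Prod>i\<in>A. ev x (f i))"
  by (induction A rule: infinite_finite_induct) simp_all

lemma ev_monom [simp]: "ev x (Polynomial.monom c n) = of_int c * x ^ n"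
  by (induction n) (simp_all add: monom_0 monom_Suc mult.left_commute)

text \<open>The quotient of x^a - 1 by x - 1; for a = p it is the p-th cyclotomic
  polynomial.\<close>

definition qint :: "nat \<Rightarrow> int poly" where "qint a = (\<Sum>j<a. Polynomial.monom 1 j)"

lemma ev_qint: "ev x (qint a) = (\<Sum>j<a. x ^ j)"
  unfolding qint_def by (simp add: ev_sum)

lemma monic_division:
  fixes f g :: "int poly"
  assumes "lead_coeff g = 1"
  obtains q r where "f = g * q + r" "r = 0 \<or> degree r < degree g"
proof -
  have g: "g \<noteq> 0" using assms by auto
  obtain q r where qr: "pseudo_divmod f g = (q, r)" by fastforce
  show ?thesis using that pseudo_divmod[OF g qr] assms by simp
qed

text \<open>Division by the monic \<open>qint p\<close> keeps the coefficients integral, and the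
  remainder has p - 1 distinct zeros but degree below p - 1.\<close>

lemma (in quad_prime) cyclotomic_divides:
  fixes f :: "int poly"
  assumes "\<And>w::complex. w ^ p = 1 \<Longrightarrow> w \<noteq> 1 \<Longrightarrow> ev w f = 0"
  obtains q where "f = qint p * q"
proof -
  have "Polynomial.coeff (qint p) j = (if j < p then 1 else 0)" for j
    unfolding qint_def by (simp add: coeff_sum)
  hence cf: "Polynomial.coeff (qint p) = (\<lambda>j. if j < p then 1 else 0)" by blast
  have dg: "degree (qint p) = p - 1"
    by (rule antisym[OF degree_le le_degree]) (use p_ge_5 in \<open>auto simp: cf\<close>)
  have "lead_coeff (qint p) = 1" unfolding dg cf using p_ge_5 by simp
  then obtain q r where qr: "f = qint p * q + r" "r = 0 \<or> degree r < degree (qint p)" by (rule monic_division)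
  define R :: "complex poly" where "R = map_poly of_int r"
  have "R = 0"
  proof (rule ccontr)
    assume R0: "R \<noteq> 0"
    define S where "S = {w::complex. w ^ p = 1}"
    have cS: "card S = p" "finite S" unfolding S_def using p_ge_5 by (simp_all add: card_roots_unity_eq finite_roots_unity)
    have "1 \<in> S" unfolding S_def by simp
    hence "card (S - {1}) = p - 1" using cS by simp
    moreover have "S - {1} \<subseteq> {w. poly R w = 0}"
    proof
      fix w assume "w \<in> S - {1}"
      hence w: "w ^ p = 1" "w \<noteq> 1" unfolding S_def by auto
      have "ev w (qint p) = 0" unfolding ev_qint by (rule root_sum[OF w])
      hence "ev w r = 0" using assms[OF w] unfolding qr(1) by simp
      thus "w \<in> {w. poly R w = 0}" unfolding R_def ev_def by simp
    qed
    moreover have "finite {w. poly R w = 0}" using R0 by (rule poly_roots_finite)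
    ultimately have "p - 1 \<le> card {w. poly R w = 0}" using card_mono by metis
    also have "\<dots> \<le> degree R" using R0 by (rule card_poly_roots_bound)
    also have "\<dots> = degree r" unfolding R_def by (rule degree_map_poly) auto
    finally have "p - 1 \<le> degree r" .
    moreover have "r \<noteq> 0" using R0 unfolding R_def by auto
    ultimately show False using qr(2) dg by simp
  qed
  have "Polynomial.coeff R n = of_int (Polynomial.coeff r n)" for n unfolding R_def by (simp add: coeff_map_poly)
  hence "r = 0" using \<open>R = 0\<close> by (auto simp: poly_eq_iff)
  show ?thesis by (rule that[of q]) (simp add: qr(1) \<open>r = 0\<close>)
qed

section \<open>Products over residues and non-residues\<close>

context quad_prime
begin

definition Res :: "nat set" where "Res = {a \<in> {1..<p}. chi a = 1}"
definition NRes :: "nat set" where "NRes = {a \<in> {1..<p}. chi a = -1}"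

lemma finite_Res [simp]: "finite Res" "finite NRes"
  unfolding Res_def NRes_def by auto

lemma Res_Un: "Res \<union> NRes = {1..<p}" "Res \<inter> NRes = {}"
proof -
  have "chi a \<noteq> 0" if "a \<in> {1..<p}" for a using that chi_eq_0_iff[of a] by (auto dest: dvd_imp_le)
  thus "Res \<union> NRes = {1..<p}" unfolding Res_def NRes_def using chi_cases by blast
qed (auto simp: Res_def NRes_def)

lemma card_Res: "card Res = half" "card NRes = half"
proof -
  have "(\<Sum>a = 1..<p. chi a) = (\<Sum>a\<in>Res. chi a) + (\<Sum>a\<in>NRes. chi a)"
    unfolding Res_Un(1)[symmetric] by (rule sum.union_disjoint) (use Res_Un in auto)
  also have "(\<Sum>a\<in>Res. chi a) = int (card Res)" unfolding Res_def by simp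
  also have "(\<Sum>a\<in>NRes. chi a) = - int (card NRes)" unfolding NRes_def by simp
  finally have "card Res = card NRes" using sum_chi by simp
  moreover have "card Res + card NRes = p - 1"
    using card_Un_disjoint[of Res NRes] Res_Un by simp
  ultimately show "card Res = half" "card NRes = half" unfolding half_def by simp_all
qed

lemma Res_scale:
  assumes "\<not> p dvd n"
  shows "chi n = 1 \<Longrightarrow> bij_betw (\<lambda>a. (a * n) mod p) Res Res"
    "chi n = 1 \<Longrightarrow> bij_betw (\<lambda>a. (a * n) mod p) NRes NRes"
    "chi n = -1 \<Longrightarrow> bij_betw (\<lambda>a. (a * n) mod p) Res NRes"
    "chi n = -1 \<Longrightarrow> bij_betw (\<lambda>a. (a * n) mod p) NRes Res"
proof -
  have inj: "inj_on (\<lambda>a. (a * n) mod p) {1..<p}" and im: "(\<lambda>a. (a * n) mod p) ` {1..<p} = {1..<p}"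
    using mult_mod_bij[OF assms] unfolding bij_betw_def by auto
  have m: "(a * n) mod p \<in> {1..<p}" if "a \<in> {1..<p}" for a using im that by blast
  have gen: "bij_betw (\<lambda>a. (a * n) mod p) S T"
    if "S \<subseteq> {1..<p}" "(\<lambda>a. (a * n) mod p) ` S \<subseteq> T" "finite T" "card S = card T" for S T
  proof -
    have i: "inj_on (\<lambda>a. (a * n) mod p) S" using inj that(1) inj_on_subset by blast
    hence "card ((\<lambda>a. (a * n) mod p) ` S) = card T" using card_image that(4) by metis
    hence "(\<lambda>a. (a * n) mod p) ` S = T" using card_subset_eq[OF that(3,2)] by simp
    thus ?thesis using i unfolding bij_betw_def by simp
  qed
  show "chi n = 1 \<Longrightarrow> bij_betw (\<lambda>a. (a * n) mod p) Res Res"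
    by (rule gen) (use m in \<open>auto simp: Res_def chi_mult\<close>)
  show "chi n = 1 \<Longrightarrow> bij_betw (\<lambda>a. (a * n) mod p) NRes NRes"
    by (rule gen) (use m in \<open>auto simp: NRes_def chi_mult\<close>)
  show "chi n = -1 \<Longrightarrow> bij_betw (\<lambda>a. (a * n) mod p) Res NRes"
    by (rule gen) (use m card_Res in \<open>auto simp: Res_def NRes_def chi_mult\<close>)
  show "chi n = -1 \<Longrightarrow> bij_betw (\<lambda>a. (a * n) mod p) NRes Res"
    by (rule gen) (use m card_Res in \<open>auto simp: Res_def NRes_def chi_mult\<close>)
qed

definition cyc :: "nat set \<Rightarrow> complex \<Rightarrow> complex" where "cyc S w = (\<Prod>a\<in>S. 1 - w ^ a)"

lemma cyc_power:
  assumes w: "w ^ p = 1" and b: "bij_betw (\<lambda>a. (a * n) mod p) S T"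
  shows "cyc S (w ^ n) = cyc T w"
proof -
  have "cyc T w = (\<Prod>a\<in>S. 1 - w ^ ((a * n) mod p))"
    unfolding cyc_def using prod.reindex_bij_betw[OF b, of "\<lambda>a. 1 - w ^ a"] by simp
  also have "\<dots> = cyc S (w ^ n)" unfolding cyc_def root_power_mod[OF w] by (simp add: power_mult[symmetric] mult.commute)
  finally show ?thesis ..
qed

text \<open>Conjugation raises w to the power p - 1, and multiplication by the residue p - 1
  permutes each of the two sets.\<close>

lemma cyc_real:
  assumes w: "w ^ p = 1" and S: "S = Res \<or> S = NRes"
  shows "cnj (cyc S w) = cyc S w"
proof -
  have nd: "\<not> p dvd p - 1" using p_ge_5 by (auto dest: dvd_imp_le)
  have "chi (p - 1) = 1" using chi_p_minus[of 1] p_ge_5 by simp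
  hence b: "bij_betw (\<lambda>a. (a * (p - 1)) mod p) S S" using Res_scale[OF nd] S by blast
  have "cnj (w ^ 1) = w ^ (p - 1)" using w p_ge_5 by (intro root_cnj) auto
  hence "cnj (cyc S w) = cyc S (w ^ (p - 1))" unfolding cyc_def by simp
  thus ?thesis using cyc_power[OF w b] by simp
qed

definition poly_Res :: "int poly" where "poly_Res = (\<Prod>a\<in>Res. qint a)"
definition poly_NRes :: "int poly" where "poly_NRes = (\<Prod>a\<in>NRes. qint a)"
definition poly_Tau :: "int poly" where "poly_Tau = (\<Sum>a = 1..<p. Polynomial.monom (chi a) a)"

lemma ev_Tau: "ev w poly_Tau = (\<Sum>a = 1..<p. of_int (chi a) * w ^ a)"
  unfolding poly_Tau_def by (simp add: ev_sum)

text \<open>Both products contain equally many factors, so the same power of 1 - w splits off. What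
  remains has factors whose value at w = 1 is a, a unit modulo p.\<close>

lemma cyc_eq:
  "cyc Res w = (1 - w) ^ half * ev w poly_Res"
  "cyc NRes w = (1 - w) ^ half * ev w poly_NRes"
proof -
  have *: "1 - w ^ a = (1 - w) * ev w (qint a)" for a
    unfolding ev_qint by (rule one_diff_power_eq)
  show "cyc Res w = (1 - w) ^ half * ev w poly_Res" "cyc NRes w = (1 - w) ^ half * ev w poly_NRes"
    unfolding cyc_def * poly_Res_def poly_NRes_def ev_prod prod.distrib by (simp_all add: card_Res)
qed

end

context quad_unit
begin

abbreviation h :: nat where "h \<equiv> class_number p"

lemma cyc_norms:
  assumes z: "z ^ p = 1" "z \<noteq> 1" "gauss_sum z = of_real (sqrt p)"
  shows "norm (cyc NRes z) = eps ^ (2 * h) * norm (cyc Res z)" "cyc Res z \<noteq> 0"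
proof -
  have ne: "1 - z ^ a \<noteq> 0" if "a \<in> {1..<p}" for a
    using root_power_ne_1[OF z(1,2), of a] that nat_dvd_not_less[of a p] by auto
  have sub: "Res \<subseteq> {1..<p}" "NRes \<subseteq> {1..<p}" unfolding Res_def NRes_def by auto
  show nz: "cyc Res z \<noteq> 0" unfolding cyc_def using ne sub by auto
  have nz': "cyc NRes z \<noteq> 0" unfolding cyc_def using ne sub by auto
  have lnS: "ln (norm (cyc S z)) = (\<Sum>a\<in>S. ln (norm (1 - z ^ a)))" if "S \<subseteq> {1..<p}" for S
    unfolding cyc_def prod_norm[symmetric] using that ne by (intro ln_prod) (auto intro: finite_subset)
  have "real h * (2 * ln eps) = - (\<Sum>a = 1..<p. chi a * ln (norm (1 - z ^ a)))"
    using class_number_formula L1_eq[OF z] unfolding sp_def by simp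
  also have "(\<Sum>a = 1..<p. chi a * ln (norm (1 - z ^ a))) =
      (\<Sum>a\<in>Res. chi a * ln (norm (1 - z ^ a))) + (\<Sum>a\<in>NRes. chi a * ln (norm (1 - z ^ a)))"
    unfolding Res_Un(1)[symmetric] by (rule sum.union_disjoint) (use Res_Un in auto)
  also have "(\<Sum>a\<in>Res. chi a * ln (norm (1 - z ^ a))) = ln (norm (cyc Res z))"
    unfolding lnS[OF sub(1)] by (intro sum.cong) (auto simp: Res_def)
  also have "(\<Sum>a\<in>NRes. chi a * ln (norm (1 - z ^ a))) = - ln (norm (cyc NRes z))"
    unfolding lnS[OF sub(2)] sum_negf[symmetric] by (intro sum.cong) (auto simp: NRes_def)
  finally have "ln (norm (cyc NRes z)) = ln (eps ^ (2 * h)) + ln (norm (cyc Res z))"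
    using eps_gt_1 by (simp add: ln_realpow)
  also have "\<dots> = ln (eps ^ (2 * h) * norm (cyc Res z))" using eps_gt_1 nz by (simp add: ln_mult)
  finally show "norm (cyc NRes z) = eps ^ (2 * h) * norm (cyc Res z)"
    using nz nz' eps_gt_1 by (subst (asm) ln_inj_iff) auto
qed

text \<open>Both sides are compared at all conjugates of \<open>\<zeta>\<close>: a non-residue exponent exchanges the two products
  and replaces \<open>\<epsilon>\<close> by its conjugate \<open>-1/\<epsilon>\<close>, so the same sign \<open>s\<close> works everywhere.\<close>

theorem cyclotomic_relation:
  obtains s :: int and q where "s = 1 \<or> s = -1"
    "Polynomial.smult (4 ^ h) poly_NRes = Polynomial.smult s (([:int t:] + Polynomial.smult (int u) poly_Tau) ^ (2 * h) * poly_Res) + qint p * q"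
proof -
  obtain z where z: "z ^ p = 1" "z \<noteq> 1" "gauss_sum z = of_real (sqrt p)" by (rule root_exists)
  define x where "x = Re (cyc Res z)"
  define y where "y = Re (cyc NRes z)"
  have x: "cyc Res z = of_real x" and y: "cyc NRes z = of_real y"
    using cyc_real[OF z(1)] unfolding x_def y_def by (simp_all add: complex_eq_iff)
  have "\<bar>y\<bar> = eps ^ (2 * h) * \<bar>x\<bar>" using cyc_norms(1)[OF z] unfolding x y by simp
  hence "y = eps ^ (2 * h) * x \<or> y = - (eps ^ (2 * h) * x)" by (auto simp: abs_if split: if_splits)
  then obtain s :: int where s: "s = 1 \<or> s = -1" "y = of_int s * (eps ^ (2 * h) * x)"
    by (metis mult_minus1 mult_1 of_int_1 of_int_minus)
  define f where "f = Polynomial.smult (4 ^ h) poly_NRes - Polynomial.smult s (([:int t:] + Polynomial.smult (int u) poly_Tau) ^ (2 * h) * poly_Res)"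
  have four: "(2::real) ^ (2 * h) = 4 ^ h" by (simp add: power_mult)
  \<comment> \<open>The conjugate relation. The conjugate of 2 eps is - 2 / eps, the even exponent
    removes its sign, and s squares to 1; so x and y exchange roles with the same s.\<close>
  have xs: "x * 4 ^ h = of_int s * ((real t - real u * sp) ^ (2 * h) * y)"
  proof -
    have "(real t - real u * sp) = 2 * cj eps" unfolding cj_eps by simp
    also have "cj eps = - inverse eps" by (rule cj_eps_inverse)
    finally have "(real t - real u * sp) ^ (2 * h) = 4 ^ h * inverse (eps ^ (2 * h))"
      using four by (simp add: power_mult_distrib power_inverse)
    thus ?thesis using s eps_gt_1 by auto
  qed
  have ys: "y * 4 ^ h = of_int s * ((real t + real u * sp) ^ (2 * h) * x)"
  proof -
    have "(real t + real u * sp) = 2 * eps" unfolding eps_def by simp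
    hence "(real t + real u * sp) ^ (2 * h) = 4 ^ h * eps ^ (2 * h)"
      using four by (simp add: power_mult_distrib)
    thus ?thesis using s by auto
  qed
  have root: "ev w f = 0" if w: "w ^ p = 1" "w \<noteq> 1" and r: "gauss_sum w = of_real r"
    "cyc Res w = of_real a" "cyc NRes w = of_real b" "b * 4 ^ h = of_int s * ((real t + real u * r) ^ (2 * h) * a)" for w r a b
  proof -
    have tau: "ev w poly_Tau = of_real r" using r(1) unfolding ev_Tau gauss_sum_def .
    have "(1 - w) ^ half * ev w f = 4 ^ h * cyc NRes w - of_int s * ((of_nat t + of_nat u * of_real r) ^ (2 * h) * cyc Res w)"
      unfolding f_def cyc_eq by (simp add: tau algebra_simps)
    also have "\<dots> = of_real (b * 4 ^ h - of_int s * ((real t + real u * r) ^ (2 * h) * a))"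
      unfolding r(2,3) by simp
    also have "\<dots> = 0" using r(4) by simp
    finally show ?thesis using w(2) by simp
  qed
  have "ev w f = 0" if w: "w ^ p = 1" "w \<noteq> 1" for w :: complex
  proof -
    \<comment> \<open>The p powers of z are distinct, so they exhaust the p-th roots of
      unity.\<close>
    have "\<exists>n. w = z ^ n"
    proof -
      have "inj_on (\<lambda>n. z ^ n) {..<p}"
      proof (rule linorder_inj_onI)
        fix i j assume ij: "i < j" "i \<in> {..<p}" "j \<in> {..<p}"
        show "z ^ i \<noteq> z ^ j"
        proof
          assume e: "z ^ i = z ^ j"
          have "z ^ j = z ^ i * z ^ (j - i)" using ij by (simp add: power_add[symmetric])
          hence "z ^ i * z ^ (j - i) = z ^ i * 1" using e by simp
          moreover have "z ^ i \<noteq> 0" using root_norm[OF z(1)] by auto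
          ultimately have "z ^ (j - i) = 1" by (metis mult_left_cancel)
          moreover have "\<not> p dvd j - i" using ij by (auto dest: dvd_imp_le)
          ultimately show False using root_power_ne_1[OF z(1,2)] by blast
        qed
      qed auto
      hence "card ((\<lambda>n. z ^ n) ` {..<p}) = p" by (simp add: card_image)
      moreover have "(\<lambda>n. z ^ n) ` {..<p} \<subseteq> {w. w ^ p = 1}"
        using z(1) by (auto simp: power_mult[symmetric] mult.commute[of _ p]) (simp add: power_mult)
      moreover have "card {w::complex. w ^ p = 1} = p" "finite {w::complex. w ^ p = 1}"
        using p_ge_5 by (simp_all add: card_roots_unity_eq finite_roots_unity)
      ultimately have "(\<lambda>n. z ^ n) ` {..<p} = {w. w ^ p = 1}" using card_subset_eq by metis
      thus ?thesis using w(1) by blast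
    qed
    then obtain n where n: "w = z ^ n" by blast
    have nd: "\<not> p dvd n"
    proof
      assume "p dvd n"
      hence "w = 1" unfolding n using z(1) by (auto simp: power_mult elim!: dvdE)
      thus False using w(2) by simp
    qed
    have g: "gauss_sum w = of_int (chi n) * of_real sp" unfolding n gauss_sum_power[OF z(1,2)] z(3) sp_def ..
    have "chi n = 1 \<or> chi n = -1" using chi_cases[of n] chi_eq_0_iff[of n] nd by auto
    thus ?thesis
    proof
      assume c: "chi n = 1"
      have "cyc Res w = of_real x" "cyc NRes w = of_real y" unfolding n
        using cyc_power[OF z(1) Res_scale(1)[OF nd c]] cyc_power[OF z(1) Res_scale(2)[OF nd c]] x y by simp_all
      thus ?thesis using root[OF w _ _ _ ys] g c by simp
    next
      assume c: "chi n = -1"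
      have "cyc Res w = of_real y" "cyc NRes w = of_real x" unfolding n
        using cyc_power[OF z(1) Res_scale(3)[OF nd c]] cyc_power[OF z(1) Res_scale(4)[OF nd c]] x y by simp_all
      moreover have "x * 4 ^ h = of_int s * ((real t + real u * (- sp)) ^ (2 * h) * y)" using xs by simp
      ultimately show ?thesis using root[OF w, of "- sp" y x] g c by simp
    qed
  qed
  then obtain q where "f = qint p * q" by (rule cyclotomic_divides)
  hence "Polynomial.smult (4 ^ h) poly_NRes = Polynomial.smult s (([:int t:] + Polynomial.smult (int u) poly_Tau) ^ (2 * h) * poly_Res) + qint p * q"
    unfolding f_def by (simp add: algebra_simps)
  thus ?thesis using that s(1) by blast
qed

end

section \<open>Comparison of logarithmic derivatives\<close>

lemma fps_log_deriv_prod: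
  fixes f :: "'b \<Rightarrow> 'a :: field fps"
  assumes "finite S" "\<And>a. a \<in> S \<Longrightarrow> fps_nth (f a) 0 \<noteq> 0"
  shows "fps_deriv (\<Prod>a\<in>S. f a) = (\<Prod>a\<in>S. f a) * (\<Sum>a\<in>S. fps_deriv (f a) * inverse (f a))"
  using assms
proof (induction S rule: finite_induct)
  case (insert a S)
  have i: "f a * inverse (f a) = 1" using insert.prems[of a] by (intro inverse_mult_eq_1') simp
  let ?P = "\<Prod>a\<in>S. f a" and ?T = "\<Sum>a\<in>S. fps_deriv (f a) * inverse (f a)"
  have "fps_deriv (f a * ?P) = f a * (?P * ?T) + fps_deriv (f a) * ?P"
    using insert by simp
  also have "fps_deriv (f a) * ?P = (f a * inverse (f a)) * (fps_deriv (f a) * ?P)" unfolding i by simp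
  finally have "fps_deriv (f a * ?P) = (f a * ?P) * (fps_deriv (f a) * inverse (f a) + ?T)" by (simp add: algebra_simps)
  thus ?case using insert.hyps by simp
qed simp

context quad_prime
begin

text \<open>Euler's criterion turns a twisted power sum into an ordinary one with exponent shifted
  by \<open>half\<close>. Such sums vanish modulo p until the exponent p - 1 is reached, that is
  until k = \<open>half\<close>.\<close>

lemma chi_power_sum_cong:
  "[(\<Sum>a = 1..<p. chi a * int a ^ k) = (\<Sum>a = 1..<p. int a ^ (half + k))] (mod int p)"
  unfolding power_add by (intro cong_sum cong_mult chi_cong) auto

lemma chi_power_sum_low:
  assumes "k < half"
  shows "int p dvd (\<Sum>a = 1..<p. chi a * int a ^ k)"
proof -
  have "[(\<Sum>a = 1..<p. int a ^ (half + k)) = 0] (mod int p)"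
    using assms p_eq_half half_ge_2 by (intro power_sum_cong_0) auto
  from cong_trans[OF chi_power_sum_cong this] show ?thesis by (simp add: cong_0_iff)
qed

lemma chi_power_sum_half: "int p dvd (\<Sum>a = 1..<p. chi a * int a ^ half) + 1"
proof -
  have sq: "[chi a * int a ^ half = 1] (mod int p)" if "a \<in> {1..<p}" for a
  proof -
    have "[chi a * int a ^ half = chi a * chi a] (mod int p)" by (intro cong_mult cong_sym[OF chi_cong]) auto
    moreover have "chi a * chi a = 1" using that chi_cases[of a] chi_eq_0_iff[of a] by (auto dest: dvd_imp_le)
    ultimately show ?thesis by simp
  qed
  have "[(\<Sum>a = 1..<p. chi a * int a ^ half) = (\<Sum>a = 1..<p. 1)] (mod int p)"
    by (intro cong_sum sq)
  hence "[(\<Sum>a = 1..<p. chi a * int a ^ half) + 1 = (\<Sum>a = 1..<p. 1) + 1] (mod int p)" by (intro cong_add) auto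
  also have "(\<Sum>a = 1..<p. 1) + 1 = int p" using p_ge_5 by (simp add: of_nat_diff)
  finally show ?thesis by (simp add: cong_dvd_iff)
qed

abbreviation ex :: "rat fps" where "ex \<equiv> fps_exp 1"

lemma fpadic_ev: "fpadic 0 p (ev ex f)"
proof (induction f)
  case (pCons a f)
  have "fpadic 0 p (fps_const (of_int a))" by (rule fpadic_const) simp
  thus ?case using pCons.IH fpadic_exp[of 1] by (auto intro!: fpadic_add fpadic_mult0(1) simp: fps_of_int)
qed (simp add: fpadic_def)

text \<open>The coefficients are power sums divided by k!, and p divides them for 0 < k < p - 1; the
  constant term is p itself.\<close>

lemma fpadic_ev_Phi: "fpadic 1 (p - 1) (ev ex (qint p))"
  unfolding fpadic_def
proof (intro allI impI)
  fix k assume k: "k < p - 1"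
  have c: "fps_nth (ev ex (qint p)) k = of_int (\<Sum>j<p. int j ^ k) / fact k"
    unfolding ev_qint by (simp add: fps_sum_nth fps_exp_power_mult sum_divide_distrib)
  have s: "{..<p} = insert 0 {1..<p}" using p_ge_5 by auto
  have "int p dvd (\<Sum>j<p. int j ^ k)"
  proof (cases "k = 0")
    case False
    thus ?thesis using power_sum_cong_0[of k] k unfolding s by (simp add: cong_0_iff power_0_left)
  qed simp
  thus "padic 1 (fps_nth (ev ex (qint p)) k)" unfolding c using k by (intro padic_divide_fact padic_of_int) auto
qed

definition Rf :: "rat fps" where "Rf = (\<Prod>a\<in>Res. expq a)"
definition Nf :: "rat fps" where "Nf = (\<Prod>a\<in>NRes. expq a)"

text \<open>Multiplying by \<open>expq 1 ^ half\<close> turns the factors from \<open>qint a\<close>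
  into \<open>expq a\<close>, whose logarithmic derivatives are known.\<close>

lemma Rf_ev: "Rf = ev ex poly_Res * expq 1 ^ half" and Nf_ev: "Nf = ev ex poly_NRes * expq 1 ^ half"
proof -
  have *: "expq a = ev ex (qint a) * expq 1" for a unfolding ev_qint by (rule expq_geometric)
  show "Rf = ev ex poly_Res * expq 1 ^ half" "Nf = ev ex poly_NRes * expq 1 ^ half"
    unfolding Rf_def Nf_def poly_Res_def poly_NRes_def ev_prod
    by (subst *, simp add: prod.distrib card_Res)+
qed

definition A0 :: int where "A0 = (\<Prod>a\<in>Res. int a)"
definition B0 :: int where "B0 = (\<Prod>a\<in>NRes. int a)"

lemma Rf_0: "fps_nth Rf 0 = of_int A0"
proof -
  have "fps_nth (\<Prod>a\<in>S. expq a) 0 = of_int (\<Prod>a\<in>S. int a)" for S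
    by (induction S rule: infinite_finite_induct) (simp_all add: expq_0)
  thus ?thesis unfolding Rf_def A0_def .
qed

lemma A0_not_dvd: "\<not> int p dvd A0"
proof
  assume "int p dvd A0"
  then obtain a where "a \<in> Res" "int p dvd int a" unfolding A0_def using prime_p
    by (subst (asm) prime_dvd_prod_iff) auto
  thus False unfolding Res_def by (auto dest: dvd_imp_le)
qed

lemma fpadic_Rf: "fpadic 0 (p - 1) Rf"
  unfolding Rf_def by (intro fpadic0_prod fpadic_expq)

definition LN :: "rat fps" where "LN = (\<Sum>a\<in>NRes. fps_deriv (expq a) * inverse (expq a))"
definition LR :: "rat fps" where "LR = (\<Sum>a\<in>Res. fps_deriv (expq a) * inverse (expq a))"

lemma deriv_Rf: "fps_deriv Rf = Rf * LR" and deriv_Nf: "fps_deriv Nf = Nf * LN"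
  unfolding Rf_def Nf_def LR_def LN_def
  by (rule fps_log_deriv_prod, auto simp: expq_0 Res_def NRes_def)+

lemma LN_nth: "fps_nth LN k = of_int (\<Sum>a\<in>NRes. int a ^ Suc k) * fps_nth expq_ld k"
  and LR_nth: "fps_nth LR k = of_int (\<Sum>a\<in>Res. int a ^ Suc k) * fps_nth expq_ld k"
proof -
  have *: "fps_nth (\<Sum>a\<in>S. fps_deriv (expq a) * inverse (expq a)) k = of_int (\<Sum>a\<in>S. int a ^ Suc k) * fps_nth expq_ld k"
    if "S \<subseteq> {1..<p}" for S
  proof -
    have "(\<Sum>a\<in>S. fps_deriv (expq a) * inverse (expq a)) = (\<Sum>a\<in>S. Abs_fps (\<lambda>k. of_nat a ^ Suc k * fps_nth expq_ld k))"
      using that by (intro sum.cong refl expq_log_deriv) auto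
    thus ?thesis by (simp add: fps_sum_nth sum_distrib_right del: power_Suc)
  qed
  show "fps_nth LN k = of_int (\<Sum>a\<in>NRes. int a ^ Suc k) * fps_nth expq_ld k"
    "fps_nth LR k = of_int (\<Sum>a\<in>Res. int a ^ Suc k) * fps_nth expq_ld k"
    unfolding LN_def LR_def by (rule *, force simp: Res_def NRes_def)+
qed

lemma LW_nth: "fps_nth (LN - LR) k = - of_int (\<Sum>a = 1..<p. chi a * int a ^ Suc k) * fps_nth expq_ld k"
proof -
  have "(\<Sum>a = 1..<p. chi a * int a ^ Suc k) = (\<Sum>a\<in>Res. chi a * int a ^ Suc k) + (\<Sum>a\<in>NRes. chi a * int a ^ Suc k)"
    unfolding Res_Un(1)[symmetric] by (rule sum.union_disjoint) (use Res_Un in auto)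
  also have "(\<Sum>a\<in>Res. chi a * int a ^ Suc k) = (\<Sum>a\<in>Res. int a ^ Suc k)"
    by (intro sum.cong) (auto simp: Res_def)
  also have "(\<Sum>a\<in>NRes. chi a * int a ^ Suc k) = - (\<Sum>a\<in>NRes. int a ^ Suc k)"
    unfolding sum_negf[symmetric] by (intro sum.cong) (auto simp: NRes_def)
  finally have "(\<Sum>a = 1..<p. chi a * int a ^ Suc k) = (\<Sum>a\<in>Res. int a ^ Suc k) - (\<Sum>a\<in>NRes. int a ^ Suc k)" by simp
  thus ?thesis by (simp only: fps_sub_nth LN_nth LR_nth of_int_diff) (simp add: algebra_simps)
qed

lemma fpadic_LN: "fpadic 0 (p - 2) LN" and fpadic_LR: "fpadic 0 (p - 2) LR"
  using fpadic_expq_ld unfolding fpadic_def LN_nth LR_nth by (auto intro!: padic_mult0(1) simp del: of_int_sum)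

text \<open>Only the twisted sum of exponent \<open>half\<close> enters, and it is -1 modulo
  p.\<close>

lemma LW_half: "padic 1 (fps_nth (LN - LR) (half - 1) - bern_coeff)"
proof -
  have "Suc (half - 1) = half" using half_ge_2 by simp
  hence "fps_nth (LN - LR) (half - 1) - bern_coeff = - (of_int ((\<Sum>a = 1..<p. chi a * int a ^ half) + 1) * bern_coeff)"
    unfolding LW_nth bern_coeff_def by (simp add: algebra_simps)
  moreover have "padic 1 (of_int ((\<Sum>a = 1..<p. chi a * int a ^ half) + 1))"
    using chi_power_sum_half by (intro padic_of_int) simp
  ultimately show ?thesis using padic_minus padic_mult0(2) padic_bern_coeff by metis
qed

text \<open>\<open>tame f \<alpha> \<beta>\<close> says that \<open>f\<close> is \<open>\<alpha> + \<beta> y\<^bsup>half\<^esup>\<close> modulo \<open>p\<close> and modulo \<open>y\<^bsup>half + 1\<^esup>\<close>.\<close>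

definition tame :: "rat fps \<Rightarrow> rat \<Rightarrow> rat \<Rightarrow> bool" where
  "tame f \<alpha> \<beta> \<longleftrightarrow> fpadic 0 (p - 1) f \<and> padic 0 \<alpha> \<and> padic 0 \<beta> \<and> padic 1 (fps_nth f 0 - \<alpha>) \<and>
    (\<forall>k. 0 < k \<and> k < half \<longrightarrow> padic 1 (fps_nth f k)) \<and> padic 1 (fps_nth f half - \<beta>)"

lemma padic_cong_mult:
  assumes "padic 1 (x - x')" "padic 1 (y - y')" "padic 0 x'" "padic 0 y"
  shows "padic 1 (x * y - x' * y')"
proof -
  have "x * y - x' * y' = (x - x') * y + x' * (y - y')" by (simp add: algebra_simps)
  thus ?thesis using padic_add[OF padic_mult0(2)[OF assms(1,4)] padic_mult0(1)[OF assms(3,2)]] by simp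
qed

lemma fps_mult_nth_split:
  fixes f g :: "rat fps"
  assumes "k > 0"
  shows "fps_nth (f * g) k = fps_nth f 0 * fps_nth g k + fps_nth f k * fps_nth g 0
     + (\<Sum>i = 1..<k. fps_nth f i * fps_nth g (k - i))"
proof -
  have "{0..k} = insert 0 (insert k {1..<k})" using assms by auto
  thus ?thesis unfolding fps_mult_nth using assms by simp
qed

lemma tame_mult:
  assumes f: "tame f \<alpha> \<beta>" and g: "tame g \<gamma> \<delta>"
  shows "tame (f * g) (\<alpha> * \<gamma>) (\<alpha> * \<delta> + \<beta> * \<gamma>)"
proof -
  have I: "padic 0 (fps_nth f k)" "padic 0 (fps_nth g k)" if "k \<le> half" for k
    using f g that half_bound unfolding tame_def fpadic_def by auto
  have low: "padic 1 (fps_nth f k)" "padic 1 (fps_nth g k)" if "0 < k" "k < half" for k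
    using f g that unfolding tame_def by auto
  have c: "padic 0 \<alpha>" "padic 0 \<beta>" "padic 0 \<gamma>" "padic 0 \<delta>" using f g unfolding tame_def by auto
  have e: "padic 1 (fps_nth f 0 - \<alpha>)" "padic 1 (fps_nth f half - \<beta>)" "padic 1 (fps_nth g 0 - \<gamma>)" "padic 1 (fps_nth g half - \<delta>)"
    using f g unfolding tame_def by auto
  have mid: "padic 1 (\<Sum>i = 1..<k. fps_nth f i * fps_nth g (k - i))" if "k \<le> half" for k
    using that low I by (intro padic_sum padic_mult0(2)) auto
  show ?thesis
    unfolding tame_def
  proof (intro conjI allI impI)
    show "fpadic 0 (p - 1) (f * g)" using f g unfolding tame_def by (intro fpadic_mult0) auto
    show "padic 0 (\<alpha> * \<gamma>)" "padic 0 (\<alpha> * \<delta> + \<beta> * \<gamma>)" using c by (auto intro!: padic_add padic_mult0)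
    show "padic 1 (fps_nth (f * g) 0 - \<alpha> * \<gamma>)" using padic_cong_mult[OF e(1) e(3)] c I by simp
    fix k assume k: "0 < k \<and> k < half"
    hence "padic 1 (fps_nth f 0 * fps_nth g k)" "padic 1 (fps_nth f k * fps_nth g 0)"
      using padic_mult0(1)[OF I(1)[of 0] low(2)[of k]] padic_mult0(2)[OF low(1)[of k] I(2)[of 0]] by auto
    thus "padic 1 (fps_nth (f * g) k)" unfolding fps_mult_nth_split[OF conjunct1[OF k]] using mid k by (auto intro!: padic_add)
  next
    have h0: "half > 0" using half_ge_2 by simp
    have "padic 1 (fps_nth f 0 * fps_nth g half - \<alpha> * \<delta>)" using padic_cong_mult[OF e(1) e(4)] c I by simp
    moreover have "padic 1 (fps_nth f half * fps_nth g 0 - \<beta> * \<gamma>)" using padic_cong_mult[OF e(2) e(3)] c I by simp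
    ultimately have "padic 1 ((fps_nth f 0 * fps_nth g half - \<alpha> * \<delta>) + (fps_nth f half * fps_nth g 0 - \<beta> * \<gamma>)
       + (\<Sum>i = 1..<half. fps_nth f i * fps_nth g (half - i)))" using mid by (intro padic_add) auto
    thus "padic 1 (fps_nth (f * g) half - (\<alpha> * \<delta> + \<beta> * \<gamma>))"
      unfolding fps_mult_nth_split[OF h0] by (simp add: algebra_simps)
  qed
qed

lemma tame_power:
  assumes "tame f \<alpha> \<beta>"
  shows "tame (f ^ n) (\<alpha> ^ n) (of_nat n * \<alpha> ^ (n - 1) * \<beta>)"
proof (induction n)
  case 0
  thus ?case using half_ge_2 unfolding tame_def by simp
next
  case (Suc n)
  have "\<alpha> * (of_nat n * \<alpha> ^ (n - 1) * \<beta>) + \<beta> * \<alpha> ^ n = of_nat (Suc n) * \<alpha> ^ (Suc n - 1) * \<beta>"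
    by (cases n) (simp_all add: algebra_simps)
  thus ?case using tame_mult[OF assms Suc] by simp
qed

text \<open>Modulo p the Gauss sum at e^y has no terms below degree \<open>half\<close>, where its
  coefficient is - 1 / half!.\<close>

lemma tame_Tau: "tame (fps_const (of_nat t) + fps_const (of_nat u) * ev ex poly_Tau) (of_nat t) (- of_nat u / fact half)"
proof -
  let ?T = "ev ex poly_Tau"
  have T: "fps_nth ?T k = of_int (\<Sum>a = 1..<p. chi a * int a ^ k) / fact k" for k
  proof -
    have "?T = (\<Sum>a = 1..<p. fps_const (of_int (chi a)) * fps_exp (of_nat a))"
      unfolding ev_Tau by (simp add: fps_exp_power_mult fps_of_int)
    thus ?thesis by (simp add: fps_sum_nth sum_divide_distrib)
  qed
  have low: "padic 1 (fps_nth ?T k)" if "k < half" for k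
    unfolding T using chi_power_sum_low[OF that] that half_bound by (intro padic_divide_fact padic_of_int) auto
  have "fps_nth ?T half + 1 / fact half = of_int ((\<Sum>a = 1..<p. chi a * int a ^ half) + 1) / fact half"
    unfolding T by (simp add: add_divide_distrib)
  moreover have "padic 1 (of_int ((\<Sum>a = 1..<p. chi a * int a ^ half) + 1) / fact half)"
    using chi_power_sum_half half_bound by (intro padic_divide_fact padic_of_int) auto
  ultimately have mid: "padic 1 (of_nat u * (fps_nth ?T half + 1 / fact half))" by (intro padic_mult0(1)) auto
  show ?thesis
    unfolding tame_def
  proof (intro conjI allI impI)
    show "fpadic 0 (p - 1) (fps_const (of_nat t) + fps_const (of_nat u) * ?T)"
      using fpadic_mono[OF fpadic_ev] by (intro fpadic_add fpadic_mult0(1) fpadic_const) auto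
    show "padic 0 (- of_nat u / fact half)" using half_bound padic_minus[OF padic0_of_nat[of u]] by (intro padic_divide_fact) auto
    show "padic 1 (fps_nth (fps_const (of_nat t) + fps_const (of_nat u) * ?T) 0 - of_nat t)"
      using low[of 0] half_ge_2 padic_mult0(1)[OF padic0_of_nat[of u]] by simp
    show "padic 1 (fps_nth (fps_const (of_nat t) + fps_const (of_nat u) * ?T) k)" if "0 < k \<and> k < half" for k
      using low[of k] that padic_mult0(1)[OF padic0_of_nat[of u]] by simp
    show "padic 1 (fps_nth (fps_const (of_nat t) + fps_const (of_nat u) * ?T) half - - of_nat u / fact half)"
      using mid half_ge_2 by (simp add: algebra_simps)
  qed simp
qed

end

context quad_unit
begin

lemma t_not_dvd: "\<not> int p dvd int t"
proof
  assume "int p dvd int t"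
  have "real_of_int (int t * int t - int p * int u * int u) = real_of_int (-4)" using pell by simp
  hence e: "int t * int t - int p * int u * int u = -4" by (simp only: of_int_eq_iff)
  have "int p dvd int t * int t - int p * int u * int u" using \<open>int p dvd int t\<close> by (intro dvd_diff) auto
  hence "int p dvd 4" unfolding e by simp
  thus False using p_ge_5 by (auto dest: zdvd_imp_le)
qed

text \<open>The relation at e^y reads C Nf = F Rf modulo p, whence F (LN - LR) = F' modulo p. The
  coefficient of y^(half - 1) involves only the two terms of F kept by \<open>tame\<close>; the
  powers of t then cancel.\<close>

theorem log_deriv_congruence: "padic 1 (of_nat t * fact half * bern_coeff - of_nat h * of_nat u)"
proof -
  obtain s :: int and q where s: "s = 1 \<or> s = -1" and rel:
    "Polynomial.smult (4 ^ h) poly_NRes = Polynomial.smult s (([:int t:] + Polynomial.smult (int u) poly_Tau) ^ (2 * h) * poly_Res) + qint p * q"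
    by (rule cyclotomic_relation)
  define H where "H = fps_const (of_nat t) + fps_const (of_nat u) * ev ex poly_Tau"
  define F where "F = fps_const (of_int s) * H ^ (2 * h)"
  define C :: "rat fps" where "C = fps_const (of_int (4 ^ h))"
  define G where "G = C * Nf - F * Rf"
  have e1: "ev ex (Polynomial.smult (4 ^ h) poly_NRes) = C * ev ex poly_NRes"
    unfolding C_def ev_smult fps_of_int ..
  have e2: "ev ex (Polynomial.smult s (([:int t:] + Polynomial.smult (int u) poly_Tau) ^ (2 * h) * poly_Res) + qint p * q)
      = F * ev ex poly_Res + ev ex (qint p) * ev ex q"
    unfolding F_def H_def by (simp add: fps_of_int fps_of_nat mult.assoc)
  have e: "C * ev ex poly_NRes = F * ev ex poly_Res + ev ex (qint p) * ev ex q"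
    unfolding e1[symmetric] rel e2 ..
  have "C * Nf = (C * ev ex poly_NRes) * expq 1 ^ half" unfolding Nf_ev by (simp add: mult.assoc)
  also have "\<dots> = F * Rf + (ev ex (qint p) * ev ex q) * expq 1 ^ half"
    unfolding e Rf_ev by (simp only: distrib_right mult.assoc)
  finally have "G = (ev ex (qint p) * ev ex q) * expq 1 ^ half" unfolding G_def by simp
  hence G: "fpadic 1 (p - 1) G"
    using fpadic_ev_Phi fpadic_mono[OF fpadic_ev] fpadic_expq by (auto intro!: fpadic_mult0(2) fpadic0_power)
  have G': "fpadic 1 (p - 2) (fps_deriv G)"
    using G p_ge_5 by (intro fpadic_deriv) (simp add: Suc_diff_Suc numeral_2_eq_2)
  have tH: "tame (H ^ (2 * h)) (of_nat t ^ (2 * h)) (of_nat (2 * h) * of_nat t ^ (2 * h - 1) * (- of_nat u / fact half))"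
    unfolding H_def by (rule tame_power[OF tame_Tau])
  \<comment> \<open>Differentiate C Nf = F Rf + G and insert the logarithmic derivatives. The
    right-hand side vanishes modulo p, and \<open>Rf\<close> can be cancelled because its constant
    term is a unit.\<close>
  have "Rf * (F * (LN - LR) - fps_deriv F) = fps_deriv G - G * LN"
  proof -
    have "C * Nf = F * Rf + G" unfolding G_def by simp
    moreover have "fps_deriv (C * Nf) = C * Nf * LN" unfolding C_def by (simp add: deriv_Nf mult.assoc)
    ultimately have "(F * Rf + G) * LN = F * (Rf * LR) + fps_deriv F * Rf + fps_deriv G"
      by (simp add: deriv_Rf)
    thus ?thesis by (simp add: algebra_simps)
  qed
  moreover have "fpadic 1 (p - 2) (fps_deriv G - G * LN)"
    using G' fpadic_mono[OF G] fpadic_LN by (intro fpadic_diff fpadic_mult0(2)) auto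
  ultimately have "fpadic 1 (p - 2) (Rf * (F * (LN - LR) - fps_deriv F))" by simp
  moreover have "fpadic 0 (p - 2) Rf" by (rule fpadic_mono[OF fpadic_Rf]) simp
  moreover have "\<not> padic 1 (fps_nth Rf 0)" unfolding Rf_0 padic_of_int_iff using A0_not_dvd by simp
  ultimately have "fpadic 1 (p - 2) (F * (LN - LR) - fps_deriv F)" by (rule fpadic_cancel)
  hence "padic 1 (fps_nth (F * (LN - LR) - fps_deriv F) (half - 1))" using half_bound unfolding fpadic_def by blast
  hence *: "padic 1 (of_int s * fps_nth (F * (LN - LR) - fps_deriv F) (half - 1))" by (intro padic_mult0(1)) auto
  have s2: "of_int s * (of_int s :: rat) = 1" using s by auto
  have "fps_const (of_int s) * F = H ^ (2 * h)" unfolding F_def using s2 by (simp add: mult.assoc[symmetric])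
  hence "fps_const (of_int s) * (F * (LN - LR) - fps_deriv F) = H ^ (2 * h) * (LN - LR) - fps_deriv (H ^ (2 * h))"
    by (metis (no_types, lifting) fps_deriv_mult_const_left mult.assoc right_diff_distrib)
  hence "padic 1 (fps_nth (H ^ (2 * h) * (LN - LR) - fps_deriv (H ^ (2 * h))) (half - 1))"
    using * by (metis fps_mult_left_const_nth)
  moreover have "fps_nth (fps_deriv (H ^ (2 * h))) (half - 1) = of_nat half * fps_nth (H ^ (2 * h)) half"
    using half_ge_2 by simp
  moreover have "fps_nth (H ^ (2 * h) * (LN - LR)) (half - 1) = fps_nth (H ^ (2 * h)) 0 * fps_nth (LN - LR) (half - 1)
      + (\<Sum>i = 1..half - 1. fps_nth (H ^ (2 * h)) i * fps_nth (LN - LR) (half - 1 - i))"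
    unfolding fps_mult_nth by (subst sum.atLeast_Suc_atMost) auto
  ultimately have 1: "padic 1 (fps_nth (H ^ (2 * h)) 0 * fps_nth (LN - LR) (half - 1)
      + (\<Sum>i = 1..half - 1. fps_nth (H ^ (2 * h)) i * fps_nth (LN - LR) (half - 1 - i)) - of_nat half * fps_nth (H ^ (2 * h)) half)"
    by simp
  have W: "padic 0 (fps_nth (LN - LR) i)" if "i < half" for i
  proof -
    have "fpadic 0 (p - 2) (LN - LR)" by (rule fpadic_diff[OF fpadic_LN fpadic_LR])
    moreover have "i < p - 2" using that half_bound by linarith
    ultimately show ?thesis unfolding fpadic_def by blast
  qed
  have 2: "padic 1 (\<Sum>i = 1..half - 1. fps_nth (H ^ (2 * h)) i * fps_nth (LN - LR) (half - 1 - i))"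
    using tH W half_ge_2 unfolding tame_def by (intro padic_sum padic_mult0(2)) auto
  have 3: "padic 1 (fps_nth (H ^ (2 * h)) 0 * fps_nth (LN - LR) (half - 1) - of_nat t ^ (2 * h) * bern_coeff)"
    using tH LW_half W half_ge_2 unfolding tame_def by (intro padic_cong_mult) auto
  have 4: "padic 1 (of_nat half * (fps_nth (H ^ (2 * h)) half - of_nat (2 * h) * of_nat t ^ (2 * h - 1) * (- of_nat u / fact half)))"
    using tH unfolding tame_def by (intro padic_mult0(1)) auto
  have "padic 1 (of_nat t ^ (2 * h) * bern_coeff - of_nat half * (of_nat (2 * h) * of_nat t ^ (2 * h - 1) * (- of_nat u / fact half)))"
    using padic_add[OF padic_diff[OF padic_diff[OF 1 2] 3] 4] by (simp add: algebra_simps)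
  moreover have "padic 0 (of_nat t * fact half)" using padic0_of_nat[of "t * fact half"] by simp
  ultimately have "padic 1 ((of_nat t * fact half) * (of_nat t ^ (2 * h) * bern_coeff - of_nat half * (of_nat (2 * h) * of_nat t ^ (2 * h - 1) * (- of_nat u / fact half))))"
    by (intro padic_mult0(1)[of "of_nat t * fact half"])
  also have "(of_nat t * fact half) * (of_nat t ^ (2 * h) * bern_coeff - of_nat half * (of_nat (2 * h) * of_nat t ^ (2 * h - 1) * (- of_nat u / fact half)))
     = of_int (int t ^ (2 * h)) * (of_nat t * fact half * bern_coeff + of_nat (2 * half) * of_nat h * of_nat u)"
    \<comment> \<open>The case h = 0 is split off because 2 h - 1 is then a truncated
      difference.\<close>
    by (cases h) (simp_all add: field_simps)
  finally have "padic 1 (of_nat t * fact half * bern_coeff + of_nat (2 * half) * of_nat h * of_nat u)"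
  proof (rule padic_cancel_int)
    show "\<not> int p dvd int t ^ (2 * h)"
      using t_not_dvd prime_p prime_dvd_power[of "int p" "int t" "2 * h"] by auto
  qed
  \<comment> \<open>Subtracting this multiple of p replaces the coefficient 2 half = p - 1 by
    -1.\<close>
  moreover have "padic 1 (of_nat p * (of_nat h * of_nat u))" using padic_mult0(2)[OF padic_p(1) padic0_of_nat[of "h * u"]] by (simp only: of_nat_mult)
  ultimately have "padic 1 (of_nat t * fact half * bern_coeff + of_nat (2 * half) * of_nat h * of_nat u - of_nat p * (of_nat h * of_nat u))"
    by (rule padic_diff)
  moreover have "(of_nat p :: rat) = of_nat (2 * half) + 1" using arg_cong[OF p_eq_half, of "of_nat :: nat \<Rightarrow> rat"] by simp
  ultimately show ?thesis by (simp add: algebra_simps)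
qed

end

section \<open>Products of residues and non-residues\<close>

context quad_prime
begin

lemma A0_B0_fact: "A0 * B0 = fact (p - 1)"
proof -
  have "A0 * B0 = (\<Prod>a\<in>Res \<union> NRes. int a)"
    unfolding A0_def B0_def using Res_Un(2) by (intro prod.union_disjoint[symmetric]) auto
  also have "\<dots> = int (\<Prod>{1..p - 1})"
  proof -
    have "{1..<p} = {1..p - 1}" using p_ge_5 by auto
    thus ?thesis unfolding Res_Un(1) by simp
  qed
  also have "\<dots> = fact (p - 1)" by (simp add: fact_prod)
  finally show ?thesis .
qed

lemma squares_bij: "bij_betw (\<lambda>j. j\<^sup>2 mod p) {1..half} Res"
proof -
  have nd: "\<not> p dvd j" if "j \<in> {1..half}" for j using that p_eq_half by (auto dest: dvd_imp_le)
  have inj: "inj_on (\<lambda>j. j\<^sup>2 mod p) {1..half}"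
  proof (rule inj_onI)
    fix i j assume ij: "i \<in> {1..half}" "j \<in> {1..half}" "i\<^sup>2 mod p = j\<^sup>2 mod p"
    have "[int (i\<^sup>2) = int (j\<^sup>2)] (mod int p)" using ij(3) unfolding cong_int_iff by (simp add: Cong.cong_def)
    hence "int p dvd int (i\<^sup>2) - int (j\<^sup>2)" by (simp only: cong_iff_dvd_diff)
    also have "int (i\<^sup>2) - int (j\<^sup>2) = (int i - int j) * int (i + j)" by (simp add: power2_eq_square algebra_simps)
    finally have "int p dvd int i - int j \<or> int p dvd int (i + j)"
      using prime_p prime_dvd_mult_iff[of "int p"] by simp
    hence "int p dvd int i - int j \<or> p dvd i + j" by (simp only: int_dvd_int_iff)
    moreover have "\<not> p dvd i + j" using ij p_eq_half by (auto dest!: dvd_imp_le)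
    ultimately have "int p dvd int i - int j" by blast
    moreover have "\<bar>int i - int j\<bar> < int p" using ij p_eq_half by auto
    ultimately have "int i - int j = 0" by (metis dvd_imp_le_int not_le zdvd_not_zless abs_of_nonneg dvd_abs_iff abs_ge_zero abs_eq_0 order_le_less)
    thus "i = j" by simp
  qed
  have sub: "(\<lambda>j. j\<^sup>2 mod p) ` {1..half} \<subseteq> Res"
  proof
    fix x assume "x \<in> (\<lambda>j. j\<^sup>2 mod p) ` {1..half}"
    then obtain j where j: "j \<in> {1..half}" "x = j\<^sup>2 mod p" by blast
    have "chi x = chi j ^ 2" unfolding j(2) by (simp add: chi_power)
    moreover have "chi j \<noteq> 0" using nd[OF j(1)] chi_eq_0_iff by simp
    ultimately have c: "chi x = 1" using chi_cases[of j] by auto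
    hence "x \<noteq> 0" using chi_0 by (metis zero_neq_one)
    moreover have "x < p" using j(2) p_ge_5 by simp
    ultimately show "x \<in> Res" unfolding Res_def using c by simp
  qed
  have "card ((\<lambda>j. j\<^sup>2 mod p) ` {1..half}) = card Res" using card_image[OF inj] card_Res by simp
  hence "(\<lambda>j. j\<^sup>2 mod p) ` {1..half} = Res" using card_subset_eq[OF _ sub] by simp
  thus ?thesis using inj unfolding bij_betw_def by simp
qed

text \<open>The residues are represented by the squares of 1, ..., \<open>half\<close>. Replacing
  one of the two factors j by p - j costs an even number of signs, so \<open>A0\<close> is (p - 1)!
  modulo p; Wilson's theorem gives -1, and \<open>B0\<close> follows from the product of the
  two.\<close>

lemma A0_cong: "[A0 = -1] (mod int p)" and B0_cong: "[B0 = 1] (mod int p)"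
proof -
  have wil: "[fact (p - 1) = -1] (mod int p)" by (rule wilson_theorem[OF prime_p])
  have "A0 = (\<Prod>j\<in>{1..half}. int (j\<^sup>2 mod p))"
    unfolding A0_def by (rule prod.reindex_bij_betw[OF squares_bij, symmetric])
  also have "[\<dots> = (\<Prod>j\<in>{1..half}. int (j\<^sup>2))] (mod int p)"
    by (intro cong_prod) (auto simp: Cong.cong_def zmod_int)
  also have "(\<Prod>j\<in>{1..half}. int (j\<^sup>2)) = (\<Prod>j\<in>{1..half}. int j) * (\<Prod>j\<in>{1..half}. int j)"
    by (simp add: power2_eq_square prod.distrib)
  also have "[\<dots> = (\<Prod>j\<in>{1..half}. int j) * (\<Prod>j\<in>{1..half}. int (p - j))] (mod int p)"
  proof (intro cong_mult cong_refl)
    have "(\<Prod>j\<in>{1..half}. int j) = (\<Prod>j\<in>{1..half}. - int j)"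
      by (simp add: prod_uminus half_eq)
    also have "[\<dots> = (\<Prod>j\<in>{1..half}. int (p - j))] (mod int p)"
    proof (intro cong_prod)
      fix j assume "j \<in> {1..half}"
      hence "int (p - j) = int p - int j" using p_eq_half by (intro of_nat_diff) auto
      thus "[- int j = int (p - j)] (mod int p)" by (simp add: cong_iff_dvd_diff)
    qed
    finally show "[(\<Prod>j\<in>{1..half}. int j) = (\<Prod>j\<in>{1..half}. int (p - j))] (mod int p)" .
  qed
  also have "(\<Prod>j\<in>{1..half}. int j) * (\<Prod>j\<in>{1..half}. int (p - j)) = fact (p - 1)"
  proof -
    have e: "p - half = Suc half" "p - 1 = half + half" using p_eq_half by auto
    have "bij_betw (\<lambda>j. p - j) {1..half} {Suc half..p - 1}"
      by (rule bij_betwI[where g = "\<lambda>j. p - j"]) (use e in auto)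
    hence "(\<Prod>j\<in>{1..half}. int (p - j)) = (\<Prod>j\<in>{Suc half..p - 1}. int j)"
      by (rule prod.reindex_bij_betw)
    moreover have "{1..p - 1} = {1..half} \<union> {Suc half..p - 1}" using e by auto
    hence "(\<Prod>j\<in>{1..p - 1}. int j) = (\<Prod>j\<in>{1..half}. int j) * (\<Prod>j\<in>{Suc half..p - 1}. int j)"
      by (simp only:) (rule prod.union_disjoint, auto)
    ultimately show ?thesis by (simp add: fact_prod)
  qed
  finally have "[A0 = fact (p - 1)] (mod int p)" .
  thus A: "[A0 = -1] (mod int p)" using wil by (rule cong_trans)
  have "[- B0 = A0 * B0] (mod int p)" using cong_mult[OF cong_sym[OF A] cong_refl[of B0]] by simp
  also have "[A0 * B0 = -1] (mod int p)" unfolding A0_B0_fact by (rule wil)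
  finally have "[- (- B0) = - (- 1)] (mod int p)" by (subst cong_minus_minus_iff)
  thus "[B0 = 1] (mod int p)" by simp
qed

lemma padic_A0_B0: "padic 1 (of_int A0 + 1)" "padic 1 (of_int B0 - 1)"
proof -
  show "padic 1 (of_int A0 + 1)" using padic_of_int[of 1 "A0 + 1"] A0_cong by (simp add: cong_iff_dvd_diff)
  show "padic 1 (of_int B0 - 1)" using padic_of_int[of 1 "B0 - 1"] B0_cong by (simp add: cong_iff_dvd_diff)
qed

lemma even_half: "even half"
  unfolding half_eq by simp

lemma padic_power_one_plus: "padic 1 x \<Longrightarrow> padic 2 ((1 + x) ^ n - (1 + of_nat n * x))"
  using padic_prod_one_plus[of "{..<n}" "\<lambda>_. x"] by simp

text \<open>First-order expansion around A0 = -1 and B0 = 1; the even exponent \<open>half\<close>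
  allows - A0 to be expanded in place of A0.\<close>

lemma power_A0_B0: "padic 2 (of_int A0 ^ half - of_int B0 ^ half + of_nat half * (of_int A0 + of_int B0))"
proof -
  have A: "(of_int A0 :: rat) ^ half = (1 + (- (of_int A0 + 1))) ^ half"
    using even_half by simp
  have "padic 2 ((1 + (- (of_int A0 + 1))) ^ half - (1 + of_nat half * (- (of_int A0 + 1))))"
    by (rule padic_power_one_plus[OF padic_minus[OF padic_A0_B0(1)]])
  moreover have "padic 2 ((1 + (of_int B0 - 1)) ^ half - (1 + of_nat half * (of_int B0 - 1)))"
    by (rule padic_power_one_plus[OF padic_A0_B0(2)])
  ultimately have "padic 2 (((1 + (- (of_int A0 + 1))) ^ half - (1 + of_nat half * (- (of_int A0 + 1)))) -
     ((1 + (of_int B0 - 1)) ^ half - (1 + of_nat half * (of_int B0 - 1))))" by (rule padic_diff)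
  thus ?thesis unfolding A[symmetric] by (simp add: algebra_simps)
qed

text \<open>By Euler's criterion a^half is close to 1 for residues and - a^half is close to 1 for
  non-residues. A product of such factors is 1 plus the sum of the deviations modulo p^2; the number
  of signs inserted is even, and the constants cancel because the two sets have equal size.\<close>

lemma power_A0_B0_sum: "padic 2 (of_int A0 ^ half - of_int B0 ^ half - (\<Sum>j = 1..<p. of_nat j ^ half))"
proof -
  have ch: "padic 1 (of_nat a ^ half - of_int (chi a))" for a
    using padic_of_int[of 1 "int a ^ half - chi a"] chi_cong[of a] by (simp add: cong_iff_dvd_diff dvd_diff_commute)
  have R: "padic 1 (of_nat a ^ half - 1)" if "a \<in> Res" for a using ch[of a] that unfolding Res_def by simp
  have N: "padic 1 (- (of_nat a ^ half) - 1)" if "a \<in> NRes" for a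
  proof -
    have "- (of_nat a ^ half) - 1 = (- (of_nat a ^ half - of_int (chi a)) :: rat)" using that unfolding NRes_def by simp
    thus ?thesis using padic_minus[OF ch[of a]] by (simp only:)
  qed
  have 1: "padic 2 ((\<Prod>a\<in>Res. 1 + (of_nat a ^ half - 1)) - (1 + (\<Sum>a\<in>Res. of_nat a ^ half - 1)))"
    by (rule padic_prod_one_plus[OF _ R]) auto
  have 2: "padic 2 ((\<Prod>a\<in>NRes. 1 + (- (of_nat a ^ half) - 1)) - (1 + (\<Sum>a\<in>NRes. - (of_nat a ^ half) - 1)))"
    by (rule padic_prod_one_plus[OF _ N]) auto
  have A: "(\<Prod>a\<in>Res. 1 + (of_nat a ^ half - 1)) = (of_int A0 ^ half :: rat)"
    unfolding A0_def by (simp add: prod_power_distrib)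
  have B: "(\<Prod>a\<in>NRes. 1 + (- (of_nat a ^ half) - 1)) = (of_int B0 ^ half :: rat)"
    unfolding B0_def using even_half by (simp add: prod_power_distrib prod_uminus card_Res)
  have "(\<Sum>a\<in>Res. of_nat a ^ half - 1) - (\<Sum>a\<in>NRes. - (of_nat a ^ half) - 1) = (\<Sum>a\<in>Res. of_nat a ^ half) + (\<Sum>a\<in>NRes. of_nat a ^ half :: rat)"
    by (simp add: sum_subtractf sum_negf card_Res)
  also have "\<dots> = (\<Sum>j = 1..<p. of_nat j ^ half)"
    unfolding Res_Un(1)[symmetric] by (rule sum.union_disjoint[symmetric]) (use Res_Un in auto)
  finally have S: "(\<Sum>j = 1..<p. of_nat j ^ half :: rat) = (\<Sum>a\<in>Res. of_nat a ^ half - 1) - (\<Sum>a\<in>NRes. - (of_nat a ^ half) - 1)" ..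
  show ?thesis unfolding S using padic_diff[OF 1 2] unfolding A B by (simp add: algebra_simps)
qed

lemma padic_double: "padic k x \<Longrightarrow> padic k (2 * x)"
  by (rule padic_mult0(1)) auto

text \<open>The two expressions for \<open>A0 ^ half - B0 ^ half\<close> modulo \<open>p\<^sup>2\<close> are compared here;
  \<open>2 * half = p - 1\<close> turns the factor \<open>half\<close> into \<open>- 1/2\<close>.\<close>

lemma A0_plus_B0: "padic 2 (of_int A0 + of_int B0 - 2 * of_nat p * fact half * bern_coeff)"
proof -
  define X :: rat where "X = of_int A0 + of_int B0"
  define Y :: rat where "Y = of_nat p * fact half * bern_coeff"
  have X1: "padic 1 X" using padic_add[OF padic_A0_B0] unfolding X_def by simp
  have pX: "padic 2 (of_nat p * X)" using padic_mult[OF padic_p(1) X1] by (simp add: numeral_2_eq_2)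
  have "padic 2 (of_nat half * X + (\<Sum>j = 1..<p. of_nat j ^ half))"
    using padic_diff[OF power_A0_B0 power_A0_B0_sum] unfolding X_def by (simp add: algebra_simps)
  from padic_diff[OF this power_sum_mod_p2] have "padic 2 (of_nat half * X + Y)"
    unfolding Y_def by (simp add: algebra_simps)
  from padic_diff[OF pX padic_double[OF this]] have "padic 2 ((of_nat p - 2 * of_nat half) * X - 2 * Y)"
    by (simp add: algebra_simps)
  moreover have "of_nat p - 2 * of_nat half = (1 :: rat)"
    using arg_cong[OF p_eq_half, of "of_nat :: nat \<Rightarrow> rat"] by simp
  ultimately show ?thesis unfolding X_def Y_def by (simp add: mult.assoc)
qed

text \<open>With k the floor of a / p, the residue of a is a (1 - p k / a). The product of these
  factors is expanded to first order modulo p^2, which produces the sum over the integer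
  parts.\<close>

lemma product_shift:
  assumes b: "bij_betw (\<lambda>s. a s mod p) {1..half} S" and S: "S = Res \<or> S = NRes"
  shows "padic 2 ((\<Prod>s = 1..half. of_nat (a s)) - of_int (\<Prod>r\<in>S. int r) -
      of_nat p * ((\<Prod>s = 1..half. of_nat (a s)) * (\<Sum>s = 1..half. of_int \<lfloor>of_nat (a s) / of_nat p :: rat\<rfloor> * (1 / of_nat (a s)))))"
    and "padic 0 ((\<Prod>s = 1..half. of_nat (a s)) * (\<Sum>s = 1..half. of_int \<lfloor>of_nat (a s) / of_nat p :: rat\<rfloor> * (1 / of_nat (a s))))"
proof -
  have nd: "\<not> int p dvd int (a s)" if "s \<in> {1..half}" for s
  proof -
    have "a s mod p \<in> S" using b that unfolding bij_betw_def by blast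
    hence "a s mod p \<noteq> 0" using S unfolding Res_def NRes_def by auto
    hence "\<not> p dvd a s" by (simp add: dvd_eq_mod_eq_0)
    thus ?thesis by (simp only: int_dvd_int_iff not_False_eq_True)
  qed
  define x where "x s = (of_int \<lfloor>of_nat (a s) / of_nat p :: rat\<rfloor> * (1 / of_nat (a s)) :: rat)" for s
  define P :: rat where "P = (\<Prod>s = 1..half. of_nat (a s))"
  have x0: "padic 0 (x s)" if "s \<in> {1..half}" for s
    unfolding x_def using padic_divide_int[OF padic0_of_int nd[OF that]] by simp
  have P0: "padic 0 P" unfolding P_def by (intro padic0_prod) simp
  show "padic 0 (P * (\<Sum>s = 1..half. x s))" using x0 by (intro padic_mult0(1) P0 padic_sum) auto
  have factor: "of_nat (a s) * (1 + (- (of_nat p * x s))) = (of_nat (a s mod p) :: rat)" if "s \<in> {1..half}" for s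
  proof -
    have "a s \<noteq> 0" using nd[OF that] by (intro notI) simp
    hence "of_nat (a s) * (1 + (- (of_nat p * x s))) = of_nat (a s) - of_nat p * (of_nat (a s div p) :: rat)"
      unfolding x_def floor_divide_of_nat_eq by (simp add: field_simps)
    also have "\<dots> = of_nat (a s mod p)" by (metis add_diff_cancel_left' mult_div_mod_eq of_nat_add of_nat_mult)
    finally show ?thesis .
  qed
  have "of_int (\<Prod>r\<in>S. int r) = (\<Prod>s = 1..half. of_nat (a s mod p) :: rat)"
    using prod.reindex_bij_betw[OF b, of "\<lambda>r. of_nat r :: rat"] by simp
  also have "\<dots> = P * (\<Prod>s = 1..half. 1 + (- (of_nat p * x s)))"
    unfolding P_def prod.distrib[symmetric] by (intro prod.cong refl factor[symmetric])
  finally have R: "of_int (\<Prod>r\<in>S. int r) = P * (\<Prod>s = 1..half. 1 + (- (of_nat p * x s)))" .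
  have "padic 2 ((\<Prod>s = 1..half. 1 + (- (of_nat p * x s))) - (1 + (\<Sum>s = 1..half. - (of_nat p * x s))))"
    using x0 padic_mult0(2)[OF padic_p(1)] by (intro padic_prod_one_plus padic_minus) auto
  hence "padic 2 (- (P * ((\<Prod>s = 1..half. 1 + (- (of_nat p * x s))) - (1 + (\<Sum>s = 1..half. - (of_nat p * x s))))))"
    by (intro padic_minus padic_mult0(1) P0)
  moreover have "(\<Sum>s = 1..half. - (of_nat p * x s)) = - (of_nat p * (\<Sum>s = 1..half. x s))"
    by (simp add: sum_negf sum_distrib_left)
  ultimately show "padic 2 (P - of_int (\<Prod>r\<in>S. int r) - of_nat p * (P * (\<Sum>s = 1..half. x s)))"
    unfolding R by (simp add: algebra_simps)
qed

lemma Res_eq: "{r \<in> {1..<p}. QuadRes (int p) (int r)} = Res"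
    "{r \<in> {1..<p}. \<not> QuadRes (int p) (int r)} = NRes"
proof -
  have "chi r = (if QuadRes (int p) (int r) then 1 else -1)" if "r \<in> {1..<p}" for r
  proof -
    have "\<not> [int r = 0] (mod int p)" using that by (auto simp: cong_0_iff dest: dvd_imp_le)
    thus ?thesis unfolding chi_def Legendre_def by simp
  qed
  thus "{r \<in> {1..<p}. QuadRes (int p) (int r)} = Res" "{r \<in> {1..<p}. \<not> QuadRes (int p) (int r)} = NRes"
    unfolding Res_def NRes_def by (auto split: if_splits)
qed

end

context quad_unit
begin

lemma A0_plus_B0_class_number: "padic 2 (of_int A0 + of_int B0 - of_nat p * (2 * of_nat h * of_nat u / of_nat t))"
proof (rule padic_cancel_int[OF _ t_not_dvd])
  have "padic 2 (of_nat t * (of_int A0 + of_int B0 - 2 * of_nat p * fact half * bern_coeff))"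
    by (rule padic_mult0(1)[OF padic0_of_nat A0_plus_B0])
  moreover have "padic 2 (of_nat p * (2 * (of_nat t * fact half * bern_coeff - of_nat h * of_nat u)))"
    using padic_mult[OF padic_p(1) padic_double[OF log_deriv_congruence]] by (simp only: one_add_one)
  ultimately have "padic 2 (of_nat t * (of_int A0 + of_int B0 - 2 * of_nat p * fact half * bern_coeff) +
     of_nat p * (2 * (of_nat t * fact half * bern_coeff - of_nat h * of_nat u)))" by (rule padic_add)
  moreover have "of_nat t * (of_int A0 + of_int B0 - 2 * of_nat p * fact half * bern_coeff) +
     of_nat p * (2 * (of_nat t * fact half * bern_coeff - of_nat h * of_nat u))
     = of_int (int t) * (of_int A0 + of_int B0 - of_nat p * (2 * of_nat h * of_nat u / of_nat t))"
    using t_pos by (simp add: field_simps)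
  ultimately show "padic 2 (of_int (int t) * (of_int A0 + of_int B0 - of_nat p * (2 * of_nat h * of_nat u / of_nat t)))" by (simp only:)
qed

lemma padic0_quotient: "padic 0 (2 * of_nat h * of_nat u / of_nat t)"
  using padic_divide_int[OF padic0_of_nat[of "2 * h * u"] t_not_dvd] by simp

theorem class_number_congruence:
  assumes a: "complete_residue_reps p a" and b: "complete_nonresidue_reps p b"
  defines "A \<equiv> (\<Prod>s = 1..(p - 1) div 2. rat_of_nat (a s))"
    and "B \<equiv> (\<Prod>s = 1..(p - 1) div 2. rat_of_nat (b s))"
  shows "rat_cong p
    ((A + B) / of_nat p)
    (2 * of_nat h * of_nat u / of_nat t +
      (A * (\<Sum>s = 1..(p - 1) div 2. of_int \<lfloor>rat_of_nat (a s) / of_nat p\<rfloor> * (1 / of_nat (a s))) +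
       B * (\<Sum>s = 1..(p - 1) div 2. of_int \<lfloor>rat_of_nat (b s) / of_nat p\<rfloor> * (1 / of_nat (b s)))))"
proof -
  have a': "bij_betw (\<lambda>s. a s mod p) {1..half} Res"
    using a unfolding complete_residue_reps_def Res_eq half_def .
  have b': "bij_betw (\<lambda>s. b s mod p) {1..half} NRes"
    using b unfolding complete_nonresidue_reps_def Res_eq half_def .
  define SA where "SA = A * (\<Sum>s = 1..half. of_int \<lfloor>rat_of_nat (a s) / of_nat p\<rfloor> * (1 / of_nat (a s)))"
  define SB where "SB = B * (\<Sum>s = 1..half. of_int \<lfloor>rat_of_nat (b s) / of_nat p\<rfloor> * (1 / of_nat (b s)))"
  define C :: rat where "C = 2 * of_nat h * of_nat u / of_nat t"
  have A: "padic 2 (A - of_int A0 - of_nat p * SA)" "padic 0 SA"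
    using product_shift[OF a'] unfolding A_def SA_def A0_def half_def by auto
  have B: "padic 2 (B - of_int B0 - of_nat p * SB)" "padic 0 SB"
    using product_shift[OF b'] unfolding B_def SB_def B0_def half_def by auto
  have "rat_cong p ((A + B) / of_nat p) (C + (SA + SB))"
  proof (rule rat_congI)
    show "padic 0 (C + (SA + SB))" using padic0_quotient A(2) B(2) unfolding C_def by (intro padic_add)
    have "padic 2 ((A - of_int A0 - of_nat p * SA) + (B - of_int B0 - of_nat p * SB) + (of_int A0 + of_int B0 - of_nat p * C))"
      using A(1) B(1) A0_plus_B0_class_number unfolding C_def by (intro padic_add)
    moreover have "(A - of_int A0 - of_nat p * SA) + (B - of_int B0 - of_nat p * SB) + (of_int A0 + of_int B0 - of_nat p * C)
      = of_nat p * ((A + B) / of_nat p - (C + (SA + SB)))" by (simp add: field_simps)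
    ultimately have "padic 2 (of_nat p * ((A + B) / of_nat p - (C + (SA + SB))))" by simp
    thus "padic 1 ((A + B) / of_nat p - (C + (SA + SB)))"
      using padic_p_divide[of 1] by (simp add: numeral_2_eq_2)
  qed
  thus ?thesis unfolding SA_def SB_def C_def half_def .
qed

end

theorem theorem2p1:
  fixes p t u :: nat and a b :: "nat \<Rightarrow> nat"
  assumes "prime p" and "[p = 1] (mod 4)"
    and "\<And>s. s \<in> {1..(p - 1) div 2} \<Longrightarrow> a s > 0"
    and "complete_residue_reps p a"
    and "\<And>s. s \<in> {1..(p - 1) div 2} \<Longrightarrow> b s > 0"
    and "complete_nonresidue_reps p b"
    and "t > 0" and "u > 0"
    and "fundamental_unit p ((real t + real u * sqrt (real p)) / 2)"
  defines "A \<equiv> (\<Prod>s = 1..(p - 1) div 2. rat_of_nat (a s))"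
    and "B \<equiv> (\<Prod>s = 1..(p - 1) div 2. rat_of_nat (b s))"
    and "h \<equiv> class_number p"
  shows "rat_cong p
    ((A + B) / of_nat p)
    (2 * of_nat h * of_nat u / of_nat t +
      (A * (\<Sum>s = 1..(p - 1) div 2. of_int \<lfloor>rat_of_nat (a s) / of_nat p\<rfloor> * (1 / of_nat (a s))) +
       B * (\<Sum>s = 1..(p - 1) div 2. of_int \<lfloor>rat_of_nat (b s) / of_nat p\<rfloor> * (1 / of_nat (b s)))))"
proof -
  interpret quad_unit p t u
    using assms(1,2,7-9) by unfold_locales (simp_all add: Cong.cong_def)
  show ?thesis unfolding A_def B_def h_def by (rule class_number_congruence[OF assms(4,6)])
qed

end
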